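(* Fix $n\ge 1$. For every $\lambda>0$ and $V_0>0$ there exists $\varepsilon_0=\varepsilon_0(n,\lambda,V_0)>0$ such that the following holds. Let $\Omega_0\subset\mathbb{R}^n$ be a bounded open set of volume $V_0$, let $\Omega=\mathbb{R}\times\Omega_0\subset\mathbb{R}^{n+1}$, let $\Lambda>\lambda$, and let $Lu=\partial_i(a^{ij}\partial_j u)+b^i\partial_i u+cu$ have bounded coefficients $a^{ij}(x),b^i(x),c(x)$ on $\Omega$ satisfying $$\lambda|\xi|^2\le a^{ij}(x)\xi_i\xi_j,\qquad |a^{ij}(x)|\le\Lambda,\qquad |b^i(x)|\le\sqrt{\varepsilon_0},\qquad c(x)\le\varepsilon_0$$ for all $x\in\Omega$, $\xi\in\mathbb{R}^{n+1}$ and all indices $i,j$. Then for every $d>0$, $P_d=\{0\}$, where $P_d$ is the space of ancient solutions of polynomial growth of order $d$: all $u\in W^{1,2}_{loc}(\mathbb{R}^-\times\Omega)$ with $(\partial_t-L)u=0$ on $\mathbb{R}^-\times\Omega$ and $u=0$ on $\mathbb{R}^-\times\partial\Omega$ for which there is $C=C(u)>0$ with $|u(t,x)|\le C(|x|+|t|^{1/2}+1)^d$ on $\mathbb{R}^-\times\Omega$.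
   Context: Notation: $\mathbb{R}^-=(-\infty,0]$; coordinates on $\mathbb{R}^{n+1}$ are $x=(x_0,\dots,x_n)$, with $x_0$ the unbounded direction of the strip $\Omega=\mathbb{R}\times\Omega_0$; indices $i,j$ run over $0,\dots,n$ and repeated indices are summed. For $r>0$ let $D_r=(-r,r)\times\Omega_0$. Conventions: coefficients are measurable functions of $x$ only. $u\in W^{1,2}_{loc}(\mathbb{R}^-\times\Omega)$ means $u\in W^{1,2}((-T,0)\times D_R)$ for all $T,R>0$. The equation is understood weakly: $\int (\partial_t u\,\eta+a^{ij}\partial_j u\,\partial_i\eta-b^i\partial_i u\,\eta-cu\,\eta)\,dx\,dt=0$ for all $\eta\in C_c^\infty((-\infty,0)\times\Omega)$. The boundary condition means that for every $\psi\in C_c^\infty(\mathbb{R})$ and a.e. $t<0$ the function $x\mapsto\psi(x_0)u(t,x)$ lies in $W^{1,2}_0(\Omega)$. Pointwise bounds are understood almost everywhere. *)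

theory Defs
  imports "HOL-Analysis.Analysis"
begin

text \<open>
  \<open>\<real>\<^sup>n\<close> is \<^typ>\<open>real ^ 'n\<close>, and \<open>\<real>\<^sup>n\<^sup>+\<^sup>1\<close> is \<^typ>\<open>real \<times> (real ^ 'n)\<close> with \<open>x\<^sub>0\<close> as first component;
  the indices \<open>i, j = 0, \<dots>, n\<close> are the \<open>n + 1\<close> elements of \<open>Basis\<close> of this product space
  (whose norm is the Euclidean one). Space-time points are pairs \<open>(t, x)\<close>.
\<close>

type_synonym 'n space = "real \<times> (real ^ 'n)"

subsection \<open>Test functions\<close>

definition pderiv_dir :: "'a::euclidean_space \<Rightarrow> ('a \<Rightarrow> real) \<Rightarrow> 'a \<Rightarrow> real" where
  "pderiv_dir v f x = frechet_derivative f (at x) v"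

fun C_diff :: "nat \<Rightarrow> ('a::euclidean_space \<Rightarrow> real) \<Rightarrow> bool" where
  "C_diff 0 f \<longleftrightarrow> continuous_on UNIV f"
| "C_diff (Suc k) f \<longleftrightarrow> (\<forall>x. f differentiable (at x)) \<and> (\<forall>i\<in>Basis. C_diff k (pderiv_dir i f))"

text \<open>\<open>C\<^sub>c\<^sup>\<infinity>(U)\<close>, its elements being extended by zero to the whole space.\<close>

definition Cc_inf :: "'a::euclidean_space set \<Rightarrow> ('a \<Rightarrow> real) set" where
  "Cc_inf U = {\<phi>. (\<forall>k. C_diff k \<phi>) \<and> compact (closure {x. \<phi> x \<noteq> 0}) \<and> closure {x. \<phi> x \<noteq> 0} \<subseteq> U}"

subsection \<open>Weak derivatives and Sobolev spaces\<close>

text \<open>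
  Elements of the spaces below are representatives, not equivalence classes: only the values
  on \<open>U\<close> matter, and all the notions are invariant under changes on null sets.
\<close>

definition L2 :: "'a::euclidean_space set \<Rightarrow> ('a \<Rightarrow> real) set" where
  "L2 U = {f. f \<in> borel_measurable (lebesgue_on U) \<and> integrable (lebesgue_on U) (\<lambda>x. (f x)\<^sup>2)}"

definition locally_integrable :: "'a::euclidean_space set \<Rightarrow> ('a \<Rightarrow> real) \<Rightarrow> bool" where
  "locally_integrable U f \<longleftrightarrow> (\<forall>K. compact K \<and> K \<subseteq> U \<longrightarrow> integrable (lebesgue_on K) f)"

definition has_weak_deriv ::
  "'a::euclidean_space set \<Rightarrow> ('a \<Rightarrow> real) \<Rightarrow> 'a \<Rightarrow> ('a \<Rightarrow> real) \<Rightarrow> bool" where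
  "has_weak_deriv U u v g \<longleftrightarrow>
     locally_integrable U u \<and> locally_integrable U g \<and>
     (\<forall>\<eta>\<in>Cc_inf U. (LINT x|lebesgue_on U. u x * pderiv_dir v \<eta> x) = - (LINT x|lebesgue_on U. g x * \<eta> x))"

definition W12 :: "'a::euclidean_space set \<Rightarrow> ('a \<Rightarrow> real) set" where
  "W12 U = {u. u \<in> L2 U \<and> (\<forall>i\<in>Basis. \<exists>g\<in>L2 U. has_weak_deriv U u i g)}"

text \<open>The closure of \<open>C\<^sub>c\<^sup>\<infinity>(U)\<close> in \<open>W\<^sup>1\<^sup>,\<^sup>2(U)\<close>; \<open>g i\<close> is the weak \<open>i\<close>-th derivative of \<open>u\<close>.\<close>

definition W12_0 :: "'a::euclidean_space set \<Rightarrow> ('a \<Rightarrow> real) set" where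
  "W12_0 U = {u. u \<in> L2 U \<and>
     (\<exists>g. (\<forall>i\<in>Basis. g i \<in> L2 U \<and> has_weak_deriv U u i (g i)) \<and>
       (\<exists>\<phi>::nat \<Rightarrow> 'a \<Rightarrow> real. (\<forall>k. \<phi> k \<in> Cc_inf U) \<and>
         (\<lambda>k. (LINT x|lebesgue_on U. (\<phi> k x - u x)\<^sup>2) +
              (\<Sum>i\<in>Basis. LINT x|lebesgue_on U. (pderiv_dir i (\<phi> k) x - g i x)\<^sup>2)) \<longlonglongrightarrow> 0))}"

subsection \<open>Ancient solutions on the strip\<close>

definition strip :: "(real ^ 'n) set \<Rightarrow> ('n::finite) space set" where
  "strip \<Omega>\<^sub>0 = UNIV \<times> \<Omega>\<^sub>0"

definition W12_loc :: "(real ^ 'n) set \<Rightarrow> (real \<times> ('n::finite) space \<Rightarrow> real) set" where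
  "W12_loc \<Omega>\<^sub>0 = {u. \<forall>T>0. \<forall>R>0. u \<in> W12 ({-T<..<0} \<times> ({-R<..<R} \<times> \<Omega>\<^sub>0))}"

text \<open>
  The weak form of \<open>(\<partial>\<^sub>t - L) u = 0\<close>; \<open>ut\<close> and \<open>Du i\<close> are the weak derivatives \<open>\<partial>\<^sub>t u\<close> and \<open>\<partial>\<^sub>i u\<close>,
  which are unique almost everywhere.
\<close>

definition weak_solution ::
  "(real ^ 'n) set \<Rightarrow> ('n space \<Rightarrow> 'n space \<Rightarrow> 'n space \<Rightarrow> real) \<Rightarrow>
   ('n space \<Rightarrow> 'n space \<Rightarrow> real) \<Rightarrow> ('n space \<Rightarrow> real) \<Rightarrow> (real \<times> ('n::finite) space \<Rightarrow> real) \<Rightarrow> bool" where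
  "weak_solution \<Omega>\<^sub>0 a b c u \<longleftrightarrow>
     (\<exists>ut Du.
        has_weak_deriv ({..<0} \<times> strip \<Omega>\<^sub>0) u (1, 0) ut \<and>
        (\<forall>i\<in>Basis. has_weak_deriv ({..<0} \<times> strip \<Omega>\<^sub>0) u (0, i) (Du i)) \<and>
        (\<forall>\<eta>\<in>Cc_inf ({..<0} \<times> strip \<Omega>\<^sub>0).
           (LINT (t, x)|lebesgue_on ({..<0} \<times> strip \<Omega>\<^sub>0).
               ut (t, x) * \<eta> (t, x)
             + (\<Sum>i\<in>Basis. \<Sum>j\<in>Basis. a i j x * Du j (t, x) * pderiv_dir (0, i) \<eta> (t, x))
             - (\<Sum>i\<in>Basis. b i x * Du i (t, x) * \<eta> (t, x))
             - c x * u (t, x) * \<eta> (t, x)) = 0))"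

definition vanishes_on_boundary ::
  "(real ^ 'n) set \<Rightarrow> (real \<times> ('n::finite) space \<Rightarrow> real) \<Rightarrow> bool" where
  "vanishes_on_boundary \<Omega>\<^sub>0 u \<longleftrightarrow>
     (\<forall>\<psi>\<in>Cc_inf (UNIV::real set). AE t in lebesgue_on {..<0}.
        (\<lambda>x. \<psi> (fst x) * u (t, x)) \<in> W12_0 (strip \<Omega>\<^sub>0))"

definition P_space ::
  "(real ^ 'n) set \<Rightarrow> ('n space \<Rightarrow> 'n space \<Rightarrow> 'n space \<Rightarrow> real) \<Rightarrow>
   ('n space \<Rightarrow> 'n space \<Rightarrow> real) \<Rightarrow> ('n space \<Rightarrow> real) \<Rightarrow> real \<Rightarrow> (real \<times> ('n::finite) space \<Rightarrow> real) set" where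
  "P_space \<Omega>\<^sub>0 a b c d =
     {u. u \<in> W12_loc \<Omega>\<^sub>0 \<and> weak_solution \<Omega>\<^sub>0 a b c u \<and> vanishes_on_boundary \<Omega>\<^sub>0 u \<and>
         (\<exists>C>0. AE (t, x) in lebesgue_on ({..0} \<times> strip \<Omega>\<^sub>0).
            \<bar>u (t, x)\<bar> \<le> C * (norm x + sqrt \<bar>t\<bar> + 1) powr d)}"

text \<open>The representatives of the zero function on \<open>\<real>\<^sup>- \<times> \<Omega>\<close>.\<close>

definition ae_zero :: "(real ^ 'n) set \<Rightarrow> (real \<times> ('n::finite) space \<Rightarrow> real) set" where
  "ae_zero \<Omega>\<^sub>0 = {u. AE z in lebesgue_on ({..0} \<times> strip \<Omega>\<^sub>0). u z = 0}"

definition admissible_coeffs ::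
  "real \<Rightarrow> real \<Rightarrow> real \<Rightarrow> ('n::finite) space set \<Rightarrow> ('n space \<Rightarrow> 'n space \<Rightarrow> 'n space \<Rightarrow> real) \<Rightarrow>
   ('n space \<Rightarrow> 'n space \<Rightarrow> real) \<Rightarrow> ('n space \<Rightarrow> real) \<Rightarrow> bool" where
  "admissible_coeffs lam \<Lambda> \<epsilon> \<Omega> a b c \<longleftrightarrow>
     (\<forall>i\<in>Basis. \<forall>j\<in>Basis. a i j \<in> borel_measurable (lebesgue_on \<Omega>)) \<and>
     (\<forall>i\<in>Basis. b i \<in> borel_measurable (lebesgue_on \<Omega>)) \<and>
     c \<in> borel_measurable (lebesgue_on \<Omega>) \<and>
     (\<exists>K. AE x in lebesgue_on \<Omega>. \<bar>c x\<bar> \<le> K) \<and>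
     (AE x in lebesgue_on \<Omega>.
        (\<forall>\<xi>. lam * (norm \<xi>)\<^sup>2 \<le> (\<Sum>i\<in>Basis. \<Sum>j\<in>Basis. a i j x * (\<xi> \<bullet> i) * (\<xi> \<bullet> j))) \<and>
        (\<forall>i\<in>Basis. \<forall>j\<in>Basis. \<bar>a i j x\<bar> \<le> \<Lambda>) \<and>
        (\<forall>i\<in>Basis. \<bar>b i x\<bar> \<le> sqrt \<epsilon>) \<and>
        c x \<le> \<epsilon>)"

end

theory Submission
  imports Defs
begin

text \<open>
  Fix cutoffs \<open>\<zeta>(t)\<close>, vanishing for \<open>t\<close> close to \<open>0\<close>, and \<open>\<psi>(x\<^sub>0)\<close>. Testing the equation with \<open>\<zeta>\<^sup>2 \<psi>\<^sup>2 u\<close> and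
  absorbing the first-order terms into \<open>\<lambda> |\<nabla>u|\<^sup>2\<close> gives
  \<open>\<lambda>/2 \<integral> \<zeta>\<^sup>2 \<psi>\<^sup>2 |\<nabla>u|\<^sup>2 - C\<epsilon> \<integral> \<zeta>\<^sup>2 \<psi>\<^sup>2 u\<^sup>2 \<le> \<integral> \<zeta> \<zeta>' \<psi>\<^sup>2 u\<^sup>2 + M \<integral> \<zeta>\<^sup>2 \<psi>'\<^sup>2 u\<^sup>2\<close>, where \<open>C\<close> does not depend on
  \<open>\<Lambda>\<close>. The Poincare inequality on the cross-section, whose constant depends only on \<open>n\<close> and \<open>V\<^sub>0\<close>, bounds the
  left-hand side from below by \<open>\<kappa> \<integral> \<zeta>\<^sup>2 \<psi>\<^sup>2 u\<^sup>2\<close> with \<open>\<kappa> > 0\<close> as soon as \<open>\<epsilon>\<close> is small. For cutoffs that are \<open>m\<close>-th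
  powers of a bump at scale \<open>T\<close>, Young's inequality absorbs the right-hand side up to an error
  \<open>O(T\<^sup>-\<^sup>2\<^sup>m) \<integral> u\<^sup>2\<close> over a box of size \<open>T\<close> (the part of \<open>\<zeta>'\<close> that is not small has a good sign). Against polynomial
  growth this tends to \<open>0\<close> when \<open>m\<close> is large, so \<open>u = 0\<close>.
\<close>

section \<open>Smooth functions\<close>

text \<open>The obstacle is that \<open>\<zeta>\<^sup>2 \<psi>\<^sup>2 u\<close> is not an
  admissible test function. The boundary condition only concerns single time slices, and the test
  functions approximating a slice come with no uniformity and no measurability in time, so they
  cannot be assembled into an approximation of \<open>u\<close> in space-time. Therefore two time
  variables are used. For fixed \<open>s\<close> the slice \<open>u(s, x)\<close> is a function of
  \<open>x\<close> alone; multiplied by a smooth function of \<open>t\<close> it can be approximated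
  and inserted into the equation. Only the resulting identity is integrated over \<open>s\<close>,
  and a mollifier in \<open>t - s\<close> brings the two times together in the limit.

  The bound \<open>\<Lambda>\<close> stays out of \<open>\<epsilon>\<close> because it occurs only
  next to \<open>\<psi>'\<close>, where the scale \<open>T\<close> compensates it, whereas
  \<open>\<epsilon>\<close> only has to beat \<open>\<kappa>\<close>. The order \<open>d\<close>
  enters only through the exponent \<open>m\<close>, chosen when all other constants are fixed; so
  one \<open>\<epsilon>\<close> serves every \<open>d\<close>.\<close>

definition smooth :: "('a::euclidean_space \<Rightarrow> real) \<Rightarrow> bool" where
  "smooth f \<longleftrightarrow> (\<forall>k. C_diff k f)"

lemma pderiv_dir_eq: "(f has_derivative f') (at x) \<Longrightarrow> pderiv_dir v f x = f' v"
  by (simp add: pderiv_dir_def frechet_derivative_at[symmetric])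

lemma C_diff_Suc_imp: "C_diff (Suc k) f \<Longrightarrow> C_diff k f"
proof (induction k arbitrary: f)
  case 0
  then show ?case
    by (auto intro!: differentiable_imp_continuous_on simp: differentiable_on_def differentiable_at_withinI)
next
  case (Suc k)
  then show ?case by simp
qed

lemma C_diff_const: "C_diff k (\<lambda>x::'a::euclidean_space. c)"
proof (induction k arbitrary: c)
  case (Suc k)
  have "pderiv_dir i (\<lambda>x::'a. c) = (\<lambda>x. 0)" for i
    by (rule ext, rule pderiv_dir_eq[THEN trans]) (auto intro: derivative_eq_intros)
  with Suc show ?case by simp
qed simp

lemma C_diff_add: "C_diff k f \<Longrightarrow> C_diff k g \<Longrightarrow> C_diff k (\<lambda>x. f x + g x)"
proof (induction k arbitrary: f g)
  case 0 then show ?case by (auto intro: continuous_intros)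
next
  case (Suc k)
  have "pderiv_dir i (\<lambda>x. f x + g x) = (\<lambda>x. pderiv_dir i f x + pderiv_dir i g x)" for i
  proof
    fix x
    from Suc.prems have "(f has_derivative frechet_derivative f (at x)) (at x)"
       "(g has_derivative frechet_derivative g (at x)) (at x)"
      by (auto simp: frechet_derivative_works)
    from pderiv_dir_eq[OF has_derivative_add[OF this]] show
      "pderiv_dir i (\<lambda>x. f x + g x) x = pderiv_dir i f x + pderiv_dir i g x"
      by (simp add: pderiv_dir_def)
  qed
  with Suc show ?case by auto
qed

lemma C_diff_mult: "C_diff k f \<Longrightarrow> C_diff k g \<Longrightarrow> C_diff k (\<lambda>x. f x * g x)"
proof (induction k arbitrary: f g)
  case 0 then show ?case by (auto intro: continuous_intros)
next
  case (Suc k)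
  have *: "pderiv_dir i (\<lambda>x. f x * g x) = (\<lambda>x. f x * pderiv_dir i g x + pderiv_dir i f x * g x)" for i
  proof
    fix x
    from Suc.prems have "(f has_derivative frechet_derivative f (at x)) (at x)"
       "(g has_derivative frechet_derivative g (at x)) (at x)"
      by (auto simp: frechet_derivative_works)
    from pderiv_dir_eq[OF has_derivative_mult[OF this]] show
      "pderiv_dir i (\<lambda>x. f x * g x) x = f x * pderiv_dir i g x + pderiv_dir i f x * g x"
      by (simp add: pderiv_dir_def)
  qed
  \<comment> \<open>The product rule multiplies derivatives by undifferentiated factors, so the
    induction also needs \<open>f\<close> and \<open>g\<close> themselves at level
    \<open>k\<close>.\<close>
  have "C_diff k f" "C_diff k g" using Suc.prems by (auto intro: C_diff_Suc_imp simp del: C_diff.simps)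
  then show ?case using Suc by (auto simp: * intro!: C_diff_add)
qed

lemma C_diff_sum: "(\<And>i. i \<in> I \<Longrightarrow> C_diff k (f i)) \<Longrightarrow> C_diff k (\<lambda>x. \<Sum>i\<in>I. f i x)"
  by (induction I rule: infinite_finite_induct) (auto intro: C_diff_const C_diff_add)

text \<open>\<open>C_diff\<close> speaks of derivatives in basis directions only. The derivative of
  the composition along \<open>i\<close> is that of \<open>f\<close> along \<open>L i\<close>, so it
  is expanded in the basis of the target to close the induction.\<close>

lemma C_diff_affine:
  fixes L :: "'a::euclidean_space \<Rightarrow> 'b::euclidean_space"
  assumes L: "bounded_linear L"
  shows "C_diff k f \<Longrightarrow> C_diff k (\<lambda>x. f (L x + c))"
proof (induction k arbitrary: f)
  case 0
  have "continuous_on UNIV (\<lambda>x. L x + c)"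
    by (intro continuous_intros linear_continuous_on L)
  from continuous_on_compose2[OF _ this, of UNIV f] 0 show ?case by simp
next
  case (Suc k)
  have D: "((\<lambda>x. f (L x + c)) has_derivative (\<lambda>h. frechet_derivative f (at (L x + c)) (L h))) (at x)" for x
  proof -
    have 1: "((\<lambda>x. L x + c) has_derivative L) (at x)"
      by (auto intro!: derivative_eq_intros bounded_linear_imp_has_derivative L)
    have 2: "(f has_derivative frechet_derivative f (at (L x + c))) (at (L x + c))"
      using Suc.prems by (auto simp: frechet_derivative_works)
    show ?thesis using has_derivative_compose[OF 1 2] .
  qed
  have "pderiv_dir i (\<lambda>x. f (L x + c)) = (\<lambda>x. \<Sum>j\<in>Basis. (L i \<bullet> j) * pderiv_dir j f (L x + c))" for i
  proof
    fix x
    have lin: "linear (frechet_derivative f (at (L x + c)))"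
      using Suc.prems by (auto intro!: linear_frechet_derivative)
    have "frechet_derivative f (at (L x + c)) (L i)
      = frechet_derivative f (at (L x + c)) (\<Sum>j\<in>Basis. (L i \<bullet> j) *\<^sub>R j)"
      by (simp add: euclidean_representation)
    also have "\<dots> = (\<Sum>j\<in>Basis. (L i \<bullet> j) * pderiv_dir j f (L x + c))"
      by (simp add: linear_sum[OF lin] linear_scale[OF lin] pderiv_dir_def)
    finally show "pderiv_dir i (\<lambda>x. f (L x + c)) x = (\<Sum>j\<in>Basis. (L i \<bullet> j) * pderiv_dir j f (L x + c))"
      using pderiv_dir_eq[OF D[of x]] by simp
  qed
  moreover have "(\<lambda>x. f (L x + c)) differentiable (at x)" for x
    using D[of x] by (auto simp: differentiable_def)
  ultimately show ?case using Suc
    by (auto intro!: C_diff_sum C_diff_mult C_diff_const)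
qed

lemma smooth_const [simp, intro]: "smooth (\<lambda>x. c)"
  by (simp add: smooth_def C_diff_const)

lemma smooth_mult: "smooth f \<Longrightarrow> smooth g \<Longrightarrow> smooth (\<lambda>x. f x * g x)"
  by (simp add: smooth_def C_diff_mult)

lemma smooth_prod: "(\<And>i. i \<in> I \<Longrightarrow> smooth (f i)) \<Longrightarrow> smooth (\<lambda>x. \<Prod>i\<in>I. f i x)"
  by (induction I rule: infinite_finite_induct) (auto intro: smooth_mult)

lemma smooth_power: "smooth f \<Longrightarrow> smooth (\<lambda>x. f x ^ n)"
  by (induction n) (auto intro: smooth_mult)

lemma smooth_affine: "bounded_linear L \<Longrightarrow> smooth f \<Longrightarrow> smooth (\<lambda>x. f (L x + c))"
  by (simp add: smooth_def C_diff_affine)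

lemma smooth_fst: "smooth f \<Longrightarrow> smooth (\<lambda>x. f (fst x))"
  using smooth_affine[OF bounded_linear_fst, of f 0] by simp

lemma smooth_snd: "smooth f \<Longrightarrow> smooth (\<lambda>x. f (snd x))"
  using smooth_affine[OF bounded_linear_snd, of f 0] by simp

lemma smooth_scale: fixes f :: "real \<Rightarrow> real" shows "smooth f \<Longrightarrow> smooth (\<lambda>x. f (a * x + c))"
  using smooth_affine[OF bounded_linear_mult_right, of f a c] by simp

lemma smooth_continuous: "smooth f \<Longrightarrow> continuous_on A f"
  unfolding smooth_def using C_diff.simps(1) continuous_on_subset by blast

lemma smooth_has_derivative:
  "smooth f \<Longrightarrow> (f has_derivative (\<lambda>v. pderiv_dir v f x)) (at x)"
  unfolding smooth_def pderiv_dir_def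
  by (metis C_diff.simps(2) eta_contract_eq frechet_derivative_works)

lemma smooth_pderiv_Basis: "smooth f \<Longrightarrow> i \<in> Basis \<Longrightarrow> smooth (pderiv_dir i f)"
  unfolding smooth_def using C_diff.simps(2) by blast

lemma smooth_has_real_derivative:
  assumes "smooth f" shows "(f has_real_derivative pderiv_dir 1 f x) (at x)"
proof -
  obtain D where D: "(f has_real_derivative D) (at x)"
    using smooth_has_derivative[OF assms, of x] by (meson differentiable_def real_differentiableE)
  then have "pderiv_dir 1 f x = D"
    unfolding has_field_derivative_def by (drule_tac pderiv_dir_eq[of f _ x 1]) simp
  with D show ?thesis by simp
qed

lemma pderiv_dir_mult:
  "smooth f \<Longrightarrow> smooth g \<Longrightarrow>
    pderiv_dir v (\<lambda>x. f x * g x) x = f x * pderiv_dir v g x + pderiv_dir v f x * g x"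
  by (rule pderiv_dir_eq[OF has_derivative_mult]; rule smooth_has_derivative)

lemma pderiv_dir_fst: "smooth f \<Longrightarrow> pderiv_dir v (\<lambda>x. f (fst x)) x = pderiv_dir (fst v) f (fst x)"
  by (rule pderiv_dir_eq[OF has_derivative_compose[OF bounded_linear_imp_has_derivative[OF bounded_linear_fst] smooth_has_derivative]])

lemma pderiv_dir_snd: "smooth f \<Longrightarrow> pderiv_dir v (\<lambda>x. f (snd x)) x = pderiv_dir (snd v) f (snd x)"
  by (rule pderiv_dir_eq[OF has_derivative_compose[OF bounded_linear_imp_has_derivative[OF bounded_linear_snd] smooth_has_derivative]])

lemma pderiv_dir_0: "smooth f \<Longrightarrow> pderiv_dir 0 f x = 0"
  using smooth_has_derivative[of f x] has_derivative_bounded_linear linear_simps(3) by fastforce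

subsection \<open>The standard bump\<close>

text \<open>Every derivative has the form \<open>p (1/x) exp (-1/x)\<close> with a polynomial \<open>p\<close>.\<close>

definition ebump_poly :: "real poly \<Rightarrow> real \<Rightarrow> real" where
  "ebump_poly p x = (if x > 0 then poly p (1 / x) * exp (- (1 / x)) else 0)"

definition ebump :: "real \<Rightarrow> real" where
  "ebump x = (if x > 0 then exp (- (1 / x)) else 0)"

lemma poly_exp_tendsto: "((\<lambda>x::real. poly p x * exp (- x)) \<longlongrightarrow> 0) at_top"
proof -
  have "((\<lambda>x::real. \<Sum>i\<le>degree p. coeff p i * (x ^ i / exp x)) \<longlongrightarrow> (\<Sum>i\<le>degree p. coeff p i * 0)) at_top"
    by (intro tendsto_intros tendsto_power_div_exp_0)
  moreover have "(\<lambda>x::real. \<Sum>i\<le>degree p. coeff p i * (x ^ i / exp x)) = (\<lambda>x. poly p x * exp (- x))"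
    by (simp add: poly_altdef sum_distrib_right exp_minus field_simps sum_divide_distrib)
  ultimately show ?thesis by simp
qed

lemma ebump_poly_tendsto: "(ebump_poly p \<longlongrightarrow> 0) (at 0)"
proof (subst filterlim_at_split, intro conjI)
  show "(ebump_poly p \<longlongrightarrow> 0) (at_left 0)"
    by (rule tendsto_eventually) (auto simp: ebump_poly_def eventually_at_filter)
  have "filterlim (\<lambda>x::real. 1 / x) at_top (at_right 0)"
    using filterlim_inverse_at_top_right by (simp add: inverse_eq_divide)
  from filterlim_compose[OF poly_exp_tendsto this]
  have "((\<lambda>x::real. poly p (1 / x) * exp (- (1 / x))) \<longlongrightarrow> 0) (at_right 0)" .
  then show "(ebump_poly p \<longlongrightarrow> 0) (at_right 0)"
    by (rule Lim_transform_eventually) (auto simp: ebump_poly_def eventually_at_filter)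
qed

text \<open>With y = 1/x, the derivative of p(y) exp(-y) in x is y^2 (p(y) - p'(y)) exp(-y). The
  class is thus closed under differentiation, and smoothness follows by induction on the
  order.\<close>

lemma ebump_poly_deriv:
  "(ebump_poly p has_real_derivative ebump_poly ([:0,0,1:] * (p - pderiv p)) x) (at x)"
proof -
  consider "x > 0" | "x < 0" | "x = 0" by linarith
  then show ?thesis
  proof cases
    case 1
    have "((\<lambda>x. poly p (1 / x) * exp (- (1 / x))) has_real_derivative
      poly (pderiv p) (1/x) * (-1/(x*x)) * exp (- (1 / x)) + exp (- (1 / x)) * (1 / (x * x)) * poly p (1/x)) (at x)"
    proof -
      have inv: "((\<lambda>x. 1 / x) has_real_derivative - 1 / (x * x)) (at x)"
        using 1 by (auto intro!: derivative_eq_intros)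
      have "((\<lambda>x. exp (- (1 / x))) has_real_derivative exp (- (1 / x)) * (1 / (x * x))) (at x)"
        using 1 by (auto intro!: derivative_eq_intros)
      from DERIV_mult[OF DERIV_chain2[OF poly_DERIV inv] this] show ?thesis .
    qed
    then have "((\<lambda>x. poly p (1 / x) * exp (- (1 / x))) has_real_derivative
        ebump_poly ([:0,0,1:] * (p - pderiv p)) x) (at x)"
      by (rule DERIV_cong) (use 1 in \<open>simp add: ebump_poly_def algebra_simps\<close>)
    then show ?thesis
      by (rule has_field_derivative_transform_within_open[of _ _ _ "{0<..}"]) (use 1 in \<open>auto simp: ebump_poly_def\<close>)
  next
    case 2
    have "((\<lambda>x. 0) has_real_derivative 0) (at x)" by simp
    then show ?thesis using 2 
      by (intro has_field_derivative_transform_within_open[of "\<lambda>x. 0" _ _ "{..<0}" "ebump_poly p"]) (auto simp: ebump_poly_def)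
  next
    case 3
    \<comment> \<open>At 0 the difference quotient belongs to the same class, with the polynomial X
      p, and so tends to 0.\<close>
    have "((\<lambda>h. (ebump_poly p (0 + h) - ebump_poly p 0) / h) \<longlongrightarrow> 0) (at 0)"
      using ebump_poly_tendsto[of "[:0,1:] * p"]
      by (rule Lim_transform_eventually) (auto simp: ebump_poly_def eventually_at_filter)
    then show ?thesis using 3 by (simp add: DERIV_def ebump_poly_def)
  qed
qed

lemma pderiv_dir_real: "(f has_real_derivative D) (at x) \<Longrightarrow> pderiv_dir 1 f x = D"
  unfolding has_field_derivative_def by (drule pderiv_dir_eq[of f _ x 1]) simp

lemma C_diff_ebump_poly: "C_diff k (ebump_poly p)"
proof (induction k arbitrary: p)
  case 0
  show ?case unfolding C_diff.simps
    by (intro continuous_at_imp_continuous_on ballI DERIV_isCont[OF ebump_poly_deriv])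
next
  case (Suc k)
  have "pderiv_dir 1 (ebump_poly p) = ebump_poly ([:0,0,1:] * (p - pderiv p))"
    by (rule ext) (rule pderiv_dir_real[OF ebump_poly_deriv])
  moreover have "ebump_poly p differentiable (at x)" for x
    using ebump_poly_deriv[of p x] unfolding real_differentiable_def by blast
  moreover have "C_diff k (ebump_poly ([:0,0,1:] * (p - pderiv p)))" by (rule Suc)
  ultimately show ?case by simp
qed

lemma smooth_ebump: "smooth ebump"
proof -
  have "ebump = ebump_poly 1" by (rule ext) (simp add: ebump_def ebump_poly_def)
  with C_diff_ebump_poly[of _ 1] show ?thesis unfolding smooth_def by simp
qed

lemma ebump_range: "0 \<le> ebump x" "ebump x \<le> 1" and ebump_pos: "x > 0 \<Longrightarrow> ebump x > 0"
  and ebump_0: "x \<le> 0 \<Longrightarrow> ebump x = 0"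
  by (auto simp: ebump_def)

lemma ebump_mono: "x \<le> y \<Longrightarrow> ebump x \<le> ebump y"
  by (auto simp: ebump_def frac_le)

lemma ebump_scale_tendsto: "x > 0 \<Longrightarrow> (\<lambda>k. ebump (real k * x)) \<longlonglongrightarrow> 1"
proof -
  assume x: "x > 0"
  have "(\<lambda>k. exp (- ((1 / x) * (1 / real k)))) \<longlonglongrightarrow> exp (- ((1 / x) * 0))"
    by (intro tendsto_intros lim_1_over_n)
  then have "(\<lambda>k. exp (- ((1 / x) * (1 / real k)))) \<longlonglongrightarrow> 1" by simp
  moreover have "eventually (\<lambda>k. exp (- ((1 / x) * (1 / real k))) = ebump (real k * x)) sequentially"
    using eventually_gt_at_top[of 0] by eventually_elim (use x in \<open>auto simp: ebump_def field_simps\<close>)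
  ultimately show ?thesis by (rule Lim_transform_eventually)
qed

definition bump :: "real \<Rightarrow> real" where
  "bump x = ebump (1 - x) * ebump (1 + x)"

lemma smooth_bump: "smooth bump"
proof -
  have "bump = (\<lambda>x. ebump (- 1 * x + 1) * ebump (1 * x + 1))"
    by (simp add: bump_def fun_eq_iff add.commute)
  then show ?thesis using smooth_mult[OF smooth_scale[OF smooth_ebump, of "-1" 1] smooth_scale[OF smooth_ebump, of 1 1]]
    by (simp only:)
qed

lemma bump_range: "0 \<le> bump x" "bump x \<le> 1"
  unfolding bump_def using ebump_range[of "1 - x"] ebump_range[of "1 + x"] by (auto intro!: mult_le_one)

lemma bump_0: "\<bar>x\<bar> \<ge> 1 \<Longrightarrow> bump x = 0"
  using ebump_0[of "1 - x"] ebump_0[of "1 + x"] unfolding bump_def by (cases "x \<ge> 1") auto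

lemma bump_even: "bump (- x) = bump x"
  by (simp add: bump_def)

lemma bump_ge: "\<bar>x\<bar> \<le> 1/2 \<Longrightarrow> bump x \<ge> (ebump (1/2))\<^sup>2"
  unfolding bump_def power2_eq_square by (intro mult_mono ebump_mono ebump_range) auto

subsection \<open>Test functions\<close>

lemma Cc_infI:
  assumes "smooth \<phi>" "compact K" "K \<subseteq> U" "\<And>x. x \<notin> K \<Longrightarrow> \<phi> x = 0"
  shows "\<phi> \<in> Cc_inf U"
proof -
  have "{x. \<phi> x \<noteq> 0} \<subseteq> K" using assms by auto
  then have cl: "closure {x. \<phi> x \<noteq> 0} \<subseteq> K" using assms(2) by (simp add: closure_minimal compact_imp_closed)
  then have "K \<inter> closure {x. \<phi> x \<noteq> 0} = closure {x. \<phi> x \<noteq> 0}" by blast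
  with compact_Int_closed[OF assms(2), of "closure {x. \<phi> x \<noteq> 0}"]
  have "compact (closure {x. \<phi> x \<noteq> 0})" by simp
  with cl assms(1,3) show ?thesis unfolding Cc_inf_def smooth_def by blast
qed

lemma Cc_inf_smooth: "\<phi> \<in> Cc_inf U \<Longrightarrow> smooth \<phi>"
  by (simp add: Cc_inf_def smooth_def)

lemma Cc_infE:
  assumes "\<phi> \<in> Cc_inf U"
  obtains K where "compact K" "K \<subseteq> U" "\<And>x. x \<notin> K \<Longrightarrow> \<phi> x = 0" "\<And>v x. x \<notin> K \<Longrightarrow> pderiv_dir v \<phi> x = 0"
proof
  let ?K = "closure {x. \<phi> x \<noteq> 0}"
  show "compact ?K" "?K \<subseteq> U" using assms by (auto simp: Cc_inf_def)
  show z: "\<phi> x = 0" if "x \<notin> ?K" for x using that closure_subset[of "{x. \<phi> x \<noteq> 0}"] by blast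
  show "pderiv_dir v \<phi> x = 0" if "x \<notin> ?K" for v x
  proof -
    have "((\<lambda>x. 0::real) has_derivative (\<lambda>x. 0)) (at x)" by simp
    then have "(\<phi> has_derivative (\<lambda>x. 0)) (at x)"
    proof (rule has_derivative_transform_within_open)
      show "open (- ?K)" "x \<in> - ?K" using that by auto
      show "0 = \<phi> y" if "y \<in> - ?K" for y using z[of y] that by simp
    qed
    then show ?thesis by (rule pderiv_dir_eq)
  qed
qed

lemma Cc_inf_mono: "U \<subseteq> V \<Longrightarrow> \<phi> \<in> Cc_inf U \<Longrightarrow> \<phi> \<in> Cc_inf V"
  by (auto simp: Cc_inf_def)

lemma Cc_inf_zero: "(\<lambda>x. 0) \<in> Cc_inf U"
  by (rule Cc_infI[of _ "{}"]) auto

lemma Cc_inf_mult: "\<phi> \<in> Cc_inf U \<Longrightarrow> smooth \<psi> \<Longrightarrow> (\<lambda>x. \<psi> x * \<phi> x) \<in> Cc_inf U"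
  by (frule Cc_inf_smooth, erule Cc_infE, rule Cc_infI) (auto intro: smooth_mult)

lemma Cc_inf_tensor:
  assumes "\<theta> \<in> Cc_inf A" "\<phi> \<in> Cc_inf B"
  shows "(\<lambda>z. \<theta> (fst z) * \<phi> (snd z)) \<in> Cc_inf (A \<times> B)"
proof -
  obtain K where K: "compact K" "K \<subseteq> A" "\<And>x. x \<notin> K \<Longrightarrow> \<theta> x = 0" using Cc_infE[OF assms(1)] by metis
  obtain L where L: "compact L" "L \<subseteq> B" "\<And>x. x \<notin> L \<Longrightarrow> \<phi> x = 0" using Cc_infE[OF assms(2)] by metis
  show ?thesis
  proof (rule Cc_infI)
    show "smooth (\<lambda>z. \<theta> (fst z) * \<phi> (snd z))"
      using assms by (intro smooth_mult smooth_fst smooth_snd Cc_inf_smooth)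
    show "compact (K \<times> L)" "K \<times> L \<subseteq> A \<times> B" using K L by (auto intro: compact_Times)
    show "\<theta> (fst z) * \<phi> (snd z) = 0" if "z \<notin> K \<times> L" for z
      using that K(3)[of "fst z"] L(3)[of "snd z"] by (auto simp: mem_Times_iff)
  qed
qed

lemma continuous_zero_outside_bounded:
  fixes f :: "'a::euclidean_space \<Rightarrow> real"
  assumes "continuous_on UNIV f" "compact K" "\<And>x. x \<notin> K \<Longrightarrow> f x = 0"
  obtains B where "B > 0" "\<And>x. \<bar>f x\<bar> \<le> B"
proof -
  have "compact (f ` K)" using assms by (intro compact_continuous_image) (auto intro: continuous_on_subset)
  then obtain B where "\<And>x. x \<in> K \<Longrightarrow> \<bar>f x\<bar> \<le> B" using compact_imp_bounded bounded_iff[of "f ` K"] by auto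
  then have "\<bar>f x\<bar> \<le> max B 1" for x using assms(3)[of x] by (cases "x \<in> K") force+
  then show ?thesis using that[of "max B 1"] by auto
qed

lemma Cc_inf_bounded:
  assumes "\<phi> \<in> Cc_inf U"
  obtains B where "B > 0" "\<And>x. \<bar>\<phi> x\<bar> \<le> B"
proof -
  obtain K where "compact K" "\<And>x. x \<notin> K \<Longrightarrow> \<phi> x = 0" using Cc_infE[OF assms] by metis
  from continuous_zero_outside_bounded[OF smooth_continuous[OF Cc_inf_smooth[OF assms]] this] that show ?thesis
    by blast
qed

lemma Cc_inf_pderiv: "\<phi> \<in> Cc_inf U \<Longrightarrow> i \<in> Basis \<Longrightarrow> pderiv_dir i \<phi> \<in> Cc_inf U"
  by (frule Cc_inf_smooth, erule Cc_infE, rule Cc_infI) (auto intro: smooth_pderiv_Basis)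

lemma smooth_borel_measurable: "smooth f \<Longrightarrow> f \<in> borel_measurable borel"
  by (intro borel_measurable_continuous_onI smooth_continuous)

section \<open>Borel representatives and the fundamental lemma of the calculus of variations\<close>

text \<open>Fubini is used for \<open>lborel\<close>, which is a product measure; its completion is
  not, and slices of a Lebesgue measurable function can fail to be measurable. Hence all data are
  exchanged for Borel functions on the whole space that vanish off \<open>U\<close>.\<close>

lemma borel_rep:
  fixes f :: "'a::euclidean_space \<Rightarrow> real"
  assumes f: "f \<in> borel_measurable (lebesgue_on U)" and U: "U \<in> sets borel"
  obtains g where "g \<in> borel_measurable borel" "AE x in lborel. x \<in> U \<longrightarrow> g x = f x" "\<And>x. x \<notin> U \<Longrightarrow> g x = 0"
proof -
  have "(\<lambda>x. if x \<in> U then f x else 0) \<in> borel_measurable lebesgue"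
    using borel_measurable_if_I[OF f] U by simp
  from completion_ex_borel_measurable_real[OF this] obtain g where
    g: "g \<in> borel_measurable lborel" "AE x in lborel. (if x \<in> U then f x else 0) = g x" by blast
  show ?thesis
  proof (rule that[of "\<lambda>x. indicator U x * g x"])
    show "(\<lambda>x. indicator U x * g x) \<in> borel_measurable borel"
      using g(1) U by (intro borel_measurable_times borel_measurable_indicator) auto
    show "AE x in lborel. x \<in> U \<longrightarrow> indicator U x * g x = f x"
      using g(2) by eventually_elim auto
  qed auto
qed

lemma
  fixes F G :: "'a::euclidean_space \<Rightarrow> real"
  assumes G: "G \<in> borel_measurable borel" and U: "U \<in> sets borel"
    and eq: "AE x in lborel. x \<in> U \<longrightarrow> G x = F x" and 0: "\<And>x. x \<notin> U \<Longrightarrow> G x = 0"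
  shows LINT_rep: "(LINT x|lebesgue_on U. F x) = (LINT x|lborel. G x)"
    and integrable_rep: "integrable (lebesgue_on U) F \<longleftrightarrow> integrable lborel G"
    and measurable_rep: "F \<in> borel_measurable (lebesgue_on U)"
proof -
  have AE: "AE x in lebesgue. G x = indicator U x *\<^sub>R F x"
    using AE_completion[OF eq] by eventually_elim (auto simp: 0 indicator_def)
  have Gl: "G \<in> borel_measurable lebesgue" using G by (intro measurable_completion) auto
  from borel_measurable_AE[OF Gl AE] have m: "(\<lambda>x. indicator U x *\<^sub>R F x) \<in> borel_measurable lebesgue" .
  have U': "U \<in> sets lebesgue" "U \<inter> space lebesgue \<in> sets lebesgue" using U by auto
  have "(LINT x|lebesgue_on U. F x) = (LINT x|lebesgue. indicator U x *\<^sub>R F x)"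
    using U' by (intro integral_restrict_space) auto
  also have "\<dots> = (LINT x|lebesgue. G x)"
    by (rule integral_cong_AE[OF m Gl]) (use AE in eventually_elim, simp)
  also have "\<dots> = (LINT x|lborel. G x)" using G by (intro integral_completion) auto
  finally show "(LINT x|lebesgue_on U. F x) = (LINT x|lborel. G x)" .
  have "integrable (lebesgue_on U) F \<longleftrightarrow> integrable lebesgue (\<lambda>x. indicator U x *\<^sub>R F x)"
    using U' by (intro integrable_restrict_space) auto
  also have "\<dots> \<longleftrightarrow> integrable lebesgue G"
    by (rule integrable_cong_AE[OF m Gl]) (use AE in eventually_elim, simp)
  also have "\<dots> \<longleftrightarrow> integrable lborel G" using G by (intro integrable_completion) auto
  finally show "integrable (lebesgue_on U) F \<longleftrightarrow> integrable lborel G" .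
  show "F \<in> borel_measurable (lebesgue_on U)"
  proof (rule borel_measurable_if_D)
    show "(\<lambda>x. if x \<in> U then F x else 0) \<in> borel_measurable lebesgue"
      using m by (rule back_subst[of "\<lambda>f. f \<in> borel_measurable lebesgue"]) (auto simp: indicator_def)
  qed
qed

lemma AE_lebesgue_on_iff:
  assumes "U \<in> sets borel"
  shows "(AE x in lebesgue_on U. P x) \<longleftrightarrow> (AE x in lborel. x \<in> (U::'a::euclidean_space set) \<longrightarrow> P x)"
  using assms by (subst AE_restrict_space_iff) (auto simp: AE_completion_iff)

text \<open>Local integrability gives measurability on compact sets only. Along a compact exhaustion
  of \<open>U\<close> the truncations of \<open>f\<close> converge pointwise, which yields
  measurability on all of \<open>U\<close> and reduces the claim to
  \<open>borel_rep\<close>.\<close>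

lemma locally_integrable_rep:
  fixes f :: "'a::euclidean_space \<Rightarrow> real"
  assumes U: "open U" and f: "locally_integrable U f"
  obtains g where "g \<in> borel_measurable borel" "AE x in lborel. x \<in> U \<longrightarrow> g x = f x" "\<And>x. x \<notin> U \<Longrightarrow> g x = 0"
    "\<And>K. compact K \<Longrightarrow> K \<subseteq> U \<Longrightarrow> integrable lborel (\<lambda>x. indicator K x * g x)"
proof -
  obtain C :: "nat \<Rightarrow> 'a set" where C: "\<And>n. compact (C n)" "\<And>n. C n \<subseteq> U" "\<And>n. C n \<subseteq> interior (C (Suc n))" "\<Union>(range C) = U"
    using open_Union_compact_subsets[OF U] by metis
  have mono: "C m \<subseteq> C n" if "m \<le> n" for m n
    using that by (rule lift_Suc_mono_le[rotated]) (use C(3) interior_subset in blast)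
  let ?f = "\<lambda>n x. if x \<in> C n then f x else 0"
  have m: "?f n \<in> borel_measurable lebesgue" for n
  proof (rule borel_measurable_if_I)
    show "f \<in> borel_measurable (lebesgue_on (C n))"
      using f C(1,2)[of n] by (auto simp: locally_integrable_def)
    show "C n \<in> sets lebesgue" using C(1)[of n] by (simp add: fmeasurableD lmeasurable_compact)
  qed
  have "(\<lambda>x. if x \<in> U then f x else 0) \<in> borel_measurable lebesgue"
  proof (rule borel_measurable_LIMSEQ_real[OF _ m])
    show "(\<lambda>n. ?f n x) \<longlonglongrightarrow> (if x \<in> U then f x else 0)" for x
    proof (cases "x \<in> U")
      case True
      then obtain N where "x \<in> C N" using C(4) by blast
      then have "\<And>n. n \<ge> N \<Longrightarrow> x \<in> C n" using mono by blast
      then have "eventually (\<lambda>n. (if x \<in> U then f x else 0) = ?f n x) sequentially"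
        using True by (auto simp: eventually_sequentially)
      then show ?thesis by (rule Lim_transform_eventually[OF tendsto_const])
    qed (use C in \<open>auto intro!: tendsto_eventually always_eventually\<close>)
  qed
  then have "f \<in> borel_measurable (lebesgue_on U)" by (rule borel_measurable_if_D)
  from borel_rep[OF this] U obtain g where g: "g \<in> borel_measurable borel" "AE x in lborel. x \<in> U \<longrightarrow> g x = f x" "\<And>x. x \<notin> U \<Longrightarrow> g x = 0"
    by auto
  moreover have "integrable lborel (\<lambda>x. indicator K x * g x)" if K: "compact K" "K \<subseteq> U" for K
  proof -
    have "integrable (lebesgue_on K) f" using f K by (auto simp: locally_integrable_def)
    moreover have "integrable (lebesgue_on K) f \<longleftrightarrow> integrable lborel (\<lambda>x. indicator K x * g x)"
    proof (rule integrable_rep)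
      show "(\<lambda>x. indicator K x * g x) \<in> borel_measurable borel"
        using g(1) borel_compact[OF K(1)] by (intro borel_measurable_times borel_measurable_indicator) auto
      show "AE x in lborel. x \<in> K \<longrightarrow> indicator K x * g x = f x" using g(2)
        by eventually_elim (use K in auto)
    qed (use K in \<open>auto intro: borel_compact\<close>)
    ultimately show ?thesis by simp
  qed
  ultimately show ?thesis by (rule that)
qed

lemma integrable_mult_compact:
  fixes g \<phi> :: "'a::euclidean_space \<Rightarrow> real"
  assumes g: "g \<in> borel_measurable borel" "integrable lborel (\<lambda>x. indicator K x * g x)"
    and \<phi>: "continuous_on UNIV \<phi>" "compact K" "\<And>x. x \<notin> K \<Longrightarrow> \<phi> x = 0"
  shows "integrable lborel (\<lambda>x. g x * \<phi> x)"
proof -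
  obtain B where B: "\<And>x. \<bar>\<phi> x\<bar> \<le> B" using continuous_zero_outside_bounded[OF \<phi>] by blast
  have m: "\<phi> \<in> borel_measurable borel" using \<phi>(1) by (rule borel_measurable_continuous_onI)
  show ?thesis
  proof (rule Bochner_Integration.integrable_bound)
    show "integrable lborel (\<lambda>x. B * (indicator K x * g x))" using g by auto
    show "(\<lambda>x. g x * \<phi> x) \<in> borel_measurable lborel" using g m by simp
    show "AE x in lborel. norm (g x * \<phi> x) \<le> norm (B * (indicator K x * g x))"
    proof (rule AE_I2)
      fix x
      show "norm (g x * \<phi> x) \<le> norm (B * (indicator K x * g x))"
      proof (cases "x \<in> K")
        case True
        have "\<bar>\<phi> x\<bar> * \<bar>g x\<bar> \<le> \<bar>B\<bar> * \<bar>g x\<bar>"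
          using B[of x] by (intro mult_right_mono) auto
        with True show ?thesis by (simp add: abs_mult mult.commute)
      qed (simp add: \<phi>(3))
    qed
  qed
qed

text \<open>
  Countably many test functions suffice in the fundamental lemma. Hence exceptional null sets that
  depend on the test function can be united, as is needed on time slices.
\<close>

definition rat_points :: "'a::euclidean_space set" where
  "rat_points = {a. \<forall>i\<in>Basis. a \<bullet> i \<in> \<rat>}"

lemma countable_rat_points: "countable (rat_points :: 'a::euclidean_space set)"
proof -
  have "(rat_points :: 'a set) \<subseteq> (\<lambda>f. \<Sum>i\<in>Basis. f i *\<^sub>R i) ` (Basis \<rightarrow>\<^sub>E \<rat>)"
  proof
    fix a :: 'a assume "a \<in> rat_points"
    then have "restrict (\<lambda>i. a \<bullet> i) Basis \<in> Basis \<rightarrow>\<^sub>E \<rat>" by (auto simp: rat_points_def)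
    moreover have "a = (\<Sum>i\<in>Basis. restrict (\<lambda>i. a \<bullet> i) Basis i *\<^sub>R i)" by (simp add: euclidean_representation)
    ultimately show "a \<in> (\<lambda>f. \<Sum>i\<in>Basis. f i *\<^sub>R i) ` (Basis \<rightarrow>\<^sub>E \<rat>)" by blast
  qed
  moreover have "countable ((\<lambda>f. \<Sum>i\<in>Basis. f i *\<^sub>R (i::'a)) ` (Basis \<rightarrow>\<^sub>E \<rat>))"
    by (intro countable_image countable_PiE) (auto simp: countable_rat)
  ultimately show ?thesis by (rule countable_subset)
qed

text \<open>A smooth function supported in the closed box that tends to the indicator of the open
  box as \<open>k\<close> grows.\<close>

definition box_bump :: "'a::euclidean_space \<Rightarrow> 'a \<Rightarrow> nat \<Rightarrow> 'a \<Rightarrow> real" where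
  "box_bump a b k x = (\<Prod>i\<in>Basis. ebump (real k * (x \<bullet> i - a \<bullet> i)) * ebump (real k * (b \<bullet> i - x \<bullet> i)))"

lemma smooth_box_bump: "smooth (box_bump a b k)"
proof -
  have 1: "bounded_linear (\<lambda>x::'a. c * (x \<bullet> i))" for c i
    by (intro bounded_linear_const_mult bounded_linear_inner_left)
  have "smooth (\<lambda>x. \<Prod>i\<in>Basis. ebump (real k * (x \<bullet> i) + - real k * (a \<bullet> i)) * ebump (- real k * (x \<bullet> i) + real k * (b \<bullet> i)))"
    by (intro smooth_prod smooth_mult smooth_affine[OF 1 smooth_ebump])
  then show ?thesis
    by (rule back_subst[of smooth]) (auto simp: box_bump_def fun_eq_iff algebra_simps)
qed

lemma box_bump_range: "0 \<le> box_bump a b k x" "box_bump a b k x \<le> 1"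
  unfolding box_bump_def
  by (auto intro!: prod_nonneg prod_le_1 mult_nonneg_nonneg ebump_range mult_le_one)

lemma box_bump_0: "x \<notin> box a b \<Longrightarrow> box_bump a b k x = 0"
proof -
  assume "x \<notin> box a b"
  then obtain i where i: "i \<in> Basis" "x \<bullet> i \<le> a \<bullet> i \<or> b \<bullet> i \<le> x \<bullet> i" by (auto simp: mem_box not_less)
  then have "real k * (x \<bullet> i - a \<bullet> i) \<le> 0 \<or> real k * (b \<bullet> i - x \<bullet> i) \<le> 0" by (auto simp: mult_le_0_iff)
  then have "ebump (real k * (x \<bullet> i - a \<bullet> i)) * ebump (real k * (b \<bullet> i - x \<bullet> i)) = 0" by (auto simp: ebump_0)
  then show ?thesis unfolding box_bump_def using i(1) by (intro prod_zero) auto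
qed

lemma box_bump_tendsto: "(\<lambda>k. box_bump a b k x) \<longlonglongrightarrow> indicator (box a b) x"
proof (cases "x \<in> box a b")
  case True
  have "(\<lambda>k. \<Prod>i\<in>Basis. ebump (real k * (x \<bullet> i - a \<bullet> i)) * ebump (real k * (b \<bullet> i - x \<bullet> i))) \<longlonglongrightarrow> (\<Prod>i\<in>(Basis::'a set). 1 * 1)"
    by (intro tendsto_prod tendsto_mult ebump_scale_tendsto) (use True in \<open>auto simp: mem_box\<close>)
  with True show ?thesis by (simp add: box_bump_def)
qed (simp add: box_bump_0)

definition box_bumps :: "'a::euclidean_space set \<Rightarrow> ('a \<Rightarrow> real) set" where
  "box_bumps U = {box_bump a b k |a b k. a \<in> rat_points \<and> b \<in> rat_points \<and> cbox a b \<subseteq> U}"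

lemma box_bumps_Cc_inf: "box_bumps U \<subseteq> Cc_inf U"
proof -
  have "box_bump a b k \<in> Cc_inf U" if "cbox a b \<subseteq> U" for a b k
    using that by (intro Cc_infI[OF smooth_box_bump, of "cbox a b"]) (auto intro!: box_bump_0 dest: subsetD[OF box_subset_cbox])
  then show ?thesis by (auto simp: box_bumps_def)
qed

lemma countable_box_bumps: "countable (box_bumps U)"
proof -
  have "box_bumps U \<subseteq> (\<lambda>(a,b,k). box_bump a b k) ` (rat_points \<times> rat_points \<times> UNIV)"
  proof
    fix f assume "f \<in> box_bumps U"
    then obtain a b k where "f = box_bump a b k" "a \<in> rat_points" "b \<in> rat_points" by (auto simp: box_bumps_def)
    then show "f \<in> (\<lambda>(a,b,k). box_bump a b k) ` (rat_points \<times> rat_points \<times> UNIV)"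
      by (intro image_eqI[of _ _ "(a,b,k)"]) auto
  qed
  then show ?thesis by (rule countable_subset) (intro countable_image countable_SIGMA countable_rat_points; simp)
qed

text \<open>The positive and negative parts of \<open>h\<close> are densities of two measures. These
  agree on the rational boxes, a countable family that is stable under intersection, generates the
  Borel sets and covers the space by sets of finite measure. Hence they agree on all Borel
  sets.\<close>

lemma fundamental_lemma_box:
  fixes h :: "'a::euclidean_space \<Rightarrow> real"
  assumes h: "integrable lborel h"
    and 0: "\<And>a b. a \<in> rat_points \<Longrightarrow> b \<in> rat_points \<Longrightarrow> (LINT x|lborel. indicator (box a b) x * h x) = 0"
  shows "AE x in lborel. h x = 0"
proof -
  have [measurable]: "h \<in> borel_measurable borel" using h by auto
  let ?p = "\<lambda>x. max (h x) 0" and ?n = "\<lambda>x. max (- h x) 0"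
  let ?E = "{box a b |a b::'a. a \<in> rat_points \<and> b \<in> rat_points}"
  have ip: "integrable lborel (\<lambda>x. indicator A x * ?p x)" and inn: "integrable lborel (\<lambda>x. indicator A x * ?n x)"
    if "A \<in> sets borel" for A
  proof -
    have "integrable lborel ?p" "integrable lborel ?n" using h by (auto intro!: integrable_max)
    then show "integrable lborel (\<lambda>x. indicator A x * ?p x)" "integrable lborel (\<lambda>x. indicator A x * ?n x)"
      using integrable_real_mult_indicator[of A lborel ?p] integrable_real_mult_indicator[of A lborel ?n] that
      by (simp_all add: mult.commute)
  qed
  have em: "emeasure (density lborel ?p) A = ennreal (LINT x|lborel. indicator A x * ?p x)"
    "emeasure (density lborel ?n) A = ennreal (LINT x|lborel. indicator A x * ?n x)" if "A \<in> sets borel" for A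
  proof -
    have "emeasure (density lborel (\<lambda>x. ennreal (q x))) A = ennreal (LINT x|lborel. indicator A x * q x)"
      if q: "q \<in> borel_measurable borel" "\<And>x. q x \<ge> 0" "integrable lborel (\<lambda>x. indicator A x * q x)" for q :: "'a \<Rightarrow> real"
    proof -
      have "emeasure (density lborel (\<lambda>x. ennreal (q x))) A = (\<integral>\<^sup>+x. ennreal (q x) * indicator A x \<partial>lborel)"
        using q(1) \<open>A \<in> sets borel\<close> by (subst emeasure_density) auto
      also have "\<dots> = (\<integral>\<^sup>+x. ennreal (indicator A x * q x) \<partial>lborel)"
        by (rule nn_integral_cong) (auto simp: indicator_def)
      also have "\<dots> = ennreal (LINT x|lborel. indicator A x * q x)"
        using q by (intro nn_integral_eq_integral) auto
      finally show ?thesis .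
    qed
    from this[of ?p] this[of ?n] ip[OF that] inn[OF that] show
      "emeasure (density lborel ?p) A = ennreal (LINT x|lborel. indicator A x * ?p x)"
      "emeasure (density lborel ?n) A = ennreal (LINT x|lborel. indicator A x * ?n x)" by auto
  qed
  have "density lborel ?p = density lborel ?n"
  proof (rule measure_eqI_generator_eq_countable[where E="?E" and \<Omega>=UNIV and A="?E"])
    show "Int_stable ?E"
    proof (rule Int_stableI, clarsimp)
      fix a b c d :: 'a assume "a \<in> rat_points" "b \<in> rat_points" "c \<in> rat_points" "d \<in> rat_points"
      then have "(\<Sum>i\<in>Basis. max (a\<bullet>i) (c\<bullet>i) *\<^sub>R i) \<in> rat_points" "(\<Sum>i\<in>Basis. min (b\<bullet>i) (d\<bullet>i) *\<^sub>R i) \<in> rat_points"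
        by (auto simp: rat_points_def max_def min_def)
      with box_Int_box[of a b c d] show "\<exists>a' b'. box a b \<inter> box c d = box a' b' \<and> a' \<in> rat_points \<and> b' \<in> rat_points"
        by blast
    qed
    show "emeasure (density lborel ?p) X = emeasure (density lborel ?n) X" if "X \<in> ?E" for X
    proof -
      from that obtain a b where X: "X = box a b" "a \<in> rat_points" "b \<in> rat_points" by auto
      have "(LINT x|lborel. indicator X x * ?p x) - (LINT x|lborel. indicator X x * ?n x) = (LINT x|lborel. indicator X x * ?p x - indicator X x * ?n x)"
        using X by (subst Bochner_Integration.integral_diff) (auto intro!: ip inn)
      also have "\<dots> = (LINT x|lborel. indicator X x * h x)"
        by (rule Bochner_Integration.integral_cong) (auto simp: indicator_def max_def)
      also have "\<dots> = 0" using 0 X by simp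
      finally show ?thesis using X by (simp add: em)
    qed
    have tb: "topological_basis ?E"
    proof (rule topological_basisI)
      fix O' and x :: 'a assume "open O'" "x \<in> O'"
      then obtain e where e: "e > 0" "ball x e \<subseteq> O'" using openE by blast
      from rational_boxes[OF e(1), of x] e(2) show "\<exists>B'\<in>?E. x \<in> B' \<and> B' \<subseteq> O'"
        by (auto simp: rat_points_def) blast
    qed auto
    have cE: "countable ?E"
    proof -
      have "?E = (\<lambda>(a,b). box a b) ` (rat_points \<times> rat_points)" by auto
      then show ?thesis by (metis countable_SIGMA countable_image countable_rat_points)
    qed
    have "sets borel = sigma_sets UNIV ?E"
      unfolding borel_eq_countable_basis[OF cE tb] by (rule sets_measure_of) auto
    then show "sets (density lborel ?p) = sigma_sets UNIV ?E" "sets (density lborel ?n) = sigma_sets UNIV ?E" by auto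
    show "countable ?E" using cE .
    show "\<Union>?E = UNIV"
    proof (intro equalityI subset_UNIV subsetI)
      fix x :: 'a
      obtain B' where "B' \<in> ?E" "x \<in> B'" by (rule topological_basisE[OF tb open_UNIV UNIV_I[of x]])
      then show "x \<in> \<Union>?E" by (rule UnionI)
    qed
    show "emeasure (density lborel ?p) a \<noteq> \<infinity>" if "a \<in> ?E" for a
    proof -
      have "a \<in> sets borel" using that by auto
      then show ?thesis by (simp add: em(1))
    qed
  qed auto
  then have eq: "ennreal (LINT x|lborel. indicator A x * ?p x) = ennreal (LINT x|lborel. indicator A x * ?n x)" if "A \<in> sets borel" for A
    using em[OF that] by simp
  \<comment> \<open>On this set the negative part vanishes, so equality of the two measures kills
    the positive part there; on the complement the roles are exchanged.\<close>
  let ?A = "{x. h x > 0}"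
  have A: "?A \<in> sets borel" "- ?A \<in> sets borel" by measurable
  have "(LINT x|lborel. indicator ?A x * ?n x) = (LINT x::'a|lborel. 0)"
    by (rule Bochner_Integration.integral_cong) (auto simp: indicator_def)
  with eq[OF A(1)] have 1: "(LINT x|lborel. indicator ?A x * ?p x) \<le> 0" by (simp add: ennreal_eq_0_iff)
  have "(LINT x|lborel. indicator (-?A) x * ?p x) = (LINT x::'a|lborel. 0)"
    by (rule Bochner_Integration.integral_cong) (auto simp: indicator_def)
  with eq[OF A(2)] have 2: "(LINT x|lborel. indicator (-?A) x * ?n x) \<le> 0" by (simp add: ennreal_eq_0_iff[symmetric])
  have AE0: "AE x in lborel. q x = 0" if "integrable lborel q" "\<And>x. q x \<ge> 0" "(LINT x|lborel. q x) \<le> 0" for q :: "'a \<Rightarrow> real"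
  proof -
    have "(LINT x|lborel. q x) = 0" using that by (intro antisym integral_nonneg_AE) auto
    then show ?thesis using that by (subst integral_nonneg_eq_0_iff_AE[symmetric]) auto
  qed
  have "AE x in lborel. indicator ?A x * ?p x = 0"
    by (rule AE0[OF ip[OF A(1)] _ 1]) simp
  moreover have "AE x in lborel. indicator (-?A) x * ?n x = 0"
    by (rule AE0[OF inn[OF A(2)] _ 2]) simp
  ultimately show ?thesis
    by eventually_elim (auto simp: indicator_def max_def split: if_splits)
qed

text \<open>Inside a closed rational box contained in \<open>U\<close>, dominated convergence of
  \<open>box_bump\<close> turns orthogonality to test functions into orthogonality to indicators of
  rational boxes. Countably many such boxes cover \<open>U\<close>.\<close>

lemma fundamental_lemma:
  fixes g :: "'a::euclidean_space \<Rightarrow> real"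
  assumes U: "open U" and g: "g \<in> borel_measurable borel"
    and loc: "\<And>K. compact K \<Longrightarrow> K \<subseteq> U \<Longrightarrow> integrable lborel (\<lambda>x. indicator K x * g x)"
    and 0: "\<And>\<phi>. \<phi> \<in> box_bumps U \<Longrightarrow> (LINT x|lborel. g x * \<phi> x) = 0"
  shows "AE x in lborel. x \<in> U \<longrightarrow> g x = 0"
proof -
  note [measurable] = g
  have *: "AE x in lborel. x \<in> box a b \<longrightarrow> g x = 0" if ab: "a \<in> rat_points" "b \<in> rat_points" "cbox a b \<subseteq> U" for a b
  proof -
    let ?h = "\<lambda>x. indicator (box a b) x * g x"
    have ih: "integrable lborel (\<lambda>x. indicator A x * (indicator (cbox a b) x * g x))" if "A \<in> sets borel" for A
      using integrable_real_mult_indicator[of A lborel "\<lambda>x. indicator (cbox a b) x * g x"] loc[OF compact_cbox ab(3)] that by (simp add: mult.commute)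
    have hh: "?h = (\<lambda>x. indicator (box a b) x * (indicator (cbox a b) x * g x))"
      by (rule ext) (auto simp: indicator_def dest: subsetD[OF box_subset_cbox])
    have "AE x in lborel. ?h x = 0"
    proof (rule fundamental_lemma_box)
      show "integrable lborel ?h" unfolding hh by (rule ih) auto
      fix c d :: 'a assume cd: "c \<in> rat_points" "d \<in> rat_points"
      \<comment> \<open>The corners of the intersection of the two boxes. They are rational again,
        so the bumps of the intersection belong to \<open>box_bumps U\<close>.\<close>
      define a' where "a' = (\<Sum>i\<in>Basis. max (c\<bullet>i) (a\<bullet>i) *\<^sub>R i)"
      define b' where "b' = (\<Sum>i\<in>Basis. min (d\<bullet>i) (b\<bullet>i) *\<^sub>R i)"
      have I: "box c d \<inter> box a b = box a' b'" unfolding a'_def b'_def by (rule box_Int_box)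
      have r: "a' \<in> rat_points" "b' \<in> rat_points" using ab cd by (auto simp: rat_points_def a'_def b'_def max_def min_def)
      have sub: "cbox a' b' \<subseteq> cbox a b"
        by (auto simp: a'_def b'_def mem_box)
      have "(\<lambda>k. LINT x|lborel. g x * box_bump a' b' k x) \<longlonglongrightarrow> (LINT x|lborel. g x * indicator (box a' b') x)"
      proof (rule integral_dominated_convergence)
        show "integrable lborel (\<lambda>x. \<bar>indicator (cbox a b) x * g x\<bar>)"
          using loc[OF compact_cbox ab(3)] by auto
        show "AE x in lborel. (\<lambda>k. g x * box_bump a' b' k x) \<longlonglongrightarrow> g x * indicator (box a' b') x"
          by (intro AE_I2 tendsto_intros box_bump_tendsto)
        have "norm (g x * box_bump a' b' k x) \<le> \<bar>indicator (cbox a b) x * g x\<bar>" for x k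
        proof (cases "x \<in> box a' b'")
          case True
          then have "x \<in> cbox a b" using sub box_subset_cbox by blast
          then show ?thesis using box_bump_range[of a' b' k x] by (simp add: abs_mult mult_left_le)
        qed (simp add: box_bump_0)
        then show "AE x in lborel. norm (g x * box_bump a' b' k x) \<le> \<bar>indicator (cbox a b) x * g x\<bar>" for k by simp
        show "(\<lambda>x. g x * box_bump a' b' k x) \<in> borel_measurable lborel" for k
          using smooth_borel_measurable[OF smooth_box_bump, of a' b' k] by simp
      qed simp
      moreover have "(LINT x|lborel. g x * box_bump a' b' k x) = 0" for k
        using r sub ab by (intro 0) (auto simp: box_bumps_def)
      ultimately have "(LINT x|lborel. g x * indicator (box a' b') x) = 0" by (simp add: LIMSEQ_const_iff)
      moreover have "(\<lambda>x. indicator (box c d) x * ?h x) = (\<lambda>x. g x * indicator (box a' b') x)"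
        unfolding I[symmetric] by (rule ext) (auto simp: indicator_def)
      ultimately show "(LINT x|lborel. indicator (box c d) x * ?h x) = 0" by simp
    qed
    then show ?thesis by eventually_elim auto
  qed
  have "countable {(a,b). a \<in> rat_points \<and> b \<in> rat_points \<and> cbox a b \<subseteq> U}"
    by (rule countable_subset[of _ "rat_points \<times> rat_points"]) (auto intro: countable_SIGMA countable_rat_points)
  then have "AE x in lborel. \<forall>p\<in>{(a,b). a \<in> rat_points \<and> b \<in> rat_points \<and> cbox a b \<subseteq> U}. x \<in> box (fst p) (snd p) \<longrightarrow> g x = 0"
    by (subst AE_ball_countable) (auto intro: *)
  then show ?thesis
  proof eventually_elim
    case (elim x)
    show ?case
    proof
      assume "x \<in> U"
      then obtain e where e: "e > 0" "cball x e \<subseteq> U" using U open_contains_cball by blast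
      from rational_boxes[OF e(1), of x] obtain a b where ab: "\<forall>i\<in>Basis. a \<bullet> i \<in> \<rat> \<and> b \<bullet> i \<in> \<rat>" "x \<in> box a b" "box a b \<subseteq> ball x e" by auto
      \<comment> \<open>\<open>rational_boxes\<close> only controls the open box. Being nonempty, it
        has the closed box as its closure, which stays in the closed ball and hence in
        \<open>U\<close>.\<close>
      have "cbox a b = closure (box a b)" using ab(2) by (subst closure_box) auto
      also have "\<dots> \<subseteq> cball x e" using ab(3) by (intro closure_minimal) (auto simp: subset_eq)
      finally show "g x = 0" using elim ab e by (force simp: rat_points_def)
    qed
  qed
qed

section \<open>Square integrable functions\<close>

definition sq_int :: "('a::euclidean_space \<Rightarrow> real) \<Rightarrow> bool" where
  "sq_int f \<longleftrightarrow> f \<in> borel_measurable borel \<and> integrable lborel (\<lambda>x. (f x)\<^sup>2)"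

lemma sq_intD: "sq_int f \<Longrightarrow> f \<in> borel_measurable borel" "sq_int f \<Longrightarrow> integrable lborel (\<lambda>x. (f x)\<^sup>2)"
  by (auto simp: sq_int_def)

lemma sq_int_bound:
  assumes f: "sq_int f" and g: "g \<in> borel_measurable borel" and le: "\<And>x. \<bar>g x\<bar> \<le> B * \<bar>f x\<bar>"
  shows "sq_int g"
  unfolding sq_int_def
proof
  show "integrable lborel (\<lambda>x. (g x)\<^sup>2)"
  proof (rule Bochner_Integration.integrable_bound)
    show "integrable lborel (\<lambda>x. B\<^sup>2 * (f x)\<^sup>2)" using sq_intD[OF f] by simp
    have "(g x)\<^sup>2 \<le> B\<^sup>2 * (f x)\<^sup>2" for x
      using power_mono[OF le[of x], of 2] by (simp add: power_mult_distrib)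
    then show "AE x in lborel. norm ((g x)\<^sup>2) \<le> norm (B\<^sup>2 * (f x)\<^sup>2)" by simp
  qed (use g in simp)
qed (rule g)

lemma sq_int_mult_bounded:
  assumes f: "sq_int f" and g: "g \<in> borel_measurable borel" and le: "\<And>x. \<bar>g x\<bar> \<le> B"
  shows "sq_int (\<lambda>x. g x * f x)"
  using f by (rule sq_int_bound[where B=B])
    (use g sq_intD[OF f] mult_right_mono[OF le] in \<open>auto simp: abs_mult\<close>)

lemma sq_int_cmult: "sq_int f \<Longrightarrow> sq_int (\<lambda>x. c * f x)"
  by (rule sq_int_mult_bounded[where B="\<bar>c\<bar>"]) auto

lemma integrable_mult_sq:
  assumes "sq_int f" "sq_int g"
  shows "integrable lborel (\<lambda>x. f x * g x)"
proof (rule Bochner_Integration.integrable_bound)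
  show "integrable lborel (\<lambda>x. (f x)\<^sup>2 + (g x)\<^sup>2)" using assms by (auto simp: sq_int_def)
  show "(\<lambda>x. f x * g x) \<in> borel_measurable lborel" using assms by (auto simp: sq_int_def)
  have "\<bar>f x * g x\<bar> \<le> (f x)\<^sup>2 + (g x)\<^sup>2" for x
    using sum_squares_bound[of "\<bar>f x\<bar>" "\<bar>g x\<bar>"] mult_nonneg_nonneg[of "\<bar>f x\<bar>" "\<bar>g x\<bar>"]
    unfolding abs_mult power2_abs by linarith
  then show "AE x in lborel. norm (f x * g x) \<le> norm ((f x)\<^sup>2 + (g x)\<^sup>2)" by simp
qed

lemma sq_int_add:
  assumes "sq_int f" "sq_int g" shows "sq_int (\<lambda>x. f x + g x)"
  using assms integrable_mult_sq[OF assms] by (auto simp: sq_int_def power2_sum mult.assoc)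

lemma sq_int_zero [simp]: "sq_int (\<lambda>x. 0)"
  by (simp add: sq_int_def)

lemma sq_int_diff: "sq_int f \<Longrightarrow> sq_int g \<Longrightarrow> sq_int (\<lambda>x. f x - g x)"
  using sq_int_add[of f "\<lambda>x. -1 * g x"] sq_int_cmult[of g "-1"] by simp

lemma sq_int_sum: "(\<And>i. i \<in> I \<Longrightarrow> sq_int (f i)) \<Longrightarrow> sq_int (\<lambda>x. \<Sum>i\<in>I. f i x)"
  by (induction I rule: infinite_finite_induct) (auto intro: sq_int_add)

lemma sq_int_continuous:
  fixes f :: "'a::euclidean_space \<Rightarrow> real"
  assumes "continuous_on UNIV f" "compact K" "\<And>x. x \<notin> K \<Longrightarrow> f x = 0"
  shows "sq_int f"
proof -
  have m: "f \<in> borel_measurable borel" using assms(1) by (rule borel_measurable_continuous_onI)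
  have "integrable lborel (\<lambda>x. indicator K x * f x)"
    using borel_integrable_compact[OF assms(2) continuous_on_subset[OF assms(1)]] by simp
  from integrable_mult_compact[OF m this assms] m show ?thesis by (simp add: sq_int_def power2_eq_square)
qed

lemma sq_int_Cc_inf:
  assumes "f \<in> Cc_inf U" shows "sq_int f"
  using Cc_infE[OF assms] sq_int_continuous[OF smooth_continuous[OF Cc_inf_smooth[OF assms]]] by metis

text \<open>The squared norm of f - t g is a nonnegative quadratic polynomial in t, with minimum at
  \<open>t = c / b\<close>.\<close>

lemma Cauchy_Schwarz_sq:
  assumes f: "sq_int f" and g: "sq_int g"
  shows "(LINT x|lborel. f x * g x)\<^sup>2 \<le> (LINT x|lborel. (f x)\<^sup>2) * (LINT x|lborel. (g x)\<^sup>2)"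
proof -
  define a b c where "a = (LINT x|lborel. (f x)\<^sup>2)" and "b = (LINT x|lborel. (g x)\<^sup>2)" and "c = (LINT x|lborel. f x * g x)"
  note i = sq_intD(2)[OF f] sq_intD(2)[OF g] integrable_mult_sq[OF f g]
  have *: "0 \<le> a - 2 * t * c + t\<^sup>2 * b" for t
  proof -
    have "0 \<le> (LINT x|lborel. (f x - t * g x)\<^sup>2)" by (intro integral_nonneg_AE) auto
    also have "(\<lambda>x. (f x - t * g x)\<^sup>2) = (\<lambda>x. (f x)\<^sup>2 - 2 * t * (f x * g x) + t\<^sup>2 * (g x)\<^sup>2)"
      by (auto simp: power2_eq_square algebra_simps)
    also have "(LINT x|lborel. (f x)\<^sup>2 - 2 * t * (f x * g x) + t\<^sup>2 * (g x)\<^sup>2) = a - 2 * t * c + t\<^sup>2 * b"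
      using i by (simp add: a_def b_def c_def)
    finally show ?thesis .
  qed
  have b0: "b \<ge> 0" unfolding b_def by (intro integral_nonneg_AE) auto
  have a0: "a \<ge> 0" using *[of 0] by simp
  have "c\<^sup>2 \<le> a * b"
  proof (cases "b = 0")
    case True
    have "c = 0"
    proof (rule ccontr)
      assume "c \<noteq> 0"
      \<comment> \<open>For \<open>b = 0\<close> the polynomial is affine, and this argument gives
        it the value -1.\<close>
      with *[of "(a + 1) / (2 * c)"] True show False by simp
    qed
    then show ?thesis using True by simp
  next
    case False
    then have "0 \<le> b * (a - 2 * (c / b) * c + (c / b)\<^sup>2 * b)" using *[of "c / b"] b0 by (intro mult_nonneg_nonneg)
    also have "\<dots> = a * b - c\<^sup>2" using False by (simp add: power2_eq_square field_simps)
    finally show ?thesis by simp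
  qed
  then show ?thesis by (simp add: a_def b_def c_def)
qed

lemma Cauchy_Schwarz_sqrt:
  assumes "sq_int f" "sq_int g"
  shows "\<bar>LINT x|lborel. f x * g x\<bar> \<le> sqrt (LINT x|lborel. (f x)\<^sup>2) * sqrt (LINT x|lborel. (g x)\<^sup>2)"
  using real_sqrt_le_mono[OF Cauchy_Schwarz_sq[OF assms]] by (simp add: real_sqrt_mult)

text \<open>Allows test functions to be replaced by their L2 limits wherever they enter
  linearly.\<close>

lemma sq_tendsto_pairing:
  assumes F: "sq_int F" and v: "sq_int v" and p: "\<And>k. sq_int (p k)"
    and lim: "(\<lambda>k. LINT x|lborel. (p k x - v x)\<^sup>2) \<longlonglongrightarrow> 0"
  shows "(\<lambda>k. LINT x|lborel. F x * p k x) \<longlonglongrightarrow> (LINT x|lborel. F x * v x)"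
proof (rule LIM_zero_cancel, rule Lim_null_comparison)
  have "(LINT x|lborel. F x * p k x) - (LINT x|lborel. F x * v x) = (LINT x|lborel. F x * (p k x - v x))" for k
    by (simp add: right_diff_distrib Bochner_Integration.integral_diff integrable_mult_sq F p v)
  then show "\<forall>\<^sub>F k in sequentially. norm ((LINT x|lborel. F x * p k x) - (LINT x|lborel. F x * v x))
      \<le> sqrt (LINT x|lborel. (F x)\<^sup>2) * sqrt (LINT x|lborel. (p k x - v x)\<^sup>2)"
    using Cauchy_Schwarz_sqrt[OF F sq_int_diff[OF p v]] by (intro always_eventually) auto
  show "(\<lambda>k. sqrt (LINT x|lborel. (F x)\<^sup>2) * sqrt (LINT x|lborel. (p k x - v x)\<^sup>2)) \<longlonglongrightarrow> 0"
    using tendsto_mult[OF tendsto_const tendsto_real_sqrt[OF lim]] by simp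
qed

text \<open>Serves to carry the Poincare inequality from test functions over to slices of the
  solution.\<close>

lemma sq_tendsto_norm:
  assumes v: "sq_int v" and p: "\<And>k. sq_int (p k)"
    and lim: "(\<lambda>k. LINT x|lborel. (p k x - v x)\<^sup>2) \<longlonglongrightarrow> 0"
  shows "(\<lambda>k. LINT x|lborel. (p k x)\<^sup>2) \<longlonglongrightarrow> (LINT x|lborel. (v x)\<^sup>2)"
proof -
  have "(p k x)\<^sup>2 = (p k x - v x)\<^sup>2 + 2 * (v x * p k x) - (v x)\<^sup>2" for k x
    by (simp add: power2_eq_square algebra_simps)
  then have "(LINT x|lborel. (p k x)\<^sup>2) = (LINT x|lborel. (p k x - v x)\<^sup>2) + 2 * (LINT x|lborel. v x * p k x) - (LINT x|lborel. (v x)\<^sup>2)" for k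
    using sq_intD(2)[OF sq_int_diff[OF p v, of k]] integrable_mult_sq[OF v p, of k] sq_intD(2)[OF v] by simp
  moreover have "(\<lambda>k. (LINT x|lborel. (p k x - v x)\<^sup>2) + 2 * (LINT x|lborel. v x * p k x) - (LINT x|lborel. (v x)\<^sup>2))
     \<longlonglongrightarrow> 0 + 2 * (LINT x|lborel. v x * v x) - (LINT x|lborel. (v x)\<^sup>2)"
    by (intro tendsto_intros lim sq_tendsto_pairing v p)
  ultimately show ?thesis by (simp add: power2_eq_square)
qed

lemma integral_sq_add_le:
  assumes "sq_int f" "sq_int g"
  shows "(LINT x|lborel. (f x + g x)\<^sup>2) \<le> 2 * (LINT x|lborel. (f x)\<^sup>2) + 2 * (LINT x|lborel. (g x)\<^sup>2)"
proof -
  have "(LINT x|lborel. (f x + g x)\<^sup>2) \<le> (LINT x|lborel. 2 * (f x)\<^sup>2 + 2 * (g x)\<^sup>2)"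
  proof (rule integral_mono)
    show "(f x + g x)\<^sup>2 \<le> 2 * (f x)\<^sup>2 + 2 * (g x)\<^sup>2" for x
      using sum_squares_bound[of "f x" "g x"] by (simp add: power2_sum)
  qed (use assms(1)[THEN sq_intD(2)] assms(2)[THEN sq_intD(2)] sq_intD(2)[OF sq_int_add[OF assms]] in auto)
  also have "\<dots> = 2 * (LINT x|lborel. (f x)\<^sup>2) + 2 * (LINT x|lborel. (g x)\<^sup>2)"
    using assms(1)[THEN sq_intD(2)] assms(2)[THEN sq_intD(2)] by simp
  finally show ?thesis .
qed

lemma integrable_const_cball: "integrable lborel (\<lambda>x::'a::euclidean_space. c * indicator (cball 0 R) x :: real)"
  using emeasure_bounded_finite[OF bounded_cball[of "0::'a" R]]
  by (intro integrable_mult_right integrable_real_indicator) auto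

lemma integral_lborel_translate:
  fixes f :: "'a::euclidean_space \<Rightarrow> real"
  assumes "f \<in> borel_measurable borel"
  shows "(LINT x|lborel. f (c + x)) = (LINT x|lborel. f x)"
  using assms by (subst (2) lborel_distr_plus[of c, symmetric]) (simp add: integral_distr)

lemma integrable_lborel_translate:
  fixes f :: "'a::euclidean_space \<Rightarrow> real"
  assumes "integrable lborel f"
  shows "integrable lborel (\<lambda>x. f (c + x))"
proof -
  have "integrable (distr lborel borel ((+) c)) f" using assms by (simp add: lborel_distr_plus)
  then show ?thesis by (rule integrable_distr[rotated]) simp
qed

lemma sq_int_translate: "sq_int f \<Longrightarrow> sq_int (\<lambda>x. f (c + x))"
  using integrable_lborel_translate[of "\<lambda>x. (f x)\<^sup>2" c] measurable_compose[of "(+) c" borel borel f borel]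
  by (auto simp: sq_int_def)

subsection \<open>Continuity of translations\<close>

lemma integral_sq_dominated:
  fixes f :: "nat \<Rightarrow> 'a::euclidean_space \<Rightarrow> real"
  assumes m: "\<And>n. f n \<in> borel_measurable borel" and w: "integrable lborel w"
    and le: "\<And>n x. (f n x)\<^sup>2 \<le> w x" and lim: "AE x in lborel. (\<lambda>n. f n x) \<longlonglongrightarrow> 0"
  shows "(\<lambda>n. LINT x|lborel. (f n x)\<^sup>2) \<longlonglongrightarrow> 0"
proof -
  have "(\<lambda>n. LINT x|lborel. (f n x)\<^sup>2) \<longlonglongrightarrow> (LINT x::'a|lborel. 0)"
  proof (rule integral_dominated_convergence[OF _ _ w])
    show "AE x in lborel. (\<lambda>n. (f n x)\<^sup>2) \<longlonglongrightarrow> 0"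
      using lim by eventually_elim (auto intro: tendsto_eq_intros)
  qed (use m le in auto)
  then show ?thesis by simp
qed

text \<open>A measurable function is an almost everywhere limit of continuous ones. Clipping these
  to \<open>[-B, B]\<close> and multiplying by the plateau \<open>q\<close> keeps them continuous
  and makes the squared error dominated by a multiple of the indicator of a ball.\<close>

lemma sq_int_dense_bounded:
  fixes v :: "'a::euclidean_space \<Rightarrow> real"
  assumes v: "v \<in> borel_measurable borel" "\<And>x. \<bar>v x\<bar> \<le> B" "\<And>x. norm x > R \<Longrightarrow> v x = 0" and e: "e > 0"
  obtains g where "continuous_on UNIV g" "\<And>x. x \<notin> cball 0 (R + 1) \<Longrightarrow> g x = 0" "(LINT x|lborel. (v x - g x)\<^sup>2) < e"
proof -
  have B0: "B \<ge> 0" using v(2)[of 0] by linarith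
  have "v \<in> borel_measurable lebesgue" using v(1) by (intro measurable_completion) auto
  then have "v measurable_on UNIV" by (simp add: lebesgue_measurable_imp_measurable_on)
  then obtain N g where N: "negligible N" "\<And>n. continuous_on UNIV (g n)" "\<And>x. x \<notin> N \<Longrightarrow> (\<lambda>n. g n x) \<longlonglongrightarrow> v x"
    unfolding measurable_on_def by auto
  \<comment> \<open>Equal to 1 where \<open>v\<close> may be nonzero and to 0 beyond radius
    \<open>R + 1\<close>.\<close>
  define q :: "'a \<Rightarrow> real" where "q x = max 0 (min 1 (R + 1 - norm x))" for x
  define h where "h n x = q x * max (- B) (min B (g n x))" for n x
  have ch: "continuous_on UNIV (h n)" for n unfolding h_def q_def by (intro continuous_intros N(2))
  have hb: "\<bar>h n x\<bar> \<le> B * indicator (cball 0 (R+1)) x" for n x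
  proof (cases "x \<in> cball 0 (R + 1)")
    case True
    have "\<bar>q x\<bar> * \<bar>max (- B) (min B (g n x))\<bar> \<le> 1 * B" using B0 by (intro mult_mono) (auto simp: q_def)
    then show ?thesis using True by (simp add: h_def abs_mult)
  qed (auto simp: h_def q_def)
  have h0: "h n x = 0" if "x \<notin> cball 0 (R+1)" for n x using that hb[of n x] by simp
  have "(\<lambda>n. LINT x|lborel. (v x - h n x)\<^sup>2) \<longlonglongrightarrow> 0"
  proof (rule integral_sq_dominated)
    show "integrable lborel (\<lambda>x::'a. 4 * B\<^sup>2 * indicator (cball 0 (R+1)) x)"
      by (rule integrable_const_cball)
    show "(\<lambda>x. v x - h n x) \<in> borel_measurable borel" for n
      using v(1) borel_measurable_continuous_onI[OF ch] by simp
    show "(v x - h n x)\<^sup>2 \<le> 4 * B\<^sup>2 * indicator (cball 0 (R+1)) x" for n x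
    proof (cases "x \<in> cball 0 (R+1)")
      case True
      then have "\<bar>v x - h n x\<bar> \<le> 2 * B" using v(2)[of x] hb[of n x] by simp
      from power_mono[OF this, of 2] True show ?thesis by (simp add: power_mult_distrib)
    qed (use h0[of x n] v(3)[of x] in auto)
    have "AE x in lborel. x \<notin> N" using AE_not_in[of N lebesgue] N(1) by (simp only: negligible_iff_null_sets AE_completion_iff)
    then show "AE x in lborel. (\<lambda>n. v x - h n x) \<longlonglongrightarrow> 0"
    proof eventually_elim
      case (elim x)
      have "(\<lambda>n. v x - h n x) \<longlonglongrightarrow> v x - q x * max (- B) (min B (v x))"
        unfolding h_def by (intro tendsto_intros N(3) elim)
      also have "v x - q x * max (- B) (min B (v x)) = 0"
        using v(2)[of x] v(3)[of x] B0 by (cases "norm x > R") (auto simp: q_def)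
      finally show ?case .
    qed
  qed
  then have "eventually (\<lambda>n. (LINT x|lborel. (v x - h n x)\<^sup>2) < e) sequentially" using e by (rule order_tendstoD)
  then obtain n where "(LINT x|lborel. (v x - h n x)\<^sup>2) < e" by (auto simp: eventually_sequentially)
  with ch h0 show ?thesis by (rule that)
qed

text \<open>Truncation both in value and in space reduces to the bounded case. The two errors of
  \<open>e / 4\<close> are each doubled by \<open>integral_sq_add_le\<close>.\<close>

lemma sq_int_dense:
  fixes v :: "'a::euclidean_space \<Rightarrow> real"
  assumes v: "sq_int v" and e: "e > 0"
  obtains g K where "continuous_on UNIV g" "compact K" "\<And>x. x \<notin> K \<Longrightarrow> g x = 0" "(LINT x|lborel. (v x - g x)\<^sup>2) < e"
proof -
  define w where "w n x = (if \<bar>v x\<bar> \<le> real n \<and> norm x \<le> real n then v x else 0)" for n x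
  have [measurable]: "v \<in> borel_measurable borel" using sq_intD[OF v] by auto
  have mw: "w n \<in> borel_measurable borel" for n unfolding w_def by measurable
  have "(\<lambda>n. LINT x|lborel. (v x - w n x)\<^sup>2) \<longlonglongrightarrow> 0"
  proof (rule integral_sq_dominated[OF _ sq_intD(2)[OF v]])
    show "AE x in lborel. (\<lambda>n. v x - w n x) \<longlonglongrightarrow> 0"
    proof (rule AE_I2)
      fix x
      obtain N where "max \<bar>v x\<bar> (norm x) \<le> real N" using real_arch_simple by blast
      then have "eventually (\<lambda>n. v x - w n x = 0) sequentially"
        unfolding eventually_sequentially by (intro exI[of _ N]) (auto simp: w_def)
      then show "(\<lambda>n. v x - w n x) \<longlonglongrightarrow> 0" by (rule tendsto_eventually)
    qed
  qed (use mw in \<open>auto simp: w_def\<close>)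
  then have "eventually (\<lambda>n. (LINT x|lborel. (v x - w n x)\<^sup>2) < e / 4) sequentially" using e by (intro order_tendstoD) auto
  then obtain n where n: "(LINT x|lborel. (v x - w n x)\<^sup>2) < e / 4" by (auto simp: eventually_sequentially)
  obtain g where g: "continuous_on UNIV g" "\<And>x. x \<notin> cball 0 (real n + 1) \<Longrightarrow> g x = 0" "(LINT x|lborel. (w n x - g x)\<^sup>2) < e / 4"
    by (rule sq_int_dense_bounded[of "w n" "real n" "real n" "e / 4"]) (use mw e in \<open>auto simp: w_def\<close>)
  have sw: "sq_int (w n)" by (rule sq_int_bound[OF v mw, where B=1]) (auto simp: w_def)
  have sg: "sq_int g" by (rule sq_int_continuous[OF g(1) compact_cball[of 0 "real n + 1"] g(2)])
  have "(LINT x|lborel. ((v x - w n x) + (w n x - g x))\<^sup>2) \<le> 2 * (LINT x|lborel. (v x - w n x)\<^sup>2) + 2 * (LINT x|lborel. (w n x - g x)\<^sup>2)"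
    by (intro integral_sq_add_le sq_int_diff v sw sg)
  then have "(LINT x|lborel. (v x - g x)\<^sup>2) < e" using n g(3) by simp
  with g(1,2) show ?thesis by (intro that[of g "cball 0 (real n + 1)"]) auto
qed

text \<open>For a continuous compactly supported approximation \<open>g\<close> of \<open>v\<close>
  this is dominated convergence. The error of replacing \<open>v\<close> by \<open>g\<close> is
  uniform in the shift, because translations preserve the L2 norm.\<close>

lemma sq_int_translation_continuous:
  fixes v :: "'a::euclidean_space \<Rightarrow> real"
  assumes F: "sq_int F" and v: "sq_int v" and c: "c \<longlonglongrightarrow> 0"
  shows "(\<lambda>n. LINT x|lborel. F x * v (c n + x)) \<longlonglongrightarrow> (LINT x|lborel. F x * v x)"
proof (rule LIMSEQ_I)
  fix r :: real assume r: "r > 0"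
  define NF where "NF = sqrt (LINT x|lborel. (F x)\<^sup>2)"
  have NF: "NF \<ge> 0" unfolding NF_def by (simp add: integral_nonneg_AE)
  \<comment> \<open>Each of the two approximation errors is at most \<open>NF * d\<close>, hence
    below \<open>r / 3\<close>; the summand 1 keeps the denominator positive when \<open>F\<close>
    is null.\<close>
  define d where "d = r / (3 * (NF + 1))"
  have d: "d > 0" "NF * d < r / 3"
    using r NF by (auto simp: d_def field_simps)
  obtain g K where g: "continuous_on UNIV g" "compact K" "\<And>x. x \<notin> K \<Longrightarrow> g x = 0" "(LINT x|lborel. (v x - g x)\<^sup>2) < d\<^sup>2"
    using sq_int_dense[OF v, of "d\<^sup>2"] d by auto
  have sg: "sq_int g" using sq_int_continuous g by blast
  note svg = sq_int_diff[OF v sg]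
  have Nvg: "sqrt (LINT x|lborel. (v x - g x)\<^sup>2) \<le> d" using g(4) d by (simp add: real_le_lsqrt real_less_lsqrt less_imp_le)
  obtain B where B: "B > 0" "\<And>x. \<bar>g x\<bar> \<le> B" using continuous_zero_outside_bounded g by metis
  obtain R where R: "K \<subseteq> cball 0 R" using compact_imp_bounded[OF g(2)] by (force simp: bounded_iff subset_eq)
  obtain C where C: "\<And>n. norm (c n) \<le> C" using c convergent_imp_Bseq[of c] by (auto simp: convergent_def Bseq_def)
  have "(\<lambda>n. LINT x|lborel. F x * g (c n + x)) \<longlonglongrightarrow> (LINT x|lborel. F x * g x)"
  proof (rule sq_tendsto_pairing[OF F sg sq_int_translate[OF sg]])
    show "(\<lambda>n. LINT x|lborel. (g (c n + x) - g x)\<^sup>2) \<longlonglongrightarrow> 0"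
    proof (rule integral_sq_dominated)
      show "integrable lborel (\<lambda>x::'a. 4 * B\<^sup>2 * indicator (cball 0 (R + C)) x)"
        by (rule integrable_const_cball)
      show "(\<lambda>x. g (c n + x) - g x) \<in> borel_measurable borel" for n
        using sq_intD(1)[OF sq_int_diff[OF sq_int_translate[OF sg, of "c n"] sg]] .
      show "(g (c n + x) - g x)\<^sup>2 \<le> 4 * B\<^sup>2 * indicator (cball 0 (R + C)) x" for n x
      proof (cases "x \<in> cball 0 (R + C)")
        case True
        have "\<bar>g (c n + x) - g x\<bar> \<le> 2 * B" using B(2)[of x] B(2)[of "c n + x"] by linarith
        from power_mono[OF this, of 2] True show ?thesis by (simp add: power_mult_distrib)
      next
        case False
        have "norm x \<le> norm (c n + x) + norm (c n)" by (metis add_diff_cancel_left' norm_triangle_ineq4)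
        then have "c n + x \<notin> cball 0 R" "x \<notin> cball 0 R" using False C[of n] order_trans[OF norm_ge_zero C[of n]] by auto
        then have "g (c n + x) = 0" "g x = 0" using g(3) R by blast+
        then show ?thesis by simp
      qed
      have "(\<lambda>n. g (c n + x) - g x) \<longlonglongrightarrow> g (0 + x) - g x" for x
        by (intro tendsto_intros isCont_tendsto_compose[of _ g]) (use g(1) c in \<open>auto intro!: tendsto_eq_intros simp: continuous_on_eq_continuous_at\<close>)
      then show "AE x in lborel. (\<lambda>n. g (c n + x) - g x) \<longlonglongrightarrow> 0" by simp
    qed
  qed
  from LIMSEQ_D[OF this, of "r / 3"] r obtain n0 where
    n0: "\<And>n. n \<ge> n0 \<Longrightarrow> \<bar>(LINT x|lborel. F x * g (c n + x)) - (LINT x|lborel. F x * g x)\<bar> < r / 3" by auto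
  have "\<bar>(LINT x|lborel. F x * v (c n + x)) - (LINT x|lborel. F x * v x)\<bar> < r" if n: "n \<ge> n0" for n
  proof -
    have st: "sq_int (\<lambda>x. v (c n + x))" "sq_int (\<lambda>x. g (c n + x))" using v sg by (auto intro: sq_int_translate)
    have "\<bar>LINT x|lborel. F x * (v (c n + x) - g (c n + x))\<bar> \<le> NF * sqrt (LINT x|lborel. (v (c n + x) - g (c n + x))\<^sup>2)"
      unfolding NF_def by (intro Cauchy_Schwarz_sqrt F sq_int_diff st)
    also have "\<dots> = NF * sqrt (LINT x|lborel. (v x - g x)\<^sup>2)"
      using integral_lborel_translate[of "\<lambda>x. (v x - g x)\<^sup>2" "c n"] sq_intD(1)[OF svg] by simp
    also have "\<dots> \<le> NF * d" using Nvg NF by (intro mult_left_mono)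
    finally have 1: "\<bar>LINT x|lborel. F x * (v (c n + x) - g (c n + x))\<bar> < r / 3" using d by simp
    have "\<bar>LINT x|lborel. F x * (v x - g x)\<bar> \<le> NF * sqrt (LINT x|lborel. (v x - g x)\<^sup>2)"
      unfolding NF_def by (intro Cauchy_Schwarz_sqrt F svg)
    also have "\<dots> \<le> NF * d" using Nvg NF by (intro mult_left_mono)
    finally have 2: "\<bar>LINT x|lborel. F x * (v x - g x)\<bar> < r / 3" using d by simp
    have "(LINT x|lborel. F x * (v (c n + x) - g (c n + x))) = (LINT x|lborel. F x * v (c n + x)) - (LINT x|lborel. F x * g (c n + x))"
      "(LINT x|lborel. F x * (v x - g x)) = (LINT x|lborel. F x * v x) - (LINT x|lborel. F x * g x)"
      by (simp_all add: right_diff_distrib Bochner_Integration.integral_diff integrable_mult_sq F v sg st)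
    with 1 2 n0[OF n] show ?thesis by linarith
  qed
  then show "\<exists>n0. \<forall>n\<ge>n0. norm ((LINT x|lborel. F x * v (c n + x)) - (LINT x|lborel. F x * v x)) < r"
    by (intro exI[of _ n0]) auto
qed

section \<open>The energy identity\<close>

lemma nn_integral_lborel_translate:
  fixes f :: "real \<Rightarrow> ennreal"
  assumes "f \<in> borel_measurable borel"
  shows "(\<integral>\<^sup>+x. f (x + c) \<partial>lborel) = (\<integral>\<^sup>+x. f x \<partial>lborel)"
  using assms by (subst (2) lborel_distr_plus[of c, symmetric]) (simp add: nn_integral_distr add.commute)

text \<open>By Fubini: for a fixed second component the map is a translation of the line. It serves
  to pass from a pair of times s, t to the shift h = s - t and t.\<close>

lemma distr_shear:
  fixes c :: "'b::euclidean_space \<Rightarrow> real"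
  assumes [measurable]: "c \<in> borel_measurable borel"
  shows "distr lborel borel (\<lambda>p. (fst p + c (snd p), snd p)) = (lborel :: (real \<times> 'b) measure)"
proof (rule measure_eqI)
  fix A assume "A \<in> sets (distr lborel borel (\<lambda>p. (fst p + c (snd p), snd p)))"
  then have A [measurable]: "A \<in> sets borel" by simp
  have T [measurable]: "(\<lambda>p. (fst p + c (snd p), snd p)) \<in> borel_measurable (borel :: (real \<times> 'b) measure)"
    unfolding borel_prod[symmetric] by measurable
  have ind [measurable]: "(indicator A :: real \<times> 'b \<Rightarrow> ennreal) \<in> borel_measurable (borel \<Otimes>\<^sub>M borel)"
    unfolding borel_prod by measurable
  have indT: "(\<lambda>p. indicator A (fst p + c (snd p), snd p) :: ennreal) \<in> borel_measurable (lborel \<Otimes>\<^sub>M lborel)"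
    using measurable_compose[OF T, of "indicator A" borel] by (simp add: lborel_prod)
  have "emeasure (distr lborel borel (\<lambda>p. (fst p + c (snd p), snd p))) A
    = (\<integral>\<^sup>+p. indicator A p \<partial>distr lborel borel (\<lambda>p. (fst p + c (snd p), snd p)))" by simp
  also have "\<dots> = (\<integral>\<^sup>+p. indicator A (fst p + c (snd p), snd p) \<partial>lborel)"
    by (subst nn_integral_distr) auto
  also have "\<dots> = (\<integral>\<^sup>+y. (\<integral>\<^sup>+x. indicator A (x + c y, y) \<partial>lborel) \<partial>lborel)"
    using lborel_pair.nn_integral_snd[OF indT] by (simp add: lborel_prod)
  also have "\<dots> = (\<integral>\<^sup>+y. (\<integral>\<^sup>+x. indicator A (x, y) \<partial>lborel) \<partial>lborel)"
  proof (rule nn_integral_cong)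
    fix y :: 'b
    have "(\<lambda>x. indicator A (x, y) :: ennreal) \<in> borel_measurable borel"
      by (rule measurable_compose[OF _ ind]) simp
    from nn_integral_lborel_translate[OF this] show
      "(\<integral>\<^sup>+x. indicator A (x + c y, y) \<partial>lborel) = (\<integral>\<^sup>+x. indicator A (x, y) \<partial>lborel)" .
  qed
  also have "\<dots> = (\<integral>\<^sup>+p. indicator A p \<partial>lborel)"
    using lborel_pair.nn_integral_snd[of "indicator A"] ind by (simp add: lborel_prod)
  also have "\<dots> = emeasure lborel A" by simp
  finally show "emeasure (distr lborel borel (\<lambda>p. (fst p + c (snd p), snd p))) A = emeasure lborel A" .
qed simp

section \<open>Correlations in time and their mollification\<close>

definition corr :: "(real \<times> 'b::euclidean_space \<Rightarrow> real) \<Rightarrow> (real \<times> 'b \<Rightarrow> real) \<Rightarrow> real \<Rightarrow> real" where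
  "corr F v h = (LINT z|lborel. F z * v (h + fst z, snd z))"

lemma translate_fst: "sq_int v \<Longrightarrow> sq_int (\<lambda>z. v (h + fst z, snd z))"
proof -
  assume "sq_int v"
  from sq_int_translate[OF this, of "(h, 0)"] show ?thesis
    by (rule back_subst[of sq_int]) (auto simp: fun_eq_iff)
qed

lemma corr_bound:
  assumes "sq_int F" "sq_int v"
  shows "\<bar>corr F v h\<bar> \<le> sqrt (LINT z|lborel. (F z)\<^sup>2) * sqrt (LINT z|lborel. (v z)\<^sup>2)"
proof -
  have m: "(\<lambda>z. (v z)\<^sup>2) \<in> borel_measurable borel" using sq_intD(1)[OF assms(2)] by simp
  have "(LINT z|lborel. (v (h + fst z, snd z))\<^sup>2) = (LINT z|lborel. (v ((h, 0) + z))\<^sup>2)"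
    by (rule Bochner_Integration.integral_cong) (auto simp: plus_prod_def)
  also have "\<dots> = (LINT z|lborel. (v z)\<^sup>2)" by (rule integral_lborel_translate[OF m])
  finally show ?thesis
    unfolding corr_def using Cauchy_Schwarz_sqrt[OF assms(1) translate_fst[OF assms(2), of h]] by simp
qed

lemma corr_measurable_pair:
  fixes F v :: "real \<times> 'b::euclidean_space \<Rightarrow> real"
  assumes [measurable]: "F \<in> borel_measurable borel" "v \<in> borel_measurable borel"
  shows "(\<lambda>(h, z). F z * v (h + fst z, snd z)) \<in> borel_measurable (lborel \<Otimes>\<^sub>M lborel)"
proof -
  have "(\<lambda>p::real \<times> (real \<times> 'b). (fst p + fst (snd p), snd (snd p))) \<in> borel \<rightarrow>\<^sub>M borel"
    by (intro borel_measurable_continuous_onI continuous_intros)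
  from measurable_compose[OF this assms(2)]
  have 1: "(\<lambda>p::real \<times> (real \<times> 'b). v (fst p + fst (snd p), snd (snd p))) \<in> borel_measurable borel" .
  have "(\<lambda>p::real \<times> (real \<times> 'b). snd p) \<in> borel \<rightarrow>\<^sub>M borel"
    by (intro borel_measurable_continuous_onI continuous_intros)
  from measurable_compose[OF this assms(1)] 1 show ?thesis
    by (simp add: lborel_prod case_prod_unfold)
qed

lemma corr_measurable:
  assumes "F \<in> borel_measurable borel" "v \<in> borel_measurable borel"
  shows "corr F v \<in> borel_measurable borel"
  using lborel.borel_measurable_lebesgue_integral[OF corr_measurable_pair[OF assms]]
  by (simp add: corr_def[abs_def])

text \<open>A translation by \<open>h\<close> in time exchanges the two copies of \<open>F\<close>,
  because the weight \<open>p\<close> does not depend on time.\<close>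

lemma corr_even:
  fixes F :: "real \<times> 'b::euclidean_space \<Rightarrow> real"
  assumes F: "F \<in> borel_measurable borel" and p: "p \<in> borel_measurable borel"
  shows "corr F (\<lambda>z. p (snd z) * F z) (- h) = corr F (\<lambda>z. p (snd z) * F z) h"
proof -
  have s: "(\<lambda>z::real \<times> 'b. p (snd z)) \<in> borel_measurable borel"
    by (rule measurable_compose[OF _ p]) (auto intro!: borel_measurable_continuous_onI continuous_intros)
  have t: "(\<lambda>z::real \<times> 'b. F (- h + fst z, snd z)) \<in> borel_measurable borel"
    by (rule measurable_compose[OF _ F]) (auto intro!: borel_measurable_continuous_onI continuous_intros)
  let ?g = "\<lambda>z. F z * (p (snd z) * F (- h + fst z, snd z))"
  have "corr F (\<lambda>z. p (snd z) * F z) (- h) = (LINT z|lborel. ?g z)" by (simp add: corr_def)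
  also have "\<dots> = (LINT z|lborel. ?g ((h, 0) + z))"
    by (rule integral_lborel_translate[symmetric]) (use F s t in simp)
  also have "\<dots> = corr F (\<lambda>z. p (snd z) * F z) h"
    unfolding corr_def by (rule Bochner_Integration.integral_cong) (auto simp: plus_prod_def mult_ac)
  finally show ?thesis .
qed

text \<open>The substitution s = h + t turns the integral over both times into one over the shift
  \<open>h\<close>, of the kernel times a correlation. Absolute integrability comes from
  Cauchy-Schwarz, which bounds the inner integral over \<open>z\<close> by a constant times
  \<open>\<bar>k (- h)\<bar>\<close>.\<close>

lemma
  fixes F v :: "real \<times> 'b::euclidean_space \<Rightarrow> real"
  assumes F: "sq_int F" and v: "sq_int v" and k: "integrable lborel k"
  defines "G \<equiv> \<lambda>p. k (fst (snd p) - fst p) * (F (snd p) * v (fst p, snd (snd p)))"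
  shows kernel_integrable: "AE s in lborel. integrable lborel (\<lambda>z. k (fst z - s) * (F z * v (s, snd z)))"
    and kernel_integrable2: "integrable lborel (\<lambda>s. LINT z|lborel. k (fst z - s) * (F z * v (s, snd z)))"
    and kernel_integral: "(LINT s|lborel. (LINT z|lborel. k (fst z - s) * (F z * v (s, snd z)))) = (LINT h|lborel. k (- h) * corr F v h)"
proof -
  note mF = sq_intD(1)[OF F] and mv = sq_intD(1)[OF v]
  have mk: "k \<in> borel_measurable borel" using k by auto
  have mG: "G \<in> borel_measurable borel"
    unfolding G_def
    by (intro borel_measurable_times measurable_compose[OF _ mk] measurable_compose[OF _ mF] measurable_compose[OF _ mv])
      (auto intro!: borel_measurable_continuous_onI continuous_intros)
  let ?T = "\<lambda>p::real \<times> (real \<times> 'b). (fst p + fst (snd p), snd p)"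
  have mT: "?T \<in> borel \<rightarrow>\<^sub>M borel" by (intro borel_measurable_continuous_onI continuous_intros)
  have d: "distr lborel borel ?T = lborel"
    by (rule distr_shear) (auto intro!: borel_measurable_continuous_onI continuous_intros)
  have GT: "G (?T (h, z)) = k (- h) * (F z * v (h + fst z, snd z))" for h z by (simp add: G_def)
  define C where "C = sqrt (LINT z|lborel. (F z)\<^sup>2) * sqrt (LINT z|lborel. (v z)\<^sup>2)"
  have mGT: "(\<lambda>p. G (?T p)) \<in> borel_measurable (lborel \<Otimes>\<^sub>M lborel)"
    using measurable_compose[OF mT mG] by (simp add: lborel_prod)
  have iz: "integrable lborel (\<lambda>z. F z * v (h + fst z, snd z))" for h
    by (intro integrable_mult_sq F translate_fst v)
  have km: "integrable lborel (\<lambda>h. k (- h))"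
    using lborel_integrable_real_affine[OF k, of "-1" 0] by simp
  have "integrable (lborel \<Otimes>\<^sub>M lborel) (\<lambda>p. G (?T p))"
  proof (rule lborel_pair.Fubini_integrable[OF mGT])
    show "integrable lborel (\<lambda>h. LINT z|lborel. norm (G (?T (h, z))))"
    proof (rule Bochner_Integration.integrable_bound)
      show "integrable lborel (\<lambda>h. C * \<bar>k (- h)\<bar>)" using km by auto
      show "(\<lambda>h. LINT z|lborel. norm (G (?T (h, z)))) \<in> borel_measurable lborel"
        using mGT by (intro lborel.borel_measurable_lebesgue_integral) (simp add: case_prod_unfold)
      have "norm (LINT z|lborel. norm (G (?T (h, z)))) \<le> norm (C * \<bar>k (- h)\<bar>)" for h
      proof -
        have "(LINT z|lborel. norm (G (?T (h, z)))) = \<bar>k (- h)\<bar> * (LINT z|lborel. \<bar>F z\<bar> * \<bar>v (h + fst z, snd z)\<bar>)"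
          unfolding GT by (simp add: abs_mult)
        also have "(LINT z|lborel. \<bar>F z\<bar> * \<bar>v (h + fst z, snd z)\<bar>) = corr (\<lambda>z. \<bar>F z\<bar>) (\<lambda>z. \<bar>v z\<bar>) h"
          by (simp add: corr_def)
        finally have *: "norm (LINT z|lborel. norm (G (?T (h, z)))) = \<bar>k (- h)\<bar> * \<bar>corr (\<lambda>z. \<bar>F z\<bar>) (\<lambda>z. \<bar>v z\<bar>) h\<bar>"
          by (simp add: abs_mult)
        have "sq_int (\<lambda>z. \<bar>F z\<bar>)" "sq_int (\<lambda>z. \<bar>v z\<bar>)" using F v by (auto simp: sq_int_def)
        from corr_bound[OF this, of h] have "\<bar>corr (\<lambda>z. \<bar>F z\<bar>) (\<lambda>z. \<bar>v z\<bar>) h\<bar> \<le> C" by (simp add: C_def)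
        then have "\<bar>k (- h)\<bar> * \<bar>corr (\<lambda>z. \<bar>F z\<bar>) (\<lambda>z. \<bar>v z\<bar>) h\<bar> \<le> \<bar>k (- h)\<bar> * C"
          by (intro mult_left_mono) auto
        also have "\<dots> \<le> norm (C * \<bar>k (- h)\<bar>)" by (simp add: mult.commute)
        finally show ?thesis using * by simp
      qed
      then show "AE h in lborel. norm (LINT z|lborel. norm (G (?T (h, z)))) \<le> norm (C * \<bar>k (- h)\<bar>)" by simp
    qed
    show "AE h in lborel. integrable lborel (\<lambda>z. G (?T (h, z)))"
      unfolding GT using iz by auto
  qed
  then have iGT: "integrable lborel (\<lambda>p. G (?T p))" by (simp add: lborel_prod)
  have "integrable (distr lborel borel ?T) G"
    using iGT mT mG by (subst integrable_distr_eq) auto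
  then have iG: "integrable (lborel \<Otimes>\<^sub>M lborel) G" unfolding d by (simp add: lborel_prod)
  from lborel_pair.AE_integrable_fst'[OF iG]
  show "AE s in lborel. integrable lborel (\<lambda>z. k (fst z - s) * (F z * v (s, snd z)))" by (simp add: G_def)
  from lborel_pair.integrable_fst'[OF iG]
  show "integrable lborel (\<lambda>s. LINT z|lborel. k (fst z - s) * (F z * v (s, snd z)))" by (simp add: G_def)
  have "(LINT s|lborel. (LINT z|lborel. k (fst z - s) * (F z * v (s, snd z)))) = (LINT p|lborel. G p)"
    using lborel_pair.integral_fst'[OF iG] by (simp add: G_def lborel_prod)
  also have "\<dots> = (LINT p|distr lborel borel ?T. G p)" by (simp add: d)
  also have "\<dots> = (LINT p|lborel. G (?T p))" using mT mG by (intro integral_distr) auto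
  also have "\<dots> = (LINT h|lborel. LINT z|lborel. G (?T (h, z)))"
    using lborel_pair.integral_fst'[of "\<lambda>p. G (?T p)"] iGT by (simp add: lborel_prod)
  also have "\<dots> = (LINT h|lborel. k (- h) * corr F v h)"
    unfolding GT by (simp add: corr_def)
  finally show "(LINT s|lborel. (LINT z|lborel. k (fst z - s) * (F z * v (s, snd z)))) = (LINT h|lborel. k (- h) * corr F v h)" .
qed

text \<open>An approximate identity whose total mass is the integral of \<open>bump\<close> instead
  of 1. This positive factor appears on both sides of the limit identity and cancels.\<close>

definition moll :: "nat \<Rightarrow> real \<Rightarrow> real" where
  "moll n h = real (Suc n) * bump (real (Suc n) * h)"

lemma smooth_moll: "smooth (moll n)"
  unfolding moll_def[abs_def] using smooth_scale[OF smooth_bump, of "real (Suc n)" 0]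
  by (intro smooth_mult smooth_const) simp

lemma moll_even: "moll n (- h) = moll n h"
  by (simp add: moll_def bump_even)

lemma moll_Cc_inf: "moll n \<in> Cc_inf UNIV"
proof (rule Cc_infI[OF smooth_moll, of "{-1..1}"])
  fix h :: real assume "h \<notin> {-1..1}"
  then have "1 * 1 \<le> real (Suc n) * \<bar>h\<bar>" by (intro mult_mono) auto
  then have "\<bar>real (Suc n) * h\<bar> \<ge> 1" by (simp add: abs_mult)
  then show "moll n h = 0" by (simp add: moll_def bump_0)
qed auto

lemma integrable_Cc_inf: "\<phi> \<in> Cc_inf U \<Longrightarrow> integrable lborel \<phi>"
proof -
  assume \<phi>: "\<phi> \<in> Cc_inf U"
  obtain K where K: "compact K" "\<And>x. x \<notin> K \<Longrightarrow> \<phi> x = 0" using Cc_infE[OF \<phi>] by metis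
  have "integrable lborel (\<lambda>x. indicator K x *\<^sub>R \<phi> x)"
    by (rule borel_integrable_compact[OF K(1) smooth_continuous[OF Cc_inf_smooth[OF \<phi>]]])
  then show ?thesis
    by (rule back_subst[of "integrable lborel"]) (use K(2) in \<open>auto simp: fun_eq_iff indicator_def\<close>)
qed

lemma pderiv_dir_odd:
  fixes f :: "real \<Rightarrow> real"
  assumes f: "smooth f" and even: "\<And>x. f (- x) = f x"
  shows "pderiv_dir 1 f (- x) = - pderiv_dir 1 f x"
proof -
  have "((\<lambda>x. f (- x)) has_real_derivative pderiv_dir 1 f (- x) * (- 1)) (at x)"
    by (rule DERIV_chain2[OF smooth_has_real_derivative[OF f]]) (auto intro!: derivative_eq_intros)
  then have "(f has_real_derivative - pderiv_dir 1 f (- x)) (at x)" by (simp add: even)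
  from DERIV_unique[OF this smooth_has_real_derivative[OF f]] show ?thesis by simp
qed

lemma integral_bump_pos: "(LINT h|lborel. bump h) > 0"
proof -
  have ib: "integrable lborel bump"
    by (rule integrable_Cc_inf[OF Cc_infI[OF smooth_bump, of "{-1..1}" UNIV]]) (auto intro!: bump_0)
  have "0 < (ebump (1/2))\<^sup>2 * measure lborel {-1/2..1/2::real}" using ebump_pos[of "1/2"] by simp
  also have "\<dots> = (LINT h|lborel. (ebump (1/2))\<^sup>2 * indicator {-1/2..1/2::real} h)" by simp
  also have "\<dots> \<le> (LINT h|lborel. bump h)"
  proof (rule integral_mono[OF _ ib])
    show "(ebump (1/2))\<^sup>2 * indicator {-1/2..1/2::real} h \<le> bump h" for h
      using bump_ge[of h] bump_range[of h] by (auto simp: indicator_def abs_if)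
  qed (auto intro!: integrable_real_indicator)
  finally show ?thesis .
qed

text \<open>After rescaling, the shift is \<open>h / real (Suc n)\<close> under the fixed weight
  \<open>bump h\<close>. The correlation is bounded by Cauchy-Schwarz and continuous at shift 0, so
  dominated convergence applies.\<close>

lemma moll_corr_tendsto:
  fixes F v :: "real \<times> 'b::euclidean_space \<Rightarrow> real"
  assumes F: "sq_int F" and v: "sq_int v"
  shows "(\<lambda>n. LINT h|lborel. moll n (- h) * corr F v h) \<longlonglongrightarrow> (LINT h|lborel. bump h) * (LINT z|lborel. F z * v z)"
proof -
  have ib: "integrable lborel bump"
    by (rule integrable_Cc_inf[OF Cc_infI[OF smooth_bump, of "{-1..1}" UNIV]]) (auto intro!: bump_0)
  have mc: "corr F v \<in> borel_measurable borel" using corr_measurable sq_intD F v by blast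
  have mb: "bump \<in> borel_measurable borel" by (rule smooth_borel_measurable[OF smooth_bump])
  define C where "C = sqrt (LINT z|lborel. (F z)\<^sup>2) * sqrt (LINT z|lborel. (v z)\<^sup>2)"
  have "(LINT h|lborel. moll n (- h) * corr F v h) = (LINT h|lborel. bump h * corr F v (h / real (Suc n)))" for n
  proof -
    have "(LINT h|lborel. bump h * corr F v (h / real (Suc n)))
       = \<bar>real (Suc n)\<bar> *\<^sub>R (LINT h|lborel. bump (0 + real (Suc n) * h) * corr F v ((0 + real (Suc n) * h) / real (Suc n)))"
      by (rule lborel_integral_real_affine) simp
    also have "\<dots> = (LINT h|lborel. moll n (- h) * corr F v h)"
      by (simp add: moll_def bump_even mult.assoc del: of_nat_Suc)
    finally show ?thesis by simp
  qed
  moreover have "(\<lambda>n. LINT h|lborel. bump h * corr F v (h / real (Suc n))) \<longlonglongrightarrow> (LINT h|lborel. bump h * (LINT z|lborel. F z * v z))"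
  proof (rule integral_dominated_convergence)
    show "integrable lborel (\<lambda>h. C * bump h)" using ib by simp
    show "(\<lambda>h. bump h * corr F v (h / real (Suc n))) \<in> borel_measurable lborel" for n
      using mb measurable_compose[OF _ mc, of "\<lambda>h. h / real (Suc n)" borel] by simp
    show "(\<lambda>h. bump h * (LINT z|lborel. F z * v z)) \<in> borel_measurable lborel" using mb by simp
    show "AE h in lborel. norm (bump h * corr F v (h / real (Suc n))) \<le> C * bump h" for n
      using corr_bound[OF F v] bump_range
      by (intro AE_I2) (auto simp: abs_mult C_def mult.commute[of _ "bump _"] intro!: mult_left_mono)
    have "(\<lambda>n. corr F v (h / real (Suc n))) \<longlonglongrightarrow> (LINT z|lborel. F z * v z)" for h
    proof -
      have "(\<lambda>n. h * inverse (real (Suc n))) \<longlonglongrightarrow> h * 0" by (intro tendsto_intros LIMSEQ_inverse_real_of_nat)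
      then have "(\<lambda>n. (h / real (Suc n), 0::'b)) \<longlonglongrightarrow> 0"
        unfolding zero_prod_def by (intro tendsto_intros) (simp add: divide_inverse)
      from sq_int_translation_continuous[OF F v this] show ?thesis
        by (simp add: corr_def plus_prod_def)
    qed
    then show "AE h in lborel. (\<lambda>n. bump h * corr F v (h / real (Suc n))) \<longlonglongrightarrow> bump h * (LINT z|lborel. F z * v z)"
      by (intro AE_I2 tendsto_intros) auto
  qed
  ultimately show ?thesis by simp
qed

text \<open>
  The solution is tested with \<open>\<zeta>(s) \<zeta>(t) k(t - s) v(s, x)\<close> for an even mollifier \<open>k\<close>, and the result is
  integrated over \<open>s\<close>. The term with \<open>k'\<close> drops out because the autocorrelation of \<open>\<zeta> u\<close> is even.
\<close>

lemma energy_identity: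
  fixes u :: "real \<times> 'b::euclidean_space \<Rightarrow> real" and E H :: "'i \<Rightarrow> real \<times> 'b \<Rightarrow> real"
  assumes \<zeta>: "smooth \<zeta>" and J: "finite J"
    and p: "p \<in> borel_measurable borel" "\<And>x. \<bar>p x\<bar> \<le> B"
    and su: "sq_int (\<lambda>z. \<zeta> (fst z) * u z)" "sq_int (\<lambda>z. pderiv_dir 1 \<zeta> (fst z) * u z)"
    and sE: "\<And>j. j \<in> J \<Longrightarrow> sq_int (\<lambda>z. \<zeta> (fst z) * E j z)"
    and sH: "\<And>j. j \<in> J \<Longrightarrow> sq_int (\<lambda>z. \<zeta> (fst z) * H j z)"
    and eq: "AE s in lborel. \<zeta> s \<noteq> 0 \<longrightarrow> (\<forall>k. smooth k \<longrightarrow>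
      (LINT z|lborel. - (pderiv_dir 1 \<zeta> (fst z) * k (fst z - s) + \<zeta> (fst z) * pderiv_dir 1 k (fst z - s)) * (u z * (p (snd z) * u (s, snd z)))
         + \<zeta> (fst z) * k (fst z - s) * (\<Sum>j\<in>J. E j z * H j (s, snd z))) = 0)"
  shows "(\<Sum>j\<in>J. LINT z|lborel. (\<zeta> (fst z))\<^sup>2 * (E j z * H j z))
     = (LINT z|lborel. pderiv_dir 1 \<zeta> (fst z) * \<zeta> (fst z) * (p (snd z) * (u z)\<^sup>2))"
proof -
  define Xu where "Xu = (\<lambda>z. \<zeta> (fst z) * u z)"
  define Yu where "Yu = (\<lambda>z. pderiv_dir 1 \<zeta> (fst z) * u z)"
  define Xv where "Xv = (\<lambda>z. p (snd z) * Xu z)"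
  define XE where "XE j = (\<lambda>z. \<zeta> (fst z) * E j z)" for j
  define XH where "XH j = (\<lambda>z. \<zeta> (fst z) * H j z)" for j
  have s: "sq_int Xu" "sq_int Yu" "\<And>j. j \<in> J \<Longrightarrow> sq_int (XE j)" "\<And>j. j \<in> J \<Longrightarrow> sq_int (XH j)"
    using su sE sH by (auto simp: Xu_def Yu_def XE_def XH_def)
  have ps: "(\<lambda>z::real \<times> 'b. p (snd z)) \<in> borel_measurable borel"
    by (rule measurable_compose[OF _ p(1)]) (auto intro!: borel_measurable_continuous_onI continuous_intros)
  have sv: "sq_int Xv" unfolding Xv_def by (rule sq_int_mult_bounded[OF s(1) ps p(2)])
  have ik: "integrable lborel (moll n)" "integrable lborel (pderiv_dir 1 (moll n))" for n
    using moll_Cc_inf[of n] by (auto intro!: integrable_Cc_inf Cc_inf_pderiv)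
  define A where "A k F w = (LINT h|lborel. k (- h) * corr F w h)" for k F and w :: "real \<times> 'b \<Rightarrow> real"
  have zero: "A (pderiv_dir 1 (moll n)) Xu Xv = 0" for n
  proof -
    let ?f = "\<lambda>h. pderiv_dir 1 (moll n) (- h) * corr Xu Xv h"
    have "?f (- h) = - ?f h" for h
      using pderiv_dir_odd[OF smooth_moll moll_even, of n "h"] corr_even[OF sq_intD(1)[OF s(1)] p(1), of h]
      by (simp add: Xv_def)
    then have "(LINT h|lborel. ?f h) = - (LINT h|lborel. ?f h)"
      using lborel_integral_real_affine[of "-1" ?f 0] by simp
    then show ?thesis by (simp add: A_def)
  qed
  have id: "(\<Sum>j\<in>J. A (moll n) (XE j) (XH j)) = A (moll n) Yu Xv" for n
  proof -
    let ?k = "moll n" and ?k' = "pderiv_dir 1 (moll n)"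
    let ?I = "\<lambda>k F w s z. k (fst z - s) * (F z * w (s, snd z))"
    let ?L = "\<lambda>k F w s. LINT z|lborel. ?I k F w s z"
    have AEJ: "AE s in lborel. \<forall>j\<in>J. integrable lborel (?I ?k (XE j) (XH j) s)"
      using J by (intro AE_finite_allI kernel_integrable s ik)
    \<comment> \<open>The hypothesis for \<open>k = moll n\<close>, multiplied by
      \<open>\<zeta> s\<close> and split into kernel terms; where \<open>\<zeta> s = 0\<close> all
      of them vanish.\<close>
    have "AE s in lborel. (\<Sum>j\<in>J. ?L ?k (XE j) (XH j) s) - ?L ?k Yu Xv s - ?L ?k' Xu Xv s = 0"
      using eq AEJ kernel_integrable[OF s(2) sv ik(1)[of n]] kernel_integrable[OF s(1) sv ik(2)[of n]]
    proof eventually_elim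
      case (elim s)
      have "(\<Sum>j\<in>J. ?L ?k (XE j) (XH j) s) - ?L ?k Yu Xv s - ?L ?k' Xu Xv s
        = (LINT z|lborel. (\<Sum>j\<in>J. ?I ?k (XE j) (XH j) s z) - ?I ?k Yu Xv s z - ?I ?k' Xu Xv s z)"
        using elim(2-4) by (subst Bochner_Integration.integral_diff; (subst Bochner_Integration.integral_diff)?)
          (auto intro!: Bochner_Integration.integrable_sum Bochner_Integration.integrable_diff simp: Bochner_Integration.integral_sum)
      also have "\<dots> = (LINT z|lborel. \<zeta> s * (- (pderiv_dir 1 \<zeta> (fst z) * ?k (fst z - s) + \<zeta> (fst z) * ?k' (fst z - s)) * (u z * (p (snd z) * u (s, snd z)))
         + \<zeta> (fst z) * ?k (fst z - s) * (\<Sum>j\<in>J. E j z * H j (s, snd z))))"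
        by (rule Bochner_Integration.integral_cong)
          (auto simp: Xu_def Yu_def Xv_def XE_def XH_def algebra_simps sum_distrib_left intro!: sum.cong)
      also have "\<dots> = 0" using elim(1) smooth_moll[of n] by (cases "\<zeta> s = 0") auto
      finally show ?case .
    qed
    then have "(LINT s|lborel. (\<Sum>j\<in>J. ?L ?k (XE j) (XH j) s) - ?L ?k Yu Xv s - ?L ?k' Xu Xv s) = 0"
      by (rule integral_eq_zero_AE)
    also have "(LINT s|lborel. (\<Sum>j\<in>J. ?L ?k (XE j) (XH j) s) - ?L ?k Yu Xv s - ?L ?k' Xu Xv s)
       = (\<Sum>j\<in>J. LINT s|lborel. ?L ?k (XE j) (XH j) s) - (LINT s|lborel. ?L ?k Yu Xv s) - (LINT s|lborel. ?L ?k' Xu Xv s)"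
      using kernel_integrable2[OF s(3) s(4) ik(1)[of n]] kernel_integrable2[OF s(2) sv ik(1)[of n]] kernel_integrable2[OF s(1) sv ik(2)[of n]]
      by (subst Bochner_Integration.integral_diff; (subst Bochner_Integration.integral_diff)?)
         (auto intro!: Bochner_Integration.integrable_sum Bochner_Integration.integrable_diff simp: Bochner_Integration.integral_sum)
    also have "\<dots> = (\<Sum>j\<in>J. A ?k (XE j) (XH j)) - A ?k Yu Xv - A ?k' Xu Xv"
      using kernel_integral[OF s(3) s(4) ik(1)[of n]] kernel_integral[OF s(2) sv ik(1)[of n]] kernel_integral[OF s(1) sv ik(2)[of n]]
      by (simp add: A_def)
    finally show ?thesis using zero[of n] by simp
  qed
  have lim1: "(\<lambda>n. \<Sum>j\<in>J. A (moll n) (XE j) (XH j)) \<longlonglongrightarrow> (\<Sum>j\<in>J. (LINT h|lborel. bump h) * (LINT z|lborel. XE j z * XH j z))"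
    unfolding A_def by (intro tendsto_sum moll_corr_tendsto s)
  have lim2: "(\<lambda>n. A (moll n) Yu Xv) \<longlonglongrightarrow> (LINT h|lborel. bump h) * (LINT z|lborel. Yu z * Xv z)"
    unfolding A_def by (intro moll_corr_tendsto s sv)
  have "(\<Sum>j\<in>J. (LINT h|lborel. bump h) * (LINT z|lborel. XE j z * XH j z)) = (LINT h|lborel. bump h) * (LINT z|lborel. Yu z * Xv z)"
    using LIMSEQ_unique[OF lim1] lim2 unfolding id by blast
  then have "(\<Sum>j\<in>J. LINT z|lborel. XE j z * XH j z) = (LINT z|lborel. Yu z * Xv z)"
    using integral_bump_pos by (simp add: sum_distrib_left[symmetric])
  moreover have "(\<lambda>z. XE j z * XH j z) = (\<lambda>z. (\<zeta> (fst z))\<^sup>2 * (E j z * H j z))" for j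
    by (auto simp: XE_def XH_def power2_eq_square mult_ac)
  moreover have "(\<lambda>z. Yu z * Xv z) = (\<lambda>z. pderiv_dir 1 \<zeta> (fst z) * \<zeta> (fst z) * (p (snd z) * (u z)\<^sup>2))"
    by (auto simp: Yu_def Xv_def Xu_def power2_eq_square mult_ac)
  ultimately show ?thesis by simp
qed

section \<open>The Poincare inequality on strips\<close>

lemma Pair_0_Basis: "k \<in> Basis \<Longrightarrow> (0, k) \<in> Basis"
  by (auto simp: Basis_prod_def)

lemma indicator_square: "(indicator A x)\<^sup>2 = (indicator A x :: real)"
  by (simp add: indicator_def)

lemma integral_Icc_sq_le:
  fixes f :: "real \<Rightarrow> real"
  assumes f: "continuous_on UNIV f"
  shows "(LINT t|lborel. f t * indicator {0..1} t)\<^sup>2 \<le> (LINT t|lborel. (f t)\<^sup>2 * indicator {0..1} t)"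
proof -
  have m: "f \<in> borel_measurable borel" using f by (rule borel_measurable_continuous_onI)
  have "integrable lborel (\<lambda>t. indicator {0..1} t *\<^sub>R (f t)\<^sup>2)"
    by (rule borel_integrable_compact) (auto intro!: continuous_intros continuous_on_subset[OF f])
  then have 1: "sq_int (\<lambda>t. f t * indicator {0..1} t)"
    using m by (auto simp: sq_int_def power_mult_distrib mult.commute indicator_square)
  have 2: "sq_int (indicator {0..1::real})"
    by (auto simp: sq_int_def indicator_square intro!: integrable_real_indicator)
  have "(LINT t|lborel. f t * indicator {0..1} t * indicator {0..1} t) = (LINT t|lborel. f t * indicator {0..1} t)"
    by (rule Bochner_Integration.integral_cong) (auto simp: indicator_def)
  with Cauchy_Schwarz_sq[OF 1 2] show ?thesis by (simp add: indicator_square power_mult_distrib)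
qed

text \<open>The fundamental theorem of calculus on the segment, then Cauchy-Schwarz in
  \<open>t\<close> over the unit interval and over the coordinates of \<open>h\<close>. The segment
  moves in the second factor only, hence only derivatives along that factor occur.\<close>

lemma segment_estimate:
  fixes \<phi> :: "'c::euclidean_space \<times> 'b::euclidean_space \<Rightarrow> real"
  assumes \<phi>: "smooth \<phi>" and 0: "\<phi> (fst x, snd x + h) = 0"
  shows "(\<phi> x)\<^sup>2 \<le> (norm h)\<^sup>2 * (LINT t|lborel. (\<Sum>k\<in>Basis. (pderiv_dir (0, k) \<phi> (fst x, snd x + t *\<^sub>R h))\<^sup>2) * indicator {0..1} t)"
proof -
  define \<gamma> where "\<gamma> t = (fst x, snd x + t *\<^sub>R h)" for t
  define F where "F t = \<phi> (\<gamma> t)" for t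
  define F' where "F' t = (\<Sum>k\<in>Basis. (h \<bullet> k) * pderiv_dir (0, k) \<phi> (\<gamma> t))" for t
  define g where "g t = (\<Sum>k\<in>Basis. (pderiv_dir (0, k) \<phi> (\<gamma> t))\<^sup>2)" for t
  have c\<gamma>: "continuous_on UNIV \<gamma>" unfolding \<gamma>_def by (intro continuous_intros)
  have cp: "continuous_on UNIV (\<lambda>t. pderiv_dir (0, k) \<phi> (\<gamma> t))" if "k \<in> Basis" for k
    by (rule continuous_on_compose2[OF smooth_continuous[OF smooth_pderiv_Basis[OF \<phi>]] c\<gamma>, of "(0, k)" UNIV]) (use that in \<open>auto intro: Pair_0_Basis\<close>)
  have cF': "continuous_on UNIV F'" unfolding F'_def by (intro continuous_intros cp)
  have cg: "continuous_on UNIV g" unfolding g_def by (intro continuous_intros cp)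
  have D: "(F has_real_derivative F' t) (at t)" for t
  proof -
    have 1: "(\<gamma> has_derivative (\<lambda>s. (0, s *\<^sub>R h))) (at t)"
      unfolding \<gamma>_def by (auto intro!: derivative_eq_intros)
    have 2: "(\<phi> has_derivative (\<lambda>v. pderiv_dir v \<phi> (\<gamma> t))) (at (\<gamma> t))" by (rule smooth_has_derivative[OF \<phi>])
    have lin: "linear (\<lambda>v. pderiv_dir v \<phi> (\<gamma> t))" using has_derivative_linear[OF 2] .
    have "pderiv_dir (0, s *\<^sub>R h) \<phi> (\<gamma> t) = F' t * s" for s
    proof -
      have "(0, s *\<^sub>R h) = (\<Sum>k\<in>Basis. (s * (h \<bullet> k)) *\<^sub>R (0::'c, k))"
        by (simp add: prod_eq_iff fst_sum snd_sum euclidean_representation flip: scaleR_scaleR scaleR_sum_right)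
      then have "pderiv_dir (0, s *\<^sub>R h) \<phi> (\<gamma> t) = (\<Sum>k\<in>Basis. (s * (h \<bullet> k)) *\<^sub>R pderiv_dir (0, k) \<phi> (\<gamma> t))"
        by (simp only: linear_sum[OF lin] linear_scale[OF lin])
      then show ?thesis
        by (simp add: F'_def sum_distrib_left mult_ac)
    qed
    with has_derivative_compose[OF 1 2] show ?thesis
      by (simp add: has_field_derivative_def F_def[abs_def])
  qed
  have "(LINT t|lborel. F' t * indicator {0..1} t) = F 1 - F 0"
    by (rule integral_FTC_Icc_real) (use D cF' in \<open>auto simp: continuous_on_eq_continuous_at\<close>)
  also have "\<dots> = - \<phi> x" using 0 by (simp add: F_def \<gamma>_def)
  finally have "(\<phi> x)\<^sup>2 = (LINT t|lborel. F' t * indicator {0..1} t)\<^sup>2" by simp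
  also have "\<dots> \<le> (LINT t|lborel. (F' t)\<^sup>2 * indicator {0..1} t)" by (rule integral_Icc_sq_le[OF cF'])
  also have "\<dots> \<le> (LINT t|lborel. (norm h)\<^sup>2 * (g t * indicator {0..1} t))"
  proof (rule integral_mono)
    have i: "integrable lborel (\<lambda>t. f t * indicator {0..1} t)" if "continuous_on UNIV f" for f :: "real \<Rightarrow> real"
      using borel_integrable_compact[OF compact_Icc continuous_on_subset[OF that], of 0 1] by (simp add: mult.commute)
    show "integrable lborel (\<lambda>t. (F' t)\<^sup>2 * indicator {0..1} t)" by (intro i continuous_intros cF')
    show "integrable lborel (\<lambda>t. (norm h)\<^sup>2 * (g t * indicator {0..1} t))" by (intro integrable_mult_right i cg)
    have "(F' t)\<^sup>2 \<le> (norm h)\<^sup>2 * g t" for t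
    proof -
      have "(F' t)\<^sup>2 \<le> (\<Sum>k\<in>Basis. (h \<bullet> k)\<^sup>2) * g t"
        unfolding F'_def g_def by (rule Cauchy_Schwarz_ineq_sum)
      also have "(\<Sum>k\<in>Basis. (h \<bullet> k)\<^sup>2) = (norm h)\<^sup>2"
        unfolding power2_norm_eq_inner by (simp add: euclidean_inner[of h h] power2_eq_square)
      finally show ?thesis .
    qed
    then show "(F' t)\<^sup>2 * indicator {0..1} t \<le> (norm h)\<^sup>2 * (g t * indicator {0..1} t)" for t
      by (simp add: indicator_def)
  qed
  also have "\<dots> = (norm h)\<^sup>2 * (LINT t|lborel. g t * indicator {0..1} t)" by simp
  finally show ?thesis by (simp add: g_def \<gamma>_def)
qed

text \<open>
  If \<open>x + h\<close> lies outside the strip, then \<open>\<phi>(x)\<close> is an integral of the gradient along the segment from \<open>x\<close> to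
  \<open>x + h\<close>. The shifts \<open>h\<close> in a ball of volume at least \<open>2V\<close> that leave the cross-section \<open>W\<close> have volume at
  least \<open>V\<close>; integrate over them and over \<open>x\<close>.
\<close>

lemma poincare_strip:
  fixes \<phi> :: "'c::euclidean_space \<times> 'b::euclidean_space \<Rightarrow> real"
  assumes \<phi>: "\<phi> \<in> Cc_inf (UNIV \<times> W)" and W: "W \<in> sets borel" "emeasure lborel W = ennreal V" "V > 0"
    and r: "measure lborel (ball (0::'b) r) \<ge> 2 * V" "r > 0"
  shows "V * (LINT x|lborel. (\<phi> x)\<^sup>2)
    \<le> r\<^sup>2 * measure lborel (ball (0::'b) r) * (\<Sum>k\<in>Basis. LINT x|lborel. (pderiv_dir (0, k) \<phi> x)\<^sup>2)"
proof -
  define g where "g x = (\<Sum>k\<in>Basis. (pderiv_dir (0, k) \<phi> x)\<^sup>2)" for x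
  note s\<phi> = Cc_inf_smooth[OF \<phi>]
  define \<mu> where "\<mu> = measure lborel (ball (0::'b) r)"
  have \<mu>: "emeasure lborel (ball (0::'b) r) = ennreal \<mu>"
    using emeasure_bounded_finite[OF bounded_ball[of "0::'b" r]] unfolding \<mu>_def by (intro emeasure_eq_ennreal_measure) auto
  have \<mu>0: "\<mu> \<ge> 0" by (simp add: \<mu>_def)
  have cg: "continuous_on UNIV g"
    unfolding g_def by (intro continuous_intros smooth_continuous smooth_pderiv_Basis s\<phi> Pair_0_Basis)
  have g0: "g x \<ge> 0" for x by (auto simp: g_def intro: sum_nonneg)
  have mg: "g \<in> borel_measurable borel" using cg by (rule borel_measurable_continuous_onI)
  have id: "integrable lborel (\<lambda>x. (pderiv_dir (0, k) \<phi> x)\<^sup>2)" if "k \<in> Basis" for k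
  proof -
    have "(\<lambda>x. pderiv_dir (0, k) \<phi> x * pderiv_dir (0, k) \<phi> x) \<in> Cc_inf (UNIV \<times> W)"
      using that by (intro Cc_inf_mult Cc_inf_pderiv \<phi> smooth_pderiv_Basis s\<phi> Pair_0_Basis)
    from integrable_Cc_inf[OF this] show ?thesis by (simp add: power2_eq_square)
  qed
  have ig: "integrable lborel g" unfolding g_def by (intro Bochner_Integration.integrable_sum id)
  have \<phi>0: "\<phi> x = 0" if "x \<notin> UNIV \<times> W" for x
    using Cc_infE[OF \<phi>] that by (metis subsetD)
  have i\<phi>: "integrable lborel (\<lambda>x. (\<phi> x)\<^sup>2)"
    using integrable_Cc_inf[OF Cc_inf_mult[OF \<phi> s\<phi>]] by (simp add: power2_eq_square)
  have m\<phi>: "\<phi> \<in> borel_measurable borel" by (rule smooth_borel_measurable[OF s\<phi>])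
  \<comment> \<open>The bound of \<open>segment_estimate\<close> with \<open>norm h\<close> enlarged
    to \<open>r\<close>, as a function of \<open>x\<close> and of \<open>w = (h, t)\<close>. Its
    values are nonnegative extended reals, so Tonelli exchanges the integrals.\<close>
  define \<Phi> where "\<Phi> x w = ennreal (indicator (ball 0 r) (fst w) * r\<^sup>2 * (g (fst x, snd x + snd w *\<^sub>R fst w) * indicator {0..1} (snd w)))"
    for x :: "'c \<times> 'b" and w :: "'b \<times> real"
  have m\<Phi>: "(\<lambda>p. \<Phi> (fst p) (snd p)) \<in> borel_measurable (borel :: (('c \<times> 'b) \<times> ('b \<times> real)) measure)"
  proof -
    have 1: "(\<lambda>p::('c \<times> 'b) \<times> ('b \<times> real). g (fst (fst p), snd (fst p) + snd (snd p) *\<^sub>R fst (snd p))) \<in> borel_measurable borel"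
      by (rule measurable_compose[OF _ mg]) (auto intro!: borel_measurable_continuous_onI continuous_intros)
    have 2: "(\<lambda>p::('c \<times> 'b) \<times> ('b \<times> real). indicator (ball 0 r) (fst (snd p)) :: real) \<in> borel_measurable borel"
      by (rule measurable_compose[OF borel_measurable_continuous_onI borel_measurable_indicator]) (auto intro!: continuous_intros)
    have 3: "(\<lambda>p::('c \<times> 'b) \<times> ('b \<times> real). indicator {0..1} (snd (snd p)) :: real) \<in> borel_measurable borel"
      by (rule measurable_compose[OF borel_measurable_continuous_onI borel_measurable_indicator]) (auto intro!: continuous_intros)
    show ?thesis unfolding \<Phi>_def using 1 2 3 by simp
  qed
  have m\<Phi>w: "(\<lambda>w. \<Phi> x w) \<in> borel_measurable borel" for x
    using measurable_compose[OF _ m\<Phi>, of "\<lambda>w. (x, w)" borel] by (auto intro!: borel_measurable_continuous_onI continuous_intros)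
  have step: "ennreal (V * (\<phi> x)\<^sup>2) \<le> (\<integral>\<^sup>+w. \<Phi> x w \<partial>lborel)" for x
  proof -
    let ?S = "{h \<in> ball 0 r. snd x + h \<notin> W}"
    let ?T = "{h. snd x + h \<in> W}"
    have mT: "?T \<in> sets borel"
      using measurable_sets_borel[of "(+) (snd x)" borel W] W(1) by (simp add: vimage_def)
    have mS: "?S \<in> sets borel"
    proof -
      have "?S = ball 0 r - ?T" by auto
      then show ?thesis using mT by auto
    qed
    have eT: "emeasure lborel ?T = ennreal V"
    proof -
      have "emeasure lborel W = emeasure (distr lborel borel ((+) (snd x))) W" by (simp add: lborel_distr_plus)
      also have "\<dots> = emeasure lborel ?T" using W(1) by (subst emeasure_distr) (auto simp: vimage_def)
      finally show ?thesis using W(2) by simp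
    qed
    \<comment> \<open>The shifts \<open>?T\<close> that lead into the cross-section form a translate
      of \<open>W\<close>, so they can use up at most half of the ball.\<close>
    have "ennreal (2 * V) \<le> ennreal \<mu>" using r(1) by (intro ennreal_leI) (simp add: \<mu>_def)
    also have "\<dots> = emeasure lborel (ball (0::'b) r)" by (simp add: \<mu>)
    also have "\<dots> \<le> emeasure lborel (?S \<union> ?T)" using mS mT by (intro emeasure_mono) auto
    also have "\<dots> \<le> emeasure lborel ?S + emeasure lborel ?T" using mS mT by (intro emeasure_subadditive) auto
    finally have "ennreal V + ennreal V \<le> emeasure lborel ?S + ennreal V"
      unfolding eT using W(3) by (simp flip: ennreal_plus)
    then have eS: "ennreal V \<le> emeasure lborel ?S" by (simp add: ennreal_add_left_cancel_le add.commute)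
    have "ennreal (V * (\<phi> x)\<^sup>2) = ennreal V * ennreal ((\<phi> x)\<^sup>2)" using W(3) by (simp add: ennreal_mult)
    also have "\<dots> \<le> emeasure lborel ?S * ennreal ((\<phi> x)\<^sup>2)" by (intro mult_right_mono eS) simp
    also have "\<dots> = (\<integral>\<^sup>+h. ennreal ((\<phi> x)\<^sup>2) * indicator ?S h \<partial>lborel)"
      using mS by (simp add: nn_integral_cmult mult.commute)
    also have "\<dots> \<le> (\<integral>\<^sup>+h. (\<integral>\<^sup>+t. \<Phi> x (h, t) \<partial>lborel) \<partial>lborel)"
    proof (rule nn_integral_mono)
      fix h :: 'b
      show "ennreal ((\<phi> x)\<^sup>2) * indicator ?S h \<le> (\<integral>\<^sup>+t. \<Phi> x (h, t) \<partial>lborel)"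
      proof (cases "h \<in> ?S")
        case True
        have "\<phi> (fst x, snd x + h) = 0" using True by (intro \<phi>0) auto
        from segment_estimate[OF s\<phi> this]
        have "(\<phi> x)\<^sup>2 \<le> (norm h)\<^sup>2 * (LINT t|lborel. g (fst x, snd x + t *\<^sub>R h) * indicator {0..1} t)" by (simp add: g_def)
        also have "\<dots> \<le> r\<^sup>2 * (LINT t|lborel. g (fst x, snd x + t *\<^sub>R h) * indicator {0..1} t)"
          using True g0 by (intro mult_right_mono power_mono integral_nonneg_AE) (auto simp: indicator_def)
        also have "\<dots> = (LINT t|lborel. r\<^sup>2 * (g (fst x, snd x + t *\<^sub>R h) * indicator {0..1} t))" by simp
        finally have "ennreal ((\<phi> x)\<^sup>2) \<le> ennreal (LINT t|lborel. r\<^sup>2 * (g (fst x, snd x + t *\<^sub>R h) * indicator {0..1} t))"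
          by (rule ennreal_leI)
        also have "\<dots> = (\<integral>\<^sup>+t. ennreal (r\<^sup>2 * (g (fst x, snd x + t *\<^sub>R h) * indicator {0..1} t)) \<partial>lborel)"
        proof (rule nn_integral_eq_integral[symmetric])
          have "continuous_on {0..1} (\<lambda>t. g (fst x, snd x + t *\<^sub>R h))"
            by (rule continuous_on_compose2[OF cg]) (auto intro!: continuous_intros)
          from borel_integrable_compact[OF compact_Icc this]
          show "integrable lborel (\<lambda>t. r\<^sup>2 * (g (fst x, snd x + t *\<^sub>R h) * indicator {0..1} t))"
            by (simp add: mult.commute)
        qed (use g0 in \<open>auto simp: indicator_def\<close>)
        also have "\<dots> = (\<integral>\<^sup>+t. \<Phi> x (h, t) \<partial>lborel)" using True by (simp add: \<Phi>_def)
        finally show ?thesis using True by simp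
      qed simp
    qed
    also have "\<dots> = (\<integral>\<^sup>+w. \<Phi> x w \<partial>lborel)"
      using lborel.nn_integral_fst[of "\<lambda>w. \<Phi> x w" lborel] m\<Phi>w[of x] by (simp add: lborel_prod)
    finally show ?thesis .
  qed
  \<comment> \<open>Makes the integral over \<open>x\<close> independent of \<open>h\<close> and
    \<open>t\<close>; what then remains is the volume of the ball times the unit interval.\<close>
  have trans: "(\<integral>\<^sup>+x. ennreal (g (fst x, snd x + y)) \<partial>lborel) = (\<integral>\<^sup>+x. ennreal (g x) \<partial>lborel)" for y
  proof -
    have "(\<integral>\<^sup>+x. ennreal (g x) \<partial>lborel) = (\<integral>\<^sup>+x. ennreal (g x) \<partial>distr lborel borel ((+) (0, y)))" by (simp add: lborel_distr_plus)
    also have "\<dots> = (\<integral>\<^sup>+x. ennreal (g ((0, y) + x)) \<partial>lborel)" using mg by (subst nn_integral_distr) auto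
    finally show ?thesis by (simp add: plus_prod_def add.commute)
  qed
  have "ennreal (V * (LINT x|lborel. (\<phi> x)\<^sup>2)) = (\<integral>\<^sup>+x. ennreal (V * (\<phi> x)\<^sup>2) \<partial>lborel)"
    using i\<phi> W(3) by (subst nn_integral_eq_integral) auto
  also have "\<dots> \<le> (\<integral>\<^sup>+x. (\<integral>\<^sup>+w. \<Phi> x w \<partial>lborel) \<partial>lborel)" by (intro nn_integral_mono step)
  also have "\<dots> = (\<integral>\<^sup>+w. (\<integral>\<^sup>+x. \<Phi> x w \<partial>lborel) \<partial>lborel)"
    using lborel_pair.Fubini[of "\<lambda>p. \<Phi> (fst p) (snd p)"] m\<Phi> by (simp add: lborel_prod)
  also have "\<dots> = (\<integral>\<^sup>+(w::'b \<times> real). ennreal r^2 * (\<integral>\<^sup>+x. ennreal (g x) \<partial>lborel) * indicator (ball 0 r \<times> {0..1}) w \<partial>lborel)"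
  proof (rule nn_integral_cong)
    fix w :: "'b \<times> real"
    have mgt: "(\<lambda>x. ennreal (g (fst x, snd x + snd w *\<^sub>R fst w))) \<in> borel_measurable lborel"
    proof -
      have "(\<lambda>x::'c \<times> 'b. (fst x, snd x + snd w *\<^sub>R fst w)) \<in> borel \<rightarrow>\<^sub>M borel"
        by (intro borel_measurable_continuous_onI continuous_intros)
      from measurable_compose[OF this mg] show ?thesis by simp
    qed
    have "(\<integral>\<^sup>+x. \<Phi> x w \<partial>lborel) = (\<integral>\<^sup>+x. (indicator (ball 0 r \<times> {0..1}) w * ennreal r^2) * ennreal (g (fst x, snd x + snd w *\<^sub>R fst w)) \<partial>lborel)"
      by (rule nn_integral_cong)
        (use r(2) g0 in \<open>auto simp: \<Phi>_def indicator_def mem_Times_iff ennreal_mult ennreal_power\<close>)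
    also have "\<dots> = (indicator (ball 0 r \<times> {0..1}) w * ennreal r^2) * (\<integral>\<^sup>+x. ennreal (g x) \<partial>lborel)"
      using mgt by (simp add: nn_integral_cmult trans)
    finally show "(\<integral>\<^sup>+x. \<Phi> x w \<partial>lborel) = ennreal r^2 * (\<integral>\<^sup>+x. ennreal (g x) \<partial>lborel) * indicator (ball 0 r \<times> {0..1}) w"
      by (simp add: mult_ac)
  qed
  also have "\<dots> = ennreal r^2 * (\<integral>\<^sup>+x. ennreal (g x) \<partial>lborel) * emeasure lborel (ball (0::'b) r \<times> {0..1::real})"
  proof -
    have "ball (0::'b) r \<times> {0..1::real} \<in> sets lborel"
      by (auto simp: borel_prod[symmetric])
    then show ?thesis by (intro nn_integral_cmult_indicator)
  qed
  also have "emeasure lborel (ball (0::'b) r \<times> {0..1::real}) = ennreal \<mu>"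
    using lborel.emeasure_pair_measure_Times[of "ball (0::'b) r" lborel "{0..1::real}"] by (simp add: lborel_prod \<mu>)
  also have "(\<integral>\<^sup>+x. ennreal (g x) \<partial>lborel) = ennreal (LINT x|lborel. g x)"
    using ig g0 by (intro nn_integral_eq_integral) auto
  also have "ennreal r^2 * ennreal (LINT x|lborel. g x) * ennreal \<mu> = ennreal (r\<^sup>2 * \<mu> * (LINT x|lborel. g x))"
    using r(2) \<mu>0 g0 by (simp add: ennreal_power ennreal_mult[symmetric] integral_nonneg_AE mult_ac)
  finally have "V * (LINT x|lborel. (\<phi> x)\<^sup>2) \<le> r\<^sup>2 * \<mu> * (LINT x|lborel. g x)"
    using \<mu>0 g0 by (subst (asm) ennreal_le_iff) (auto intro!: mult_nonneg_nonneg integral_nonneg_AE)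
  also have "(LINT x|lborel. g x) = (\<Sum>k\<in>Basis. LINT x|lborel. (pderiv_dir (0, k) \<phi> x)\<^sup>2)"
    unfolding g_def by (intro Bochner_Integration.integral_sum id)
  finally show ?thesis by (simp add: \<mu>_def)
qed

text \<open>The ball contains a cube of side \<open>n > max V 1\<close>, whose volume is at least
  \<open>n\<close>.\<close>

lemma exists_ball_measure_ge: "\<exists>r>0. measure lborel (ball (0::'b::euclidean_space) r) \<ge> V"
proof -
  obtain n :: nat where n: "real n > max V 1" using reals_Archimedean2 by blast
  let ?a = "(\<Sum>i\<in>Basis. (real n / 2) *\<^sub>R i) :: 'b"
  have "V \<le> real n ^ DIM('b)"
  proof -
    have "V \<le> real n ^ 1" using n by simp
    also have "\<dots> \<le> real n ^ DIM('b)" using n by (intro power_increasing) (auto simp: Suc_leI)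
    finally show ?thesis .
  qed
  also have "\<dots> = measure lborel (cbox (- ?a) ?a)"
    by (subst content_cbox') (auto simp: box_ne_empty)
  also have "\<dots> \<le> measure lborel (ball (0::'b) (norm ?a + 1))" 
  proof (rule measure_mono_fmeasurable)
    show "cbox (- ?a) ?a \<subseteq> ball 0 (norm ?a + 1)"
    proof
      fix x assume "x \<in> cbox (- ?a) ?a"
      then have "\<bar>x \<bullet> i\<bar> \<le> \<bar>?a \<bullet> i\<bar>" if "i \<in> Basis" for i using that by (fastforce simp: mem_box)
      then have "norm x \<le> norm ?a" by (intro norm_le_componentwise) auto
      then show "x \<in> ball 0 (norm ?a + 1)" by simp
    qed
    show "ball (0::'b) (norm ?a + 1) \<in> fmeasurable lborel"
      using emeasure_bounded_finite[OF bounded_ball] by (intro fmeasurableI) auto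
  qed simp
  finally show ?thesis by (intro exI[of _ "norm ?a + 1"]) (auto intro: add_nonneg_pos)
qed

section \<open>Solutions on the strip\<close>

text \<open>The bounded pieces of the space-time domain on which \<open>W12_loc\<close> provides
  square integrability.\<close>

definition cyl :: "(real ^ 'n) set \<Rightarrow> real \<Rightarrow> real \<Rightarrow> (real \<times> ('n::finite) space) set" where
  "cyl W T R = {-T<..<0} \<times> ({-R<..<R} \<times> W)"

lemma open_cyl: "open W \<Longrightarrow> open (cyl W T R)"
  unfolding cyl_def by (intro open_Times) auto

lemma sq_int_bounded_support:
  fixes f :: "'a::euclidean_space \<Rightarrow> real"
  assumes f: "f \<in> borel_measurable borel" "\<And>x. \<bar>f x\<bar> \<le> B" and S: "S \<in> sets borel" "bounded S" "\<And>x. x \<notin> S \<Longrightarrow> f x = 0"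
  shows "sq_int f"
proof -
  have "sq_int (indicator S :: 'a \<Rightarrow> real)"
    using S emeasure_bounded_finite[OF S(2)] by (auto simp: sq_int_def indicator_square intro!: integrable_real_indicator)
  then show ?thesis
  proof (rule sq_int_bound[OF _ f(1), of _ B])
    show "\<bar>f x\<bar> \<le> B * \<bar>indicator S x\<bar>" for x using f(2)[of x] S(3)[of x] by (cases "x \<in> S") auto
  qed
qed

lemma sq_int_slice:
  fixes F :: "real \<times> 'b::euclidean_space \<Rightarrow> real"
  assumes F: "sq_int F"
  shows "AE s in lborel. sq_int (\<lambda>x. F (s, x))"
proof -
  have "integrable (lborel \<Otimes>\<^sub>M lborel) (\<lambda>z. (F z)\<^sup>2)" using sq_intD(2)[OF F] by (simp add: lborel_prod)
  from lborel_pair.AE_integrable_fst'[OF this] show ?thesis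
  proof eventually_elim
    case (elim s)
    have "(\<lambda>x::'b. (s, x)) \<in> borel \<rightarrow>\<^sub>M borel" by (intro borel_measurable_continuous_onI continuous_intros)
    from measurable_compose[OF this sq_intD(1)[OF F]] elim show ?case by (simp add: sq_int_def)
  qed
qed

lemma measurable_fst_borel: "f \<in> borel_measurable borel \<Longrightarrow>
    (\<lambda>z::'a::euclidean_space \<times> 'b::euclidean_space. f (fst z) :: real) \<in> borel_measurable borel"
  by (rule measurable_compose[of fst borel borel f borel]) (intro borel_measurable_continuous_onI continuous_intros)

lemma measurable_snd_borel: "f \<in> borel_measurable borel \<Longrightarrow>
    (\<lambda>z::'a::euclidean_space \<times> 'b::euclidean_space. f (snd z) :: real) \<in> borel_measurable borel"
  by (rule measurable_compose[of snd borel borel f borel]) (intro borel_measurable_continuous_onI continuous_intros)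

lemma sq_int_tensor:
  fixes f :: "'a::euclidean_space \<Rightarrow> real" and g :: "'b::euclidean_space \<Rightarrow> real"
  assumes f: "sq_int f" and g: "sq_int g"
  shows "sq_int (\<lambda>z. f (fst z) * g (snd z))"
    and "(LINT z|lborel. (f (fst z) * g (snd z))\<^sup>2) = (LINT x|lborel. (f x)\<^sup>2) * (LINT y|lborel. (g y)\<^sup>2)"
proof -
  have m: "(\<lambda>z. f (fst z) * g (snd z)) \<in> borel_measurable borel"
    using measurable_fst_borel[OF sq_intD(1)[OF f], where 'b='b] measurable_snd_borel[OF sq_intD(1)[OF g], where 'a='a] by simp
  have i: "integrable (lborel \<Otimes>\<^sub>M lborel) (\<lambda>z. (f (fst z) * g (snd z))\<^sup>2)"
  proof (rule lborel_pair.Fubini_integrable)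
    show "(\<lambda>z. (f (fst z) * g (snd z))\<^sup>2) \<in> borel_measurable (lborel \<Otimes>\<^sub>M lborel)"
      using m by (simp add: lborel_prod)
    show "integrable lborel (\<lambda>x. LINT y|lborel. norm ((f (fst (x, y)) * g (snd (x, y)))\<^sup>2))"
      using sq_intD(2)[OF f] sq_intD(2)[OF g] by (simp add: power_mult_distrib)
    show "AE x in lborel. integrable lborel (\<lambda>y. (f (fst (x, y)) * g (snd (x, y)))\<^sup>2)"
      using sq_intD(2)[OF g] by (simp add: power_mult_distrib)
  qed
  then show "sq_int (\<lambda>z. f (fst z) * g (snd z))" using m by (simp add: sq_int_def lborel_prod)
  show "(LINT z|lborel. (f (fst z) * g (snd z))\<^sup>2) = (LINT x|lborel. (f x)\<^sup>2) * (LINT y|lborel. (g y)\<^sup>2)"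
    using lborel_pair.integral_fst'[OF i] by (simp add: lborel_prod power_mult_distrib)
qed

text \<open>\<open>P\<close> stands for the sum of the absolute values of the gradient components
  and \<open>S\<close> for the squared Euclidean norm of the gradient, whence
  \<open>P\<^sup>2 \<le> N * S\<close>. Young's inequality with weight \<open>lam / (4 * N)\<close>
  is used for the cutoff term with \<open>A\<close> and for the drift term with \<open>Bq\<close>.
  Each use costs a quarter of \<open>lam * S\<close>, so that half of the ellipticity is left.
  \<open>\<Lambda>\<close> survives only as a factor of \<open>\<psi>'\<^sup>2\<close>.\<close>

lemma pointwise_estimate:
  fixes lam N S P A Bq \<psi> \<psi>' v q c eps \<Lambda> :: real
  assumes "lam > 0" "N > 0" "P\<^sup>2 \<le> N * S" "\<bar>A\<bar> \<le> \<Lambda> * P" "\<bar>Bq\<bar> \<le> sqrt eps * P" "lam * S \<le> q" "c \<le> eps" "eps \<ge> 0" "P \<ge> 0"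
  shows "lam / 2 * (\<psi>\<^sup>2 * S) - (eps * N / lam + eps) * (\<psi>\<^sup>2 * v\<^sup>2) - 4 * N * \<Lambda>\<^sup>2 / lam * (\<psi>'\<^sup>2 * v\<^sup>2)
     \<le> \<psi>\<^sup>2 * q + 2 * \<psi> * \<psi>' * v * A - \<psi>\<^sup>2 * v * Bq - c * (\<psi>\<^sup>2 * v\<^sup>2)"
proof -
  define \<alpha> where "\<alpha> = lam / (4 * N)"
  have \<alpha>: "\<alpha> > 0" using assms by (simp add: \<alpha>_def)
  have young: "2 * x * y \<le> \<alpha> * x\<^sup>2 + y\<^sup>2 / \<alpha>" for x y :: real
  proof -
    have "0 \<le> (\<alpha> * x - y)\<^sup>2 / \<alpha>" using \<alpha> by simp
    also have "\<dots> = \<alpha> * x\<^sup>2 + y\<^sup>2 / \<alpha> - 2 * x * y" using \<alpha> by (simp add: power2_eq_square field_simps)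
    finally show ?thesis by simp
  qed
  have aP: "\<alpha> * P\<^sup>2 \<le> lam / 4 * S"
    using mult_left_mono[OF assms(3), of \<alpha>] \<alpha> assms(2) by (simp add: \<alpha>_def field_simps)
  have "- (2 * \<psi> * \<psi>' * v * A) \<le> 2 * \<bar>\<psi> * \<psi>' * v\<bar> * \<bar>A\<bar>"
    by (metis abs_ge_minus_self abs_mult abs_numeral mult.assoc)
  also have "\<dots> \<le> 2 * \<bar>\<psi> * \<psi>' * v\<bar> * (\<Lambda> * P)" using assms by (intro mult_left_mono) auto
  also have "\<dots> = 2 * (\<bar>\<psi>\<bar> * P) * (\<Lambda> * \<bar>\<psi>'\<bar> * \<bar>v\<bar>)" by (simp add: abs_mult)
  also have "\<dots> \<le> \<alpha> * (\<bar>\<psi>\<bar> * P)\<^sup>2 + (\<Lambda> * \<bar>\<psi>'\<bar> * \<bar>v\<bar>)\<^sup>2 / \<alpha>" by (rule young)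
  also have "\<dots> = \<psi>\<^sup>2 * (\<alpha> * P\<^sup>2) + 4 * N * \<Lambda>\<^sup>2 / lam * (\<psi>'\<^sup>2 * v\<^sup>2)"
    using assms by (simp add: \<alpha>_def power_mult_distrib field_simps)
  also have "\<dots> \<le> \<psi>\<^sup>2 * (lam / 4 * S) + 4 * N * \<Lambda>\<^sup>2 / lam * (\<psi>'\<^sup>2 * v\<^sup>2)"
    using aP by (intro add_right_mono mult_left_mono) auto
  finally have 1: "- (2 * \<psi> * \<psi>' * v * A) \<le> \<psi>\<^sup>2 * (lam / 4 * S) + 4 * N * \<Lambda>\<^sup>2 / lam * (\<psi>'\<^sup>2 * v\<^sup>2)" .
  have "v * Bq \<le> \<bar>v\<bar> * \<bar>Bq\<bar>" by (metis abs_ge_self abs_mult)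
  also have "\<dots> \<le> \<bar>v\<bar> * (sqrt eps * P)" using assms by (intro mult_left_mono) auto
  also have "\<dots> = 2 * P * (sqrt eps * \<bar>v\<bar> / 2)" by simp
  also have "\<dots> \<le> \<alpha> * P\<^sup>2 + (sqrt eps * \<bar>v\<bar> / 2)\<^sup>2 / \<alpha>" by (rule young)
  also have "\<dots> \<le> lam / 4 * S + eps * N / lam * v\<^sup>2"
    using aP assms by (simp add: \<alpha>_def power_mult_distrib power_divide real_sqrt_pow2 field_simps)
  finally have "\<psi>\<^sup>2 * (v * Bq) \<le> \<psi>\<^sup>2 * (lam / 4 * S + eps * N / lam * v\<^sup>2)" by (intro mult_left_mono) auto
  then have 2: "\<psi>\<^sup>2 * v * Bq \<le> \<psi>\<^sup>2 * (lam / 4 * S) + eps * N / lam * (\<psi>\<^sup>2 * v\<^sup>2)"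
    by (simp add: algebra_simps)
  have 3: "\<psi>\<^sup>2 * (lam * S) \<le> \<psi>\<^sup>2 * q" using assms by (intro mult_left_mono) auto
  have 4: "c * (\<psi>\<^sup>2 * v\<^sup>2) \<le> eps * (\<psi>\<^sup>2 * v\<^sup>2)" using assms by (intro mult_right_mono) auto
  have 5: "\<psi>\<^sup>2 * (lam * S) = lam / 2 * (\<psi>\<^sup>2 * S) + \<psi>\<^sup>2 * (lam / 4 * S) + \<psi>\<^sup>2 * (lam / 4 * S)" by (simp add: algebra_simps)
  have 6: "(eps * N / lam + eps) * (\<psi>\<^sup>2 * v\<^sup>2) = eps * N / lam * (\<psi>\<^sup>2 * v\<^sup>2) + eps * (\<psi>\<^sup>2 * v\<^sup>2)" by (rule distrib_right)
  show ?thesis unfolding 6 using 1 2 3 4 5 by linarith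
qed

text \<open>
  A solution all of whose data are replaced by Borel functions; those of \<open>u\<close> and of its gradient \<open>D\<close> vanish
  outside the domain, so that all integrals extend over the whole space. The time derivative only occurs
  on test functions.
\<close>

locale strip_solution =
  fixes W :: "(real ^ 'n::finite) set" and lam \<Lambda> eps Kc :: real
    and a :: "'n space \<Rightarrow> 'n space \<Rightarrow> 'n space \<Rightarrow> real"
    and b :: "'n space \<Rightarrow> 'n space \<Rightarrow> real" and c :: "'n space \<Rightarrow> real"
    and u :: "real \<times> 'n space \<Rightarrow> real" and D :: "'n space \<Rightarrow> real \<times> 'n space \<Rightarrow> real"
  assumes W: "open W" "bounded W" and lam: "lam > 0" and eps: "eps \<ge> 0"
    and meas_a: "\<And>i j. i \<in> Basis \<Longrightarrow> j \<in> Basis \<Longrightarrow> a i j \<in> borel_measurable borel"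
    and meas_b: "\<And>i. i \<in> Basis \<Longrightarrow> b i \<in> borel_measurable borel"
    and meas_c: "c \<in> borel_measurable borel"
    and bnd_a: "\<And>i j x. i \<in> Basis \<Longrightarrow> j \<in> Basis \<Longrightarrow> \<bar>a i j x\<bar> \<le> \<Lambda>"
    and bnd_b: "\<And>i x. i \<in> Basis \<Longrightarrow> \<bar>b i x\<bar> \<le> sqrt eps"
    and bnd_c: "\<And>x. \<bar>c x\<bar> \<le> Kc" "\<And>x. c x \<le> eps"
    and elliptic: "AE x in lborel. x \<in> strip W \<longrightarrow>
      (\<forall>\<xi>. lam * (norm \<xi>)\<^sup>2 \<le> (\<Sum>i\<in>Basis. \<Sum>j\<in>Basis. a i j x * (\<xi> \<bullet> i) * (\<xi> \<bullet> j)))"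
    and meas_u: "u \<in> borel_measurable borel" and meas_D: "\<And>i. i \<in> Basis \<Longrightarrow> D i \<in> borel_measurable borel"
    and u_0: "\<And>z. z \<notin> {..<0} \<times> strip W \<Longrightarrow> u z = 0"
    and D_0: "\<And>i z. i \<in> Basis \<Longrightarrow> z \<notin> {..<0} \<times> strip W \<Longrightarrow> D i z = 0"
    and sq_u: "\<And>T R. T > 0 \<Longrightarrow> R > 0 \<Longrightarrow> sq_int (\<lambda>z. indicator (cyl W T R) z * u z)"
    and sq_D: "\<And>T R i. T > 0 \<Longrightarrow> R > 0 \<Longrightarrow> i \<in> Basis \<Longrightarrow> sq_int (\<lambda>z. indicator (cyl W T R) z * D i z)"
    and weak_D: "\<And>i \<eta>. i \<in> Basis \<Longrightarrow> \<eta> \<in> Cc_inf ({..<0} \<times> strip W) \<Longrightarrow>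
      (LINT z|lborel. u z * pderiv_dir (0, i) \<eta> z) = - (LINT z|lborel. D i z * \<eta> z)"
    and weak_eq: "\<And>\<eta>. \<eta> \<in> Cc_inf ({..<0} \<times> strip W) \<Longrightarrow>
      (LINT z|lborel. - (u z * pderiv_dir (1, 0) \<eta> z)
         + (\<Sum>i\<in>Basis. \<Sum>j\<in>Basis. a i j (snd z) * D j z * pderiv_dir (0, i) \<eta> z)
         - (\<Sum>i\<in>Basis. b i (snd z) * D i z * \<eta> z) - c (snd z) * u z * \<eta> z) = 0"
    and boundary: "\<And>\<psi>. \<psi> \<in> Cc_inf UNIV \<Longrightarrow> AE s in lborel. s < 0 \<longrightarrow> (\<exists>\<phi>. (\<forall>k. \<phi> k \<in> Cc_inf (strip W)) \<and>
        (\<lambda>k. LINT x|lborel. (\<phi> k x - \<psi> (fst x) * u (s, x))\<^sup>2) \<longlonglongrightarrow> 0 \<and>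
        (\<forall>i\<in>Basis. (\<lambda>k. LINT x|lborel. (pderiv_dir i (\<phi> k) x
             - (\<psi> (fst x) * D i (s, x) + pderiv_dir (fst i) \<psi> (fst x) * u (s, x)))\<^sup>2) \<longlonglongrightarrow> 0))"
begin

lemma cyl_borel: "cyl W T R \<in> sets borel"
  using open_cyl[OF W(1)] by simp

text \<open>The index \<open>0\<close>, which is not in \<open>Basis\<close>, stands for the terms of order zero.\<close>

definition E :: "'n space \<Rightarrow> real \<times> 'n space \<Rightarrow> real" where
  "E j z = (if j = 0 then - (\<Sum>i\<in>Basis. b i (snd z) * D i z) - c (snd z) * u z
     else (\<Sum>i\<in>Basis. a j i (snd z) * D i z))"

lemma E_0: "j = 0 \<or> j \<in> Basis \<Longrightarrow> z \<notin> {..<0} \<times> strip W \<Longrightarrow> E j z = 0"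
  by (simp add: E_def u_0 D_0)

lemma sq_E:
  assumes "T > 0" "R > 0" "j = 0 \<or> j \<in> Basis"
  shows "sq_int (\<lambda>z. indicator (cyl W T R) z * E j z)"
proof -
  have aux: "sq_int (\<lambda>z. f (snd z) * (indicator (cyl W T R) z * D i z))"
    if "f \<in> borel_measurable borel" "\<And>x. \<bar>f x\<bar> \<le> B" "i \<in> Basis" for f :: "'n space \<Rightarrow> real" and B i
    by (rule sq_int_mult_bounded[OF sq_D[OF assms(1,2) that(3)] measurable_snd_borel[OF that(1)] that(2)])
  have auxu: "sq_int (\<lambda>z. c (snd z) * (indicator (cyl W T R) z * u z))"
    by (rule sq_int_mult_bounded[OF sq_u[OF assms(1,2)] measurable_snd_borel[OF meas_c] bnd_c(1)])
  consider "j = 0" | "j \<noteq> 0" "j \<in> Basis" using assms(3) by blast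
  then show ?thesis
  proof cases
    case 1
    have "sq_int (\<lambda>z. -1 * (\<Sum>i\<in>Basis. b i (snd z) * (indicator (cyl W T R) z * D i z)) - c (snd z) * (indicator (cyl W T R) z * u z))"
      by (intro sq_int_diff sq_int_cmult sq_int_sum auxu aux[OF meas_b bnd_b])
    then show ?thesis
      by (rule back_subst[of sq_int]) (auto simp: 1 E_def fun_eq_iff algebra_simps sum_distrib_left sum_negf)
  next
    case 2
    have "sq_int (\<lambda>z. (\<Sum>i\<in>Basis. a j i (snd z) * (indicator (cyl W T R) z * D i z)))"
      using 2 by (intro sq_int_sum aux[OF meas_a bnd_a])
    then show ?thesis
      by (rule back_subst[of sq_int]) (use 2 in \<open>auto simp: E_def fun_eq_iff algebra_simps sum_distrib_left\<close>)
  qed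
qed

text \<open>The weak derivative of \<open>\<psi>(x\<^sub>0) u\<close> along
  \<open>i\<close>.\<close>

definition G :: "(real \<Rightarrow> real) \<Rightarrow> 'n space \<Rightarrow> real \<times> 'n space \<Rightarrow> real" where
  "G \<psi> i z = \<psi> (fst (snd z)) * D i z + pderiv_dir (fst i) \<psi> (fst (snd z)) * u z"

lemma pderiv_fst_Basis:
  assumes "\<psi> \<in> Cc_inf (UNIV::real set)" "i \<in> (Basis :: 'n space set)"
  shows "pderiv_dir (fst i) \<psi> = (if i = (1, 0) then pderiv_dir 1 \<psi> else (\<lambda>x. 0))"
proof -
  have "fst i = 0" if "i \<noteq> (1, 0)" using assms(2) that by (auto simp: Basis_prod_def)
  then show ?thesis using pderiv_dir_0[OF Cc_inf_smooth[OF assms(1)]] by auto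
qed

lemma pderiv_fst_measurable_bounded:
  assumes "\<psi> \<in> Cc_inf (UNIV::real set)" "i \<in> (Basis :: 'n space set)"
  shows "pderiv_dir (fst i) \<psi> \<in> borel_measurable borel" "\<exists>B. \<forall>x. \<bar>pderiv_dir (fst i) \<psi> x\<bar> \<le> B"
proof -
  have d: "pderiv_dir 1 \<psi> \<in> Cc_inf UNIV" by (rule Cc_inf_pderiv[OF assms(1)]) simp
  show "pderiv_dir (fst i) \<psi> \<in> borel_measurable borel"
    unfolding pderiv_fst_Basis[OF assms] using smooth_borel_measurable[OF Cc_inf_smooth[OF d]] by simp
  obtain B where "\<And>x. \<bar>pderiv_dir 1 \<psi> x\<bar> \<le> B" "B > 0" using Cc_inf_bounded[OF d] by metis
  then show "\<exists>B. \<forall>x. \<bar>pderiv_dir (fst i) \<psi> x\<bar> \<le> B"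
    unfolding pderiv_fst_Basis[OF assms] by (intro exI[of _ B]) auto
qed

end

section \<open>Testing the equation with a time slice of the solution\<close>

context strip_solution
begin

definition cutoff :: "real \<Rightarrow> real \<Rightarrow> (real \<Rightarrow> real) \<Rightarrow> (real \<Rightarrow> real) \<Rightarrow> bool" where
  "cutoff T R \<theta> \<psi> \<longleftrightarrow> T > 0 \<and> R > 0 \<and> \<theta> \<in> Cc_inf {-T<..<0} \<and> \<psi> \<in> Cc_inf UNIV \<and> (\<forall>x. \<psi> x \<noteq> 0 \<longrightarrow> \<bar>x\<bar> < R)"

lemma cutoff_zero:
  assumes "cutoff T R \<theta> \<psi>"
  shows "t \<notin> {-T<..<0} \<Longrightarrow> \<theta> t = 0" "t \<notin> {-T<..<0} \<Longrightarrow> pderiv_dir 1 \<theta> t = 0"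
    "y \<notin> {-R<..<R} \<Longrightarrow> \<psi> y = 0" 
proof -
  have "\<theta> \<in> Cc_inf {-T<..<0}" using assms by (auto simp: cutoff_def)
  from Cc_infE[OF this] obtain K where "K \<subseteq> {-T<..<0}" "\<And>x. x \<notin> K \<Longrightarrow> \<theta> x = 0" "\<And>x v. x \<notin> K \<Longrightarrow> pderiv_dir v \<theta> x = 0" by metis
  then show "t \<notin> {-T<..<0} \<Longrightarrow> \<theta> t = 0" "t \<notin> {-T<..<0} \<Longrightarrow> pderiv_dir 1 \<theta> t = 0" by blast+
  show "y \<notin> {-R<..<R} \<Longrightarrow> \<psi> y = 0" using assms unfolding cutoff_def abs_less_iff by force
qed

text \<open>Off the cylinder one of \<open>f\<close>, \<open>g\<close> and \<open>F\<close>
  vanishes, so square integrability of \<open>F\<close> on the cylinder is enough. At nonnegative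
  times it is \<open>F\<close> that vanishes.\<close>

lemma sq_int_local:
  assumes F: "sq_int (\<lambda>z. indicator (cyl W T R) z * F z)" "\<And>z. z \<notin> {..<0} \<times> strip W \<Longrightarrow> F z = 0"
    and f: "f \<in> borel_measurable borel" "\<And>t. \<bar>f t\<bar> \<le> B" "\<And>t. t < 0 \<Longrightarrow> t \<notin> {-T<..<0} \<Longrightarrow> f t = 0"
    and g: "g \<in> borel_measurable borel" "\<And>y. \<bar>g y\<bar> \<le> B'" "\<And>y. y \<notin> {-R<..<R} \<Longrightarrow> g y = 0"
  shows "sq_int (\<lambda>z. f (fst z) * g (fst (snd z)) * F z)"
proof -
  have B: "B \<ge> 0" using f(2)[of 0] by linarith
  have "sq_int (\<lambda>z. (f (fst z) * g (fst (snd z))) * (indicator (cyl W T R) z * F z))"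
  proof (rule sq_int_mult_bounded[OF F(1)])
    show "(\<lambda>z::real \<times> 'n space. f (fst z) * g (fst (snd z))) \<in> borel_measurable borel"
      by (intro borel_measurable_times measurable_fst_borel f(1) measurable_snd_borel[of "\<lambda>x. g (fst x)"] g(1))
    show "\<bar>f (fst z) * g (fst (snd z))\<bar> \<le> B * B'" for z :: "real \<times> 'n space"
      unfolding abs_mult using f(2) g(2) B by (intro mult_mono) auto
  qed
  then show ?thesis
  proof (rule back_subst[of sq_int], intro ext)
    fix z :: "real \<times> 'n space"
    show "(f (fst z) * g (fst (snd z))) * (indicator (cyl W T R) z * F z) = f (fst z) * g (fst (snd z)) * F z"
    proof (cases "z \<in> cyl W T R")
      case False
      then have "fst z \<notin> {-T<..<0} \<or> fst (snd z) \<notin> {-R<..<R} \<or> snd (snd z) \<notin> W"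
        by (auto simp: cyl_def mem_Times_iff)
      then have "f (fst z) * g (fst (snd z)) * F z = 0"
        using f(3)[of "fst z"] g(3)[of "fst (snd z)"] F(2)[of z] by (force simp: strip_def mem_Times_iff)
      then show ?thesis using False by simp
    qed simp
  qed
qed

lemma Cc_inf_measurable_bounded:
  assumes "\<phi> \<in> Cc_inf U"
  obtains B where "\<phi> \<in> borel_measurable borel" "\<And>x. \<bar>\<phi> x\<bar> \<le> B"
  using Cc_inf_bounded[OF assms] smooth_borel_measurable[OF Cc_inf_smooth[OF assms]] by metis

text \<open>Expanding the derivatives of the product test function and sorting by
  \<open>\<phi>\<close> and its gradient leaves coefficients that will be shown square integrable in
  space-time. This is the form in which \<open>\<phi>\<close> can be replaced by a limit.\<close>

lemma weak_eq_product:
  assumes \<theta>: "\<theta> \<in> Cc_inf {..<0}" and \<psi>: "\<psi> \<in> Cc_inf UNIV" and \<phi>: "\<phi> \<in> Cc_inf (strip W)"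
  shows "(LINT z|lborel. (- (pderiv_dir 1 \<theta> (fst z) * \<psi> (fst (snd z)) * u z)
            + \<theta> (fst z) * (\<psi> (fst (snd z)) * E 0 z + (\<Sum>i\<in>Basis. pderiv_dir (fst i) \<psi> (fst (snd z)) * E i z))) * \<phi> (snd z)
        + (\<Sum>i\<in>Basis. \<theta> (fst z) * \<psi> (fst (snd z)) * E i z * pderiv_dir i \<phi> (snd z))) = 0"
proof -
  let ?\<kappa> = "\<lambda>x. \<psi> (fst x) * \<phi> x"
  let ?\<eta> = "\<lambda>z. \<theta> (fst z) * ?\<kappa> (snd z)"
  note s\<theta> = Cc_inf_smooth[OF \<theta>] and s\<psi> = Cc_inf_smooth[OF \<psi>] and s\<phi> = Cc_inf_smooth[OF \<phi>]
  have s\<psi>f: "smooth (\<lambda>x::'n space. \<psi> (fst x))" by (rule smooth_fst[OF s\<psi>])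
  have s\<kappa>: "smooth ?\<kappa>" by (intro smooth_mult s\<psi>f s\<phi>)
  have \<kappa>: "?\<kappa> \<in> Cc_inf (strip W)" by (rule Cc_inf_mult[OF \<phi> s\<psi>f])
  have \<eta>: "?\<eta> \<in> Cc_inf ({..<0} \<times> strip W)" by (rule Cc_inf_tensor[OF \<theta> \<kappa>])
  have d1: "pderiv_dir (1, 0) ?\<eta> z = pderiv_dir 1 \<theta> (fst z) * ?\<kappa> (snd z)" for z
    using pderiv_dir_mult[OF smooth_fst[OF s\<theta>] smooth_snd[OF s\<kappa>], of "(1, 0)" z]
    by (simp add: pderiv_dir_fst[OF s\<theta>] pderiv_dir_snd[OF s\<kappa>] pderiv_dir_0[OF s\<kappa>])
  have d2: "pderiv_dir (0, i) ?\<eta> z = \<theta> (fst z) * (\<psi> (fst (snd z)) * pderiv_dir i \<phi> (snd z) + pderiv_dir (fst i) \<psi> (fst (snd z)) * \<phi> (snd z))" for i z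
    using pderiv_dir_mult[OF smooth_fst[OF s\<theta>] smooth_snd[OF s\<kappa>], of "(0, i)" z]
    by (simp add: pderiv_dir_fst[OF s\<theta>] pderiv_dir_snd[OF s\<kappa>] pderiv_dir_0[OF s\<theta>]
        pderiv_dir_mult[OF s\<psi>f s\<phi>] pderiv_dir_fst[OF s\<psi>])
  have S1: "(\<Sum>i\<in>Basis. \<Sum>j\<in>Basis. a i j (snd z) * D j z * pderiv_dir (0, i) ?\<eta> z) = (\<Sum>i\<in>Basis. E i z * pderiv_dir (0, i) ?\<eta> z)" for z
    by (intro sum.cong refl) (auto simp: E_def sum_distrib_right)
  have S2: "- (\<Sum>i\<in>Basis. b i (snd z) * D i z * ?\<eta> z) - c (snd z) * u z * ?\<eta> z = E 0 z * ?\<eta> z" for z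
  proof -
    define S where "S = (\<Sum>i\<in>Basis. b i (snd z) * D i z)"
    have "(\<Sum>i\<in>Basis. b i (snd z) * D i z * ?\<eta> z) = S * ?\<eta> z" by (simp only: S_def sum_distrib_right)
    moreover have "E 0 z = - S - c (snd z) * u z" by (simp add: E_def S_def)
    ultimately show ?thesis by (simp only: left_diff_distrib minus_mult_left)
  qed
  have S3: "- (u z * pderiv_dir (1, 0) ?\<eta> z)
         + (\<Sum>i\<in>Basis. \<Sum>j\<in>Basis. a i j (snd z) * D j z * pderiv_dir (0, i) ?\<eta> z)
         - (\<Sum>i\<in>Basis. b i (snd z) * D i z * ?\<eta> z) - c (snd z) * u z * ?\<eta> z
     = - (u z * pderiv_dir (1, 0) ?\<eta> z) + (\<Sum>i\<in>Basis. E i z * pderiv_dir (0, i) ?\<eta> z) + E 0 z * ?\<eta> z" for z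
    using S1[of z] S2[of z] by linarith
  from weak_eq[OF \<eta>] have "(LINT z|lborel. - (u z * pderiv_dir (1, 0) ?\<eta> z) + (\<Sum>i\<in>Basis. E i z * pderiv_dir (0, i) ?\<eta> z) + E 0 z * ?\<eta> z) = 0"
    by (simp only: S3)
  then show ?thesis
    unfolding d1 d2
    by (rule back_subst[of "\<lambda>f. integral\<^sup>L lborel f = 0"])
      (simp add: fun_eq_iff algebra_simps sum_distrib_left sum_distrib_right sum.distrib)
qed

text \<open>A nonzero function of \<open>x\<close> alone is not square integrable over the infinite
  time axis. Since \<open>A\<close> vanishes outside \<open>(-T, 0)\<close>, the indicator of that
  interval can be attached to \<open>v\<close> without changing the product.\<close>

lemma sq_pairing_slice:
  fixes A :: "real \<times> 'n space \<Rightarrow> real"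
  assumes A: "sq_int A" "\<And>z. fst z \<notin> {-T<..<0} \<Longrightarrow> A z = 0"
    and v: "sq_int v" and p: "\<And>k. sq_int (p k)" and lim: "(\<lambda>k. LINT x|lborel. (p k x - v x)\<^sup>2) \<longlonglongrightarrow> 0"
  shows "integrable lborel (\<lambda>z. A z * v (snd z))"
    and "(\<lambda>k. LINT z|lborel. A z * p k (snd z)) \<longlonglongrightarrow> (LINT z|lborel. A z * v (snd z))"
proof -
  let ?I = "indicator {-T<..<0} :: real \<Rightarrow> real"
  have sI: "sq_int ?I" by (rule sq_int_bounded_support[of _ 1 "{-T<..<0}"]) auto
  have I: "A z * (?I (fst z) * w (snd z)) = A z * w (snd z)" for z and w :: "'n space \<Rightarrow> real"
    using A(2)[of z] by (cases "fst z \<in> {-T<..<0}") auto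
  from integrable_mult_sq[OF A(1) sq_int_tensor(1)[OF sI v]]
  show "integrable lborel (\<lambda>z. A z * v (snd z))" unfolding I .
  have "(LINT z|lborel. (?I (fst z) * p k (snd z) - ?I (fst z) * v (snd z))\<^sup>2) = (LINT t|lborel. (?I t)\<^sup>2) * (LINT x|lborel. (p k x - v x)\<^sup>2)" for k
    using sq_int_tensor(2)[OF sI sq_int_diff[OF p v, of k]] by (simp add: right_diff_distrib)
  then have "(\<lambda>k. LINT z|lborel. (?I (fst z) * p k (snd z) - ?I (fst z) * v (snd z))\<^sup>2) \<longlonglongrightarrow> 0"
    using tendsto_mult[OF tendsto_const lim, of "LINT t|lborel. (?I t)\<^sup>2"] by simp
  from sq_tendsto_pairing[OF A(1) sq_int_tensor(1)[OF sI v] sq_int_tensor(1)[OF sI p] this]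
  show "(\<lambda>k. LINT z|lborel. A z * p k (snd z)) \<longlonglongrightarrow> (LINT z|lborel. A z * v (snd z))" unfolding I .
qed

text \<open>\<open>weak_eq_product\<close> is linear in \<open>\<phi>\<close> and its gradient with
  square integrable coefficients, so it passes to L2 limits. It will be applied with
  \<open>v\<close> the slice of \<open>\<psi> u\<close> at a fixed time \<open>s\<close>, which is
  the function that the boundary condition approximates.\<close>

lemma weak_eq_slice:
  assumes cut: "cutoff T R \<theta> \<psi>" and sub: "\<psi> \<in> Cc_inf {-R<..<R}"
    and \<phi>: "\<And>k. \<phi> k \<in> Cc_inf (strip W)"
    and v: "sq_int v" and limv: "(\<lambda>k. LINT x|lborel. (\<phi> k x - v x)\<^sup>2) \<longlonglongrightarrow> 0"
    and g: "\<forall>i\<in>Basis. sq_int (g i)"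
    and limg: "\<forall>i\<in>Basis. (\<lambda>k. LINT x|lborel. (pderiv_dir i (\<phi> k) x - g i x)\<^sup>2) \<longlonglongrightarrow> 0"
  shows "(LINT z|lborel. (- (pderiv_dir 1 \<theta> (fst z) * \<psi> (fst (snd z)) * u z)
            + \<theta> (fst z) * (\<psi> (fst (snd z)) * E 0 z + (\<Sum>i\<in>Basis. pderiv_dir (fst i) \<psi> (fst (snd z)) * E i z))) * v (snd z)
        + (\<Sum>i\<in>Basis. \<theta> (fst z) * \<psi> (fst (snd z)) * E i z * g i (snd z))) = 0"
proof -
  have TR: "T > 0" "R > 0" and \<theta>: "\<theta> \<in> Cc_inf {-T<..<0}" and \<psi>: "\<psi> \<in> Cc_inf UNIV" using cut by (auto simp: cutoff_def)
  have \<theta>': "\<theta> \<in> Cc_inf {..<0}" by (rule Cc_inf_mono[OF _ \<theta>]) auto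
  obtain B1 where b1: "\<theta> \<in> borel_measurable borel" "\<And>x. \<bar>\<theta> x\<bar> \<le> B1" using Cc_inf_measurable_bounded[OF \<theta>] by metis
  obtain B2 where b2: "pderiv_dir 1 \<theta> \<in> borel_measurable borel" "\<And>x. \<bar>pderiv_dir 1 \<theta> x\<bar> \<le> B2"
    using Cc_inf_measurable_bounded[OF Cc_inf_pderiv[OF \<theta>, of 1]] by auto
  obtain B3 where b3: "\<psi> \<in> borel_measurable borel" "\<And>x. \<bar>\<psi> x\<bar> \<le> B3" using Cc_inf_measurable_bounded[OF \<psi>] by metis
  obtain K where K: "K \<subseteq> {-R<..<R}" "\<And>x w. x \<notin> K \<Longrightarrow> pderiv_dir w \<psi> x = 0" using Cc_infE[OF sub] by metis
  then have K: "y \<notin> {-R<..<R} \<Longrightarrow> pderiv_dir w \<psi> y = 0" for w y by blast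
  define A where "A z = - (pderiv_dir 1 \<theta> (fst z) * \<psi> (fst (snd z)) * u z)
            + \<theta> (fst z) * (\<psi> (fst (snd z)) * E 0 z + (\<Sum>i\<in>Basis. pderiv_dir (fst i) \<psi> (fst (snd z)) * E i z))" for z
  define BB where "BB i z = \<theta> (fst z) * \<psi> (fst (snd z)) * E i z" for i z
  note z = cutoff_zero[OF cut]
  have sB: "sq_int (BB i)" if "i \<in> Basis" for i
    unfolding BB_def using that
    by (intro sq_int_local[OF sq_E[OF TR] E_0 b1 _ b3]) (auto intro: z)
  have sA: "sq_int A"
  proof -
    have 1: "sq_int (\<lambda>z. pderiv_dir 1 \<theta> (fst z) * \<psi> (fst (snd z)) * u z)"
      by (intro sq_int_local[OF sq_u[OF TR] u_0 b2 _ b3]) (auto intro: z)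
    have 2: "sq_int (\<lambda>z. \<theta> (fst z) * \<psi> (fst (snd z)) * E 0 z)"
      by (intro sq_int_local[OF sq_E[OF TR] E_0 b1 _ b3]) (auto intro: z)
    have 3: "sq_int (\<lambda>z. \<theta> (fst z) * pderiv_dir (fst i) \<psi> (fst (snd z)) * E i z)" if i: "i \<in> Basis" for i
    proof -
      obtain B4 where b4: "pderiv_dir (fst i) \<psi> \<in> borel_measurable borel" "\<And>x. \<bar>pderiv_dir (fst i) \<psi> x\<bar> \<le> B4"
        using pderiv_fst_measurable_bounded[OF \<psi> i] by metis
      show ?thesis
        by (rule sq_int_local[OF sq_E[OF TR] E_0 b1 _ b4]) (use i z K in blast)+
    qed
    have "sq_int (\<lambda>z. (\<theta> (fst z) * \<psi> (fst (snd z)) * E 0 z + (\<Sum>i\<in>Basis. \<theta> (fst z) * pderiv_dir (fst i) \<psi> (fst (snd z)) * E i z))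
        - pderiv_dir 1 \<theta> (fst z) * \<psi> (fst (snd z)) * u z)"
      by (intro sq_int_diff sq_int_add sq_int_sum 1 2 3)
    then show ?thesis
      by (rule back_subst[of sq_int]) (simp add: A_def fun_eq_iff algebra_simps sum_distrib_left)
  qed
  have A0: "A z = 0" "BB i z = 0" if "fst z \<notin> {-T<..<0}" for z i
    using z(1,2)[OF that] by (auto simp: A_def BB_def)
  have c: "sq_int (\<phi> k)" "i \<in> Basis \<Longrightarrow> sq_int (pderiv_dir i (\<phi> k))" for k i
    by (rule sq_int_Cc_inf[OF \<phi>], rule sq_int_Cc_inf[OF Cc_inf_pderiv[OF \<phi>]])
  note pv = sq_pairing_slice[OF sA A0(1) v c(1) limv]
  note pg = sq_pairing_slice[OF sB A0(2) bspec[OF g] c(2) bspec[OF limg]]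
  have "(LINT z|lborel. A z * \<phi> k (snd z)) + (\<Sum>i\<in>Basis. LINT z|lborel. BB i z * pderiv_dir i (\<phi> k) (snd z)) = 0" for k
  proof -
    have i1: "integrable lborel (\<lambda>z. A z * \<phi> k (snd z))"
      by (rule sq_pairing_slice(1)[OF sA A0(1), where p="\<lambda>_. \<phi> k"]) (auto intro: c)
    have i2: "integrable lborel (\<lambda>z. BB i z * pderiv_dir i (\<phi> k) (snd z))" if "i \<in> Basis" for i
      by (rule sq_pairing_slice(1)[OF sB[OF that] A0(2), where p="\<lambda>_. pderiv_dir i (\<phi> k)"]) (auto intro: c that)
    have "(LINT z|lborel. A z * \<phi> k (snd z) + (\<Sum>i\<in>Basis. BB i z * pderiv_dir i (\<phi> k) (snd z))) = 0"
      using weak_eq_product[OF \<theta>' \<psi> \<phi>[of k]] by (simp add: A_def BB_def)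
    then show ?thesis using i1 i2 by (simp add: Bochner_Integration.integral_sum)
  qed
  moreover have "(\<lambda>k. (LINT z|lborel. A z * \<phi> k (snd z)) + (\<Sum>i\<in>Basis. LINT z|lborel. BB i z * pderiv_dir i (\<phi> k) (snd z)))
     \<longlonglongrightarrow> (LINT z|lborel. A z * v (snd z)) + (\<Sum>i\<in>Basis. LINT z|lborel. BB i z * g i (snd z))"
    by (intro tendsto_add tendsto_sum pv(2) pg(2))
  ultimately have "(LINT z|lborel. A z * v (snd z)) + (\<Sum>i\<in>Basis. LINT z|lborel. BB i z * g i (snd z)) = 0"
    by (simp add: LIMSEQ_const_iff)
  then have "(LINT z|lborel. A z * v (snd z) + (\<Sum>i\<in>Basis. BB i z * g i (snd z))) = 0"
    using pv(1) pg(1) by (simp add: Bochner_Integration.integral_sum)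
  then show ?thesis by (simp add: A_def BB_def)
qed

text \<open>Index 0 gives \<open>\<psi>\<^sup>2 u\<close>, the other indices its weak gradient,
  written by the product rule for \<open>\<psi>\<close> times \<open>\<psi> u\<close>. The sum of
  \<open>E j z * H \<psi> j z\<close> is thus the spatial part of the equation tested with
  \<open>\<psi>\<^sup>2 u\<close>.\<close>

definition H :: "(real \<Rightarrow> real) \<Rightarrow> 'n space \<Rightarrow> real \<times> 'n space \<Rightarrow> real" where
  "H \<psi> j z = (if j = 0 then (\<psi> (fst (snd z)))\<^sup>2 * u z
     else \<psi> (fst (snd z)) * G \<psi> j z + pderiv_dir (fst j) \<psi> (fst (snd z)) * \<psi> (fst (snd z)) * u z)"

lemma sq_cut_u: "cutoff T R \<theta> \<psi> \<Longrightarrow> sq_int (\<lambda>z. indicator {-T<..<0} (fst z) * \<psi> (fst (snd z)) * u z)"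
proof -
  assume cut: "cutoff T R \<theta> \<psi>"
  then have TR: "T > 0" "R > 0" and \<psi>: "\<psi> \<in> Cc_inf UNIV" by (auto simp: cutoff_def)
  obtain B3 where b3: "\<psi> \<in> borel_measurable borel" "\<And>x. \<bar>\<psi> x\<bar> \<le> B3" using Cc_inf_measurable_bounded[OF \<psi>] by metis
  show ?thesis
    by (rule sq_int_local[OF sq_u[OF TR] u_0 _ _ _ b3, of _ 1]) (auto intro: cutoff_zero[OF cut] simp: indicator_def)
qed

lemma sq_cut_G:
  assumes cut: "cutoff T R \<theta> \<psi>" and sub: "\<psi> \<in> Cc_inf {-R<..<R}" and i: "i \<in> Basis"
  shows "sq_int (\<lambda>z. indicator {-T<..<0} (fst z) * G \<psi> i z)"
proof -
  have TR: "T > 0" "R > 0" and \<psi>: "\<psi> \<in> Cc_inf UNIV" using cut by (auto simp: cutoff_def)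
  obtain B3 where b3: "\<psi> \<in> borel_measurable borel" "\<And>x. \<bar>\<psi> x\<bar> \<le> B3" using Cc_inf_measurable_bounded[OF \<psi>] by metis
  obtain B4 where b4: "pderiv_dir (fst i) \<psi> \<in> borel_measurable borel" "\<And>x. \<bar>pderiv_dir (fst i) \<psi> x\<bar> \<le> B4"
    using pderiv_fst_measurable_bounded[OF \<psi> i] by metis
  obtain K where K: "K \<subseteq> {-R<..<R}" "\<And>x w. x \<notin> K \<Longrightarrow> pderiv_dir w \<psi> x = 0" using Cc_infE[OF sub] by metis
  then have K: "y \<notin> {-R<..<R} \<Longrightarrow> pderiv_dir w \<psi> y = 0" for w y by blast
  have "sq_int (\<lambda>z. indicator {-T<..<0} (fst z) * \<psi> (fst (snd z)) * D i z)"
    by (rule sq_int_local[OF sq_D[OF TR i] D_0[OF i] _ _ _ b3, of _ 1]) (auto intro: cutoff_zero[OF cut] simp: indicator_def)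
  moreover have "sq_int (\<lambda>z. indicator {-T<..<0} (fst z) * pderiv_dir (fst i) \<psi> (fst (snd z)) * u z)"
    by (rule sq_int_local[OF sq_u[OF TR] u_0 _ _ _ b4 K, of _ 1]) (auto simp: indicator_def)
  ultimately have "sq_int (\<lambda>z. indicator {-T<..<0} (fst z) * \<psi> (fst (snd z)) * D i z
      + indicator {-T<..<0} (fst z) * pderiv_dir (fst i) \<psi> (fst (snd z)) * u z)" by (rule sq_int_add)
  then show ?thesis by (rule back_subst[of sq_int]) (simp add: G_def fun_eq_iff algebra_simps)
qed

text \<open>The exceptional null set depends on the cutoffs only; the same one therefore serves all
  mollifiers, as \<open>energy_identity\<close> demands.\<close>

lemma slice_approx:
  assumes cut: "cutoff T R \<theta> \<psi>" and sub: "\<psi> \<in> Cc_inf {-R<..<R}"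
  shows "AE s in lborel. s \<in> {-T<..<0} \<longrightarrow> sq_int (\<lambda>x. \<psi> (fst x) * u (s, x)) \<and> (\<forall>i\<in>Basis. sq_int (\<lambda>x. G \<psi> i (s, x))) \<and>
    (\<exists>\<phi>. (\<forall>k. \<phi> k \<in> Cc_inf (strip W)) \<and>
        (\<lambda>k. LINT x|lborel. (\<phi> k x - \<psi> (fst x) * u (s, x))\<^sup>2) \<longlonglongrightarrow> 0 \<and>
        (\<forall>i\<in>Basis. (\<lambda>k. LINT x|lborel. (pderiv_dir i (\<phi> k) x - G \<psi> i (s, x))\<^sup>2) \<longlonglongrightarrow> 0))"
proof -
  have \<psi>: "\<psi> \<in> Cc_inf UNIV" using cut by (auto simp: cutoff_def)
  have "AE s in lborel. \<forall>i\<in>Basis. sq_int (\<lambda>x. indicator {-T<..<0} (fst (s, x)) * G \<psi> i (s, x))"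
    by (intro AE_finite_allI sq_int_slice sq_cut_G[OF cut sub]) auto
  with boundary[OF \<psi>] sq_int_slice[OF sq_cut_u[OF cut]] show ?thesis
    by eventually_elim (auto simp: G_def)
qed

text \<open>This is \<open>energy_identity\<close> with the weight \<open>\<psi>\<^sup>2\<close>.
  Its hypotheses are global in space, while \<open>E\<close> and \<open>u\<close> are square
  integrable on cylinders only. So the indicator of a cylinder is inserted, and removed afterwards:
  off the cylinder the time cutoff, \<open>\<psi>\<close> or the function itself is 0.\<close>

lemma energy:
  assumes cut: "cutoff T R \<zeta> \<psi>" and sub: "\<psi> \<in> Cc_inf {-R<..<R}"
  shows "\<And>j. j \<in> insert 0 Basis \<Longrightarrow> integrable lborel (\<lambda>z. (\<zeta> (fst z))\<^sup>2 * (E j z * H \<psi> j z))"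
    and "(\<Sum>j\<in>insert 0 Basis. LINT z|lborel. (\<zeta> (fst z))\<^sup>2 * (E j z * H \<psi> j z))
      = (LINT z|lborel. pderiv_dir 1 \<zeta> (fst z) * \<zeta> (fst z) * ((\<psi> (fst (snd z)))\<^sup>2 * (u z)\<^sup>2))"
proof -
  have TR: "T > 0" "R > 0" and \<zeta>: "\<zeta> \<in> Cc_inf {-T<..<0}" and \<psi>: "\<psi> \<in> Cc_inf UNIV" using cut by (auto simp: cutoff_def)
  obtain B1 where b1: "\<zeta> \<in> borel_measurable borel" "\<And>x. \<bar>\<zeta> x\<bar> \<le> B1" using Cc_inf_measurable_bounded[OF \<zeta>] by metis
  obtain B2 where b2: "pderiv_dir 1 \<zeta> \<in> borel_measurable borel" "\<And>x. \<bar>pderiv_dir 1 \<zeta> x\<bar> \<le> B2"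
    using Cc_inf_measurable_bounded[OF Cc_inf_pderiv[OF \<zeta>, of 1]] by auto
  obtain B3 where b3: "\<psi> \<in> borel_measurable borel" "\<And>x. \<bar>\<psi> x\<bar> \<le> B3" using Cc_inf_measurable_bounded[OF \<psi>] by metis
  note z = cutoff_zero[OF cut]
  let ?C = "indicator (cyl W T R) :: real \<times> 'n space \<Rightarrow> real"
  let ?J = "insert 0 (Basis :: 'n space set)"
  have sE: "sq_int (\<lambda>z. \<zeta> (fst z) * (?C z * E j z))" if "j \<in> ?J" for j
    using that by (intro sq_int_mult_bounded[OF sq_E[OF TR] measurable_fst_borel[OF b1(1)] b1(2)]) auto
  have sH: "sq_int (\<lambda>z. \<zeta> (fst z) * H \<psi> j z)" if "j \<in> ?J" for j
  proof (cases "j = 0")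
    case True
    have m: "(\<lambda>z::real \<times> 'n space. \<zeta> (fst z) * \<psi> (fst (snd z))) \<in> borel_measurable borel"
      by (intro borel_measurable_times measurable_fst_borel b1(1) measurable_snd_borel[of "\<lambda>x. \<psi> (fst x)"] b3(1))
    have "sq_int (\<lambda>z. (\<zeta> (fst z) * \<psi> (fst (snd z))) * (indicator {-T<..<0} (fst z) * \<psi> (fst (snd z)) * u z))"
      by (rule sq_int_mult_bounded[OF sq_cut_u[OF cut] m, of "B1 * B3"])
        (auto simp: abs_mult intro!: mult_mono b1 b3 order_trans[OF abs_ge_zero b1(2)])
    then show ?thesis
      by (rule back_subst[of sq_int]) (use z(1) in \<open>auto simp: True H_def fun_eq_iff power2_eq_square indicator_def\<close>)
  next
    case False
    then have j: "j \<in> Basis" using that by auto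
    obtain B4 where b4: "pderiv_dir (fst j) \<psi> \<in> borel_measurable borel" "\<And>x. \<bar>pderiv_dir (fst j) \<psi> x\<bar> \<le> B4"
      using pderiv_fst_measurable_bounded[OF \<psi> j] by metis
    have m: "(\<lambda>z::real \<times> 'n space. \<zeta> (fst z) * \<psi> (fst (snd z))) \<in> borel_measurable borel"
      "(\<lambda>z::real \<times> 'n space. \<zeta> (fst z) * pderiv_dir (fst j) \<psi> (fst (snd z))) \<in> borel_measurable borel"
      by (intro borel_measurable_times measurable_fst_borel b1(1) measurable_snd_borel[of "\<lambda>x. \<psi> (fst x)"] b3(1)
          measurable_snd_borel[of "\<lambda>x. pderiv_dir (fst j) \<psi> (fst x)"] b4(1))+
    have "sq_int (\<lambda>z. (\<zeta> (fst z) * \<psi> (fst (snd z))) * (indicator {-T<..<0} (fst z) * G \<psi> j z)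
        + (\<zeta> (fst z) * pderiv_dir (fst j) \<psi> (fst (snd z))) * (indicator {-T<..<0} (fst z) * \<psi> (fst (snd z)) * u z))"
      by (intro sq_int_add sq_int_mult_bounded[OF sq_cut_G[OF cut sub j] m(1), of "B1 * B3"]
          sq_int_mult_bounded[OF sq_cut_u[OF cut] m(2), of "B1 * B4"])
        (auto simp: abs_mult intro!: mult_mono b1 b3 b4 order_trans[OF abs_ge_zero b1(2)])
    then show ?thesis
      by (rule back_subst[of sq_int]) (use z(1) False in \<open>auto simp: H_def fun_eq_iff algebra_simps indicator_def\<close>)
  qed
  have drop: "\<zeta>' (fst z) * (?C z * F z * (\<psi> (fst x) * w)) = \<zeta>' (fst z) * (F z * (\<psi> (fst x) * w))"
    if "\<And>t. t \<notin> {-T<..<0} \<Longrightarrow> \<zeta>' t = 0" "z \<notin> {..<0} \<times> strip W \<Longrightarrow> F z = 0" "snd z = x" for \<zeta>' F z w x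
  proof (cases "z \<in> cyl W T R")
    case False
    then have "fst z \<notin> {-T<..<0} \<or> fst (snd z) \<notin> {-R<..<R} \<or> snd (snd z) \<notin> W"
      by (auto simp: cyl_def mem_Times_iff)
    then have "\<zeta>' (fst z) = 0 \<or> \<psi> (fst x) = 0 \<or> F z = 0"
      using that(1)[of "fst z"] that(2,3) z(3)[of "fst (snd z)"] by (auto simp: strip_def mem_Times_iff)
    then show ?thesis by auto
  qed simp
  \<comment> \<open>Exhibits the factor \<open>\<psi>\<close> of \<open>H \<psi> j\<close> that
    \<open>drop\<close> relies on.\<close>
  have Hfac: "\<exists>w. \<forall>z. H \<psi> j z = \<psi> (fst (snd z)) * w z" for j
    by (rule exI[of _ "\<lambda>z. if j = 0 then \<psi> (fst (snd z)) * u z else G \<psi> j z + pderiv_dir (fst j) \<psi> (fst (snd z)) * u z"])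
      (auto simp: H_def power2_eq_square algebra_simps)
  have conv: "(\<zeta> (fst z))\<^sup>2 * (?C z * E j z * H \<psi> j z) = (\<zeta> (fst z))\<^sup>2 * (E j z * H \<psi> j z)" if "j \<in> ?J" for j z
  proof -
    obtain w where w: "\<And>z. H \<psi> j z = \<psi> (fst (snd z)) * w z" using Hfac by metis
    show ?thesis unfolding w
      by (rule drop[of "\<lambda>t. (\<zeta> t)\<^sup>2"]) (use z(1) E_0[of j] that in auto)
  qed
  show "integrable lborel (\<lambda>z. (\<zeta> (fst z))\<^sup>2 * (E j z * H \<psi> j z))" if "j \<in> ?J" for j
  proof -
    have "integrable lborel (\<lambda>z. (\<zeta> (fst z))\<^sup>2 * (?C z * E j z * H \<psi> j z))"
      using integrable_mult_sq[OF sE[OF that] sH[OF that]] by (simp add: power2_eq_square mult_ac)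
    then show ?thesis unfolding conv[OF that] .
  qed
  have "(\<Sum>j\<in>?J. LINT z|lborel. (\<zeta> (fst z))\<^sup>2 * ((?C z * E j z) * H \<psi> j z))
     = (LINT z|lborel. pderiv_dir 1 \<zeta> (fst z) * \<zeta> (fst z) * ((\<psi> (fst (snd z)))\<^sup>2 * (?C z * u z)\<^sup>2))"
  proof (rule energy_identity[where p="\<lambda>x. (\<psi> (fst x))\<^sup>2" and B="B3\<^sup>2"])
    show "smooth \<zeta>" by (rule Cc_inf_smooth[OF \<zeta>])
    show "(\<lambda>x::'n space. (\<psi> (fst x))\<^sup>2) \<in> borel_measurable borel"
      using measurable_fst_borel[OF b3(1), where 'b="real ^ 'n"] by (rule borel_measurable_power)
    show "\<bar>(\<psi> (fst x))\<^sup>2\<bar> \<le> B3\<^sup>2" for x :: "'n space" using power_mono[OF b3(2)[of "fst x"] abs_ge_zero, of 2] by simp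
    show "sq_int (\<lambda>z. \<zeta> (fst z) * (?C z * u z))"
      by (rule sq_int_mult_bounded[OF sq_u[OF TR] measurable_fst_borel[OF b1(1)] b1(2)])
    show "sq_int (\<lambda>z. pderiv_dir 1 \<zeta> (fst z) * (?C z * u z))"
      by (rule sq_int_mult_bounded[OF sq_u[OF TR] measurable_fst_borel[OF b2(1)] b2(2)])
    show "AE s in lborel. \<zeta> s \<noteq> 0 \<longrightarrow> (\<forall>k. smooth k \<longrightarrow>
      (LINT z|lborel. - (pderiv_dir 1 \<zeta> (fst z) * k (fst z - s) + \<zeta> (fst z) * pderiv_dir 1 k (fst z - s))
          * (?C z * u z * ((\<psi> (fst (snd z)))\<^sup>2 * (?C (s, snd z) * u (s, snd z))))
         + \<zeta> (fst z) * k (fst z - s) * (\<Sum>j\<in>?J. ?C z * E j z * H \<psi> j (s, snd z))) = 0)"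
      using slice_approx[OF cut sub]
    proof eventually_elim
      case (elim s)
      show ?case
      proof (intro impI allI)
        fix k :: "real \<Rightarrow> real" assume s0: "\<zeta> s \<noteq> 0" and k: "smooth k"
        then have s: "s \<in> {-T<..<0}" using z(1) by blast
        with elim obtain \<phi> where sv: "sq_int (\<lambda>x. \<psi> (fst x) * u (s, x))" and sG: "\<forall>i\<in>Basis. sq_int (\<lambda>x. G \<psi> i (s, x))"
          and \<phi>: "\<And>k. \<phi> k \<in> Cc_inf (strip W)" "(\<lambda>k. LINT x|lborel. (\<phi> k x - \<psi> (fst x) * u (s, x))\<^sup>2) \<longlonglongrightarrow> 0"
            "\<forall>i\<in>Basis. (\<lambda>k. LINT x|lborel. (pderiv_dir i (\<phi> k) x - G \<psi> i (s, x))\<^sup>2) \<longlonglongrightarrow> 0" by blast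
        \<comment> \<open>The time factor of the test function: the cutoff in \<open>t\<close> times
          the mollifier centred at \<open>s\<close>. The factor \<open>\<psi>\<close> in
          \<open>weak_eq_slice\<close> and the one in the slice combine to
          \<open>\<psi>\<^sup>2\<close>.\<close>
        define \<theta> where "\<theta> t = k (t - s) * \<zeta> t" for t
        have sk: "smooth (\<lambda>t. k (t - s))" using smooth_scale[OF k, of 1 "- s"] by simp
        have \<theta>: "\<theta> \<in> Cc_inf {-T<..<0}" unfolding \<theta>_def[abs_def] by (rule Cc_inf_mult[OF \<zeta> sk])
        have cut': "cutoff T R \<theta> \<psi>" using cut \<theta> by (auto simp: cutoff_def)
        have "((\<lambda>t. k (t - s)) has_real_derivative pderiv_dir 1 k (t - s) * 1) (at t)" for t
          by (rule DERIV_chain2[OF smooth_has_real_derivative[OF k]]) (auto intro!: derivative_eq_intros)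
        then have d\<theta>: "pderiv_dir 1 \<theta> t = k (t - s) * pderiv_dir 1 \<zeta> t + pderiv_dir 1 k (t - s) * \<zeta> t" for t
          unfolding \<theta>_def[abs_def] using pderiv_dir_mult[OF sk Cc_inf_smooth[OF \<zeta>], of 1 t] pderiv_dir_real[of "\<lambda>t. k (t - s)" _ t] by simp
        note eq = weak_eq_slice[OF cut' sub \<phi>(1) sv \<phi>(2) sG \<phi>(3)]
        show "(LINT z|lborel. - (pderiv_dir 1 \<zeta> (fst z) * k (fst z - s) + \<zeta> (fst z) * pderiv_dir 1 k (fst z - s))
          * (?C z * u z * ((\<psi> (fst (snd z)))\<^sup>2 * (?C (s, snd z) * u (s, snd z))))
         + \<zeta> (fst z) * k (fst z - s) * (\<Sum>j\<in>?J. ?C z * E j z * H \<psi> j (s, snd z))) = 0"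
          using eq
        proof (rule back_subst[of "\<lambda>f. integral\<^sup>L lborel f = 0"], intro ext)
          fix z :: "real \<times> 'n space"
          have 0: "t \<notin> {-T<..<0} \<Longrightarrow> pderiv_dir 1 \<theta> t = 0" "t \<notin> {-T<..<0} \<Longrightarrow> \<theta> t = 0" for t
            using cutoff_zero[OF cut'] by auto
          have alg: "- (p * q + r * q') * X + r * q * Y = - ((q * p + q' * r) * X) + q * r * Y" for p q q' r X Y :: real
            by (simp add: algebra_simps)
          have i1: "pderiv_dir 1 \<theta> (fst z) * (?C z * u z * ((\<psi> (fst (snd z)))\<^sup>2 * (?C (s, snd z) * u (s, snd z))))
            = pderiv_dir 1 \<theta> (fst z) * (u z * ((\<psi> (fst (snd z)))\<^sup>2 * u (s, snd z)))"
          proof -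
            have 1: "(\<psi> (fst (snd z)))\<^sup>2 * (?C (s, snd z) * u (s, snd z)) = (\<psi> (fst (snd z)))\<^sup>2 * u (s, snd z)"
              using z(3)[of "fst (snd z)"] s u_0[of "(s, snd z)"]
              by (cases "(s, snd z) \<in> cyl W T R") (auto simp: cyl_def strip_def mem_Times_iff)
            show ?thesis unfolding 1
              using drop[of "pderiv_dir 1 \<theta>" z u "snd z" "\<psi> (fst (snd z)) * u (s, snd z)"] 0(1) u_0[of z]
              by (simp add: power2_eq_square mult.assoc)
          qed
          have i2: "\<theta> (fst z) * (?C z * E j z * H \<psi> j (s, snd z)) = \<theta> (fst z) * (E j z * H \<psi> j (s, snd z))" if "j \<in> ?J" for j
          proof -
            obtain w where w: "\<And>z. H \<psi> j z = \<psi> (fst (snd z)) * w z" using Hfac by metis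
            show ?thesis unfolding w
              by (simp only: snd_conv, rule drop[of \<theta>]) (use 0(2) E_0[of j] that in auto)
          qed
          have "- (pderiv_dir 1 \<zeta> (fst z) * k (fst z - s) + \<zeta> (fst z) * pderiv_dir 1 k (fst z - s))
              * (?C z * u z * ((\<psi> (fst (snd z)))\<^sup>2 * (?C (s, snd z) * u (s, snd z))))
             + \<zeta> (fst z) * k (fst z - s) * (\<Sum>j\<in>?J. ?C z * E j z * H \<psi> j (s, snd z))
            = - (pderiv_dir 1 \<theta> (fst z) * (?C z * u z * ((\<psi> (fst (snd z)))\<^sup>2 * (?C (s, snd z) * u (s, snd z)))))
             + (\<Sum>j\<in>?J. \<theta> (fst z) * (?C z * E j z * H \<psi> j (s, snd z)))"
            unfolding d\<theta> \<theta>_def sum_distrib_left[symmetric] by (rule alg)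
          also have "\<dots> = - (pderiv_dir 1 \<theta> (fst z) * (u z * ((\<psi> (fst (snd z)))\<^sup>2 * u (s, snd z))))
             + (\<Sum>j\<in>?J. \<theta> (fst z) * (E j z * H \<psi> j (s, snd z)))"
            unfolding i1 by (intro arg_cong2[of _ _ _ _ "(+)"] refl sum.cong i2)
          also have "\<dots> = - (pderiv_dir 1 \<theta> (fst z) * (u z * ((\<psi> (fst (snd z)))\<^sup>2 * u (s, snd z))))
             + \<theta> (fst z) * (E 0 z * ((\<psi> (fst (snd z)))\<^sup>2 * u (s, snd z)))
             + (\<Sum>j\<in>Basis. \<theta> (fst z) * (E j z * (\<psi> (fst (snd z)) * G \<psi> j (s, snd z) + pderiv_dir (fst j) \<psi> (fst (snd z)) * \<psi> (fst (snd z)) * u (s, snd z))))"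
            by (subst sum.insert) (auto simp: H_def intro!: sum.cong)
          also have "\<dots> = (- (pderiv_dir 1 \<theta> (fst z) * \<psi> (fst (snd z)) * u z)
              + \<theta> (fst z) * (\<psi> (fst (snd z)) * E 0 z + (\<Sum>i\<in>Basis. pderiv_dir (fst i) \<psi> (fst (snd z)) * E i z))) * (\<psi> (fst (snd z)) * u (s, snd z))
              + (\<Sum>i\<in>Basis. \<theta> (fst z) * \<psi> (fst (snd z)) * E i z * G \<psi> i (s, snd z))"
            by (simp add: algebra_simps power2_eq_square sum.distrib sum_distrib_left sum_distrib_right)
          finally show "(- (pderiv_dir 1 \<theta> (fst z) * \<psi> (fst (snd z)) * u z)
              + \<theta> (fst z) * (\<psi> (fst (snd z)) * E 0 z + (\<Sum>i\<in>Basis. pderiv_dir (fst i) \<psi> (fst (snd z)) * E i z))) * (\<psi> (fst (snd z)) * u (s, snd z))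
              + (\<Sum>i\<in>Basis. \<theta> (fst z) * \<psi> (fst (snd z)) * E i z * G \<psi> i (s, snd z))
            = - (pderiv_dir 1 \<zeta> (fst z) * k (fst z - s) + \<zeta> (fst z) * pderiv_dir 1 k (fst z - s))
              * (?C z * u z * ((\<psi> (fst (snd z)))\<^sup>2 * (?C (s, snd z) * u (s, snd z))))
             + \<zeta> (fst z) * k (fst z - s) * (\<Sum>j\<in>?J. ?C z * E j z * H \<psi> j (s, snd z))" by simp
        qed
      qed
    qed
  qed (use sE sH in auto)
  also have "(\<lambda>z. pderiv_dir 1 \<zeta> (fst z) * \<zeta> (fst z) * ((\<psi> (fst (snd z)))\<^sup>2 * (?C z * u z)\<^sup>2))
     = (\<lambda>z. pderiv_dir 1 \<zeta> (fst z) * \<zeta> (fst z) * ((\<psi> (fst (snd z)))\<^sup>2 * (u z)\<^sup>2))"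
  proof
    fix z :: "real \<times> 'n space"
    show "pderiv_dir 1 \<zeta> (fst z) * \<zeta> (fst z) * ((\<psi> (fst (snd z)))\<^sup>2 * (?C z * u z)\<^sup>2)
      = pderiv_dir 1 \<zeta> (fst z) * \<zeta> (fst z) * ((\<psi> (fst (snd z)))\<^sup>2 * (u z)\<^sup>2)"
      using drop[of "\<lambda>t. pderiv_dir 1 \<zeta> t * \<zeta> t" z "\<lambda>z. (u z)\<^sup>2" "snd z" "\<psi> (fst (snd z))"] z(1) u_0[of z]
      by (simp add: power_mult_distrib indicator_square power2_eq_square[of "\<psi> _"] mult_ac)
  qed
  finally show "(\<Sum>j\<in>?J. LINT z|lborel. (\<zeta> (fst z))\<^sup>2 * (E j z * H \<psi> j z))
      = (LINT z|lborel. pderiv_dir 1 \<zeta> (fst z) * \<zeta> (fst z) * ((\<psi> (fst (snd z)))\<^sup>2 * (u z)\<^sup>2))"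
    using conv by simp
qed

end

lemma AE_lborel_snd:
  assumes "AE x in (lborel :: 'b::euclidean_space measure). P x"
  shows "AE z in (lborel :: ('a::euclidean_space \<times> 'b) measure). P (snd z)"
proof -
  obtain N where N: "{x. \<not> P x} \<subseteq> N" "N \<in> sets borel" "emeasure lborel N = 0"
    using AE_E[OF assms] by auto
  have "emeasure lborel ((UNIV :: 'a set) \<times> N) = 0"
    using lborel.emeasure_pair_measure_Times[of "UNIV :: 'a set" lborel N] N by (simp add: lborel_prod)
  moreover have "(UNIV :: 'a set) \<times> N \<in> sets borel" unfolding borel_prod[symmetric] using N by (intro pair_measureI) auto
  ultimately show ?thesis by (intro AE_I[where N="UNIV \<times> N"]) (use N in auto)
qed

lemma integral_slices:
  fixes f :: "real \<times> 'b::euclidean_space \<Rightarrow> real"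
  assumes "integrable lborel f"
  shows "integrable lborel (\<lambda>s. LINT x|lborel. f (s, x))"
    and "(LINT s|lborel. (LINT x|lborel. f (s, x))) = (LINT z|lborel. f z)"
  using lborel_pair.integrable_fst'[of f] lborel_pair.integral_fst'[of f] assms by (simp_all add: lborel_prod)

section \<open>The energy inequality, with the Poincare inequality inserted\<close>

context strip_solution
begin

lemma sq_cut_mult:
  assumes cut: "cutoff T R \<zeta> \<psi>"
  shows "sq_int (\<lambda>z. \<zeta> (fst z) * \<psi> (fst (snd z)) * u z)"
    and "\<And>i. i \<in> Basis \<Longrightarrow> sq_int (\<lambda>z. \<zeta> (fst z) * \<psi> (fst (snd z)) * D i z)"
proof -
  have TR: "T > 0" "R > 0" and \<zeta>: "\<zeta> \<in> Cc_inf {-T<..<0}" and \<psi>: "\<psi> \<in> Cc_inf UNIV" using cut by (auto simp: cutoff_def)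
  obtain B1 where b1: "\<zeta> \<in> borel_measurable borel" "\<And>x. \<bar>\<zeta> x\<bar> \<le> B1" using Cc_inf_measurable_bounded[OF \<zeta>] by metis
  obtain B3 where b3: "\<psi> \<in> borel_measurable borel" "\<And>x. \<bar>\<psi> x\<bar> \<le> B3" using Cc_inf_measurable_bounded[OF \<psi>] by metis
  note z = cutoff_zero[OF cut]
  show "sq_int (\<lambda>z. \<zeta> (fst z) * \<psi> (fst (snd z)) * u z)"
    by (rule sq_int_local[OF sq_u[OF TR] u_0 b1 z(1) b3 z(3)])
  show "sq_int (\<lambda>z. \<zeta> (fst z) * \<psi> (fst (snd z)) * D i z)" if "i \<in> Basis" for i
    by (rule sq_int_local[OF sq_D[OF TR that] D_0[OF that] b1 z(1) b3 z(3)])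
qed

text \<open>On almost every slice the inequality holds for the approximating test functions and
  survives their limit. The cutoff \<open>\<psi>\<close> depends on the unbounded coordinate only,
  so it commutes with derivatives along the cross-section and causes no error term
  (\<open>Gk\<close>).\<close>

lemma poincare_slices:
  assumes cut: "cutoff T R \<zeta> \<psi>" and sub: "\<psi> \<in> Cc_inf {-R<..<R}"
    and V: "emeasure lborel W = ennreal V" "V > 0"
    and r: "measure lborel (ball (0::real ^ 'n) r) \<ge> 2 * V" "r > 0"
  shows "V * (LINT z|lborel. (\<zeta> (fst z) * \<psi> (fst (snd z)) * u z)\<^sup>2)
    \<le> r\<^sup>2 * measure lborel (ball (0::real ^ 'n) r) *
      (\<Sum>i\<in>Basis. LINT z|lborel. (\<zeta> (fst z) * \<psi> (fst (snd z)) * D i z)\<^sup>2)"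
proof -
  define C where "C = r\<^sup>2 * measure lborel (ball (0::real ^ 'n) r)"
  have C: "C \<ge> 0" by (simp add: C_def)
  have \<psi>: "\<psi> \<in> Cc_inf UNIV" and \<zeta>: "\<zeta> \<in> Cc_inf {-T<..<0}" using cut by (auto simp: cutoff_def)
  note z = cutoff_zero[OF cut]
  let ?f = "\<lambda>z. \<zeta> (fst z) * \<psi> (fst (snd z)) * u z"
  let ?g = "\<lambda>i z. \<zeta> (fst z) * \<psi> (fst (snd z)) * D i z"
  note sf = sq_cut_mult(1)[OF cut] and sg = sq_cut_mult(2)[OF cut]
  have Gk: "G \<psi> (0, k) z = \<psi> (fst (snd z)) * D (0, k) z" for k z
    by (simp add: G_def pderiv_dir_0[OF Cc_inf_smooth[OF \<psi>]])
  have "AE s in lborel. V * (LINT x|lborel. (?f (s, x))\<^sup>2) \<le> C * (\<Sum>k\<in>Basis. LINT x|lborel. (?g (0, k) (s, x))\<^sup>2)"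
    using slice_approx[OF cut sub]
  proof eventually_elim
    case (elim s)
    show ?case
    proof (cases "s \<in> {-T<..<0}")
      case True
      with elim obtain \<phi> where sv: "sq_int (\<lambda>x. \<psi> (fst x) * u (s, x))" and sG: "\<forall>i\<in>Basis. sq_int (\<lambda>x. G \<psi> i (s, x))"
          and \<phi>: "\<And>k. \<phi> k \<in> Cc_inf (strip W)" "(\<lambda>k. LINT x|lborel. (\<phi> k x - \<psi> (fst x) * u (s, x))\<^sup>2) \<longlonglongrightarrow> 0"
            "\<forall>i\<in>Basis. (\<lambda>k. LINT x|lborel. (pderiv_dir i (\<phi> k) x - G \<psi> i (s, x))\<^sup>2) \<longlonglongrightarrow> 0" by blast
      have c: "sq_int (\<phi> k)" "i \<in> Basis \<Longrightarrow> sq_int (pderiv_dir i (\<phi> k))" for k i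
        by (rule sq_int_Cc_inf[OF \<phi>(1)], rule sq_int_Cc_inf[OF Cc_inf_pderiv[OF \<phi>(1)]])
      have P: "V * (LINT x|lborel. (\<phi> k x)\<^sup>2) \<le> C * (\<Sum>j\<in>Basis. LINT x|lborel. (pderiv_dir (0, j) (\<phi> k) x)\<^sup>2)" for k
        unfolding C_def using \<phi>(1)[of k] W(1) V r by (intro poincare_strip[of _ W]) (auto simp: strip_def)
      have l1: "(\<lambda>k. V * (LINT x|lborel. (\<phi> k x)\<^sup>2)) \<longlonglongrightarrow> V * (LINT x|lborel. (\<psi> (fst x) * u (s, x))\<^sup>2)"
        by (intro tendsto_intros sq_tendsto_norm sv c \<phi>(2))
      have l2: "(\<lambda>k. C * (\<Sum>j\<in>Basis. LINT x|lborel. (pderiv_dir (0, j) (\<phi> k) x)\<^sup>2))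
          \<longlonglongrightarrow> C * (\<Sum>j\<in>Basis. LINT x|lborel. (G \<psi> (0, j) (s, x))\<^sup>2)"
        by (intro tendsto_mult tendsto_const tendsto_sum sq_tendsto_norm c bspec[OF sG] bspec[OF \<phi>(3)] Pair_0_Basis)
      have "V * (LINT x|lborel. (\<psi> (fst x) * u (s, x))\<^sup>2) \<le> C * (\<Sum>j\<in>Basis. LINT x|lborel. (G \<psi> (0, j) (s, x))\<^sup>2)"
        by (rule LIMSEQ_le[OF l1 l2]) (use P in auto)
      then have "(\<zeta> s)\<^sup>2 * (V * (LINT x|lborel. (\<psi> (fst x) * u (s, x))\<^sup>2)) \<le> (\<zeta> s)\<^sup>2 * (C * (\<Sum>j\<in>Basis. LINT x|lborel. (G \<psi> (0, j) (s, x))\<^sup>2))"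
        by (intro mult_left_mono) auto
      moreover have "(LINT x|lborel. (?f (s, x))\<^sup>2) = (\<zeta> s)\<^sup>2 * (LINT x|lborel. (\<psi> (fst x) * u (s, x))\<^sup>2)"
        by (simp only: fst_conv snd_conv mult.assoc power_mult_distrib[of "\<zeta> s"] integral_mult_right_zero)
      moreover have "(LINT x|lborel. (?g (0, k) (s, x))\<^sup>2) = (\<zeta> s)\<^sup>2 * (LINT x|lborel. (G \<psi> (0, k) (s, x))\<^sup>2)" for k
        unfolding Gk by (simp only: fst_conv snd_conv mult.assoc power_mult_distrib[of "\<zeta> s"] integral_mult_right_zero)
      ultimately show ?thesis
        by (simp only: sum_distrib_left[symmetric] mult.left_commute[of V] mult.left_commute[of C])
    qed (use z(1) in simp)
  qed
  then have "(LINT s|lborel. V * (LINT x|lborel. (?f (s, x))\<^sup>2)) \<le> (LINT s|lborel. C * (\<Sum>k\<in>Basis. LINT x|lborel. (?g (0, k) (s, x))\<^sup>2))"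
    by (intro integral_mono_AE integrable_mult_right Bochner_Integration.integrable_sum
        integral_slices(1)[OF sq_intD(2)[OF sf]] integral_slices(1)[OF sq_intD(2)[OF sg]] Pair_0_Basis)
  also have "(LINT s|lborel. V * (LINT x|lborel. (?f (s, x))\<^sup>2)) = V * (LINT z|lborel. (?f z)\<^sup>2)"
    using integral_slices(2)[OF sq_intD(2)[OF sf]] by simp
  also have "(LINT s|lborel. C * (\<Sum>k\<in>Basis. LINT x|lborel. (?g (0, k) (s, x))\<^sup>2)) = C * (\<Sum>k\<in>Basis. LINT z|lborel. (?g (0, k) z)\<^sup>2)"
    using integral_slices[OF sq_intD(2)[OF sg[OF Pair_0_Basis]]] by (simp add: Bochner_Integration.integral_sum)
  \<comment> \<open>Adds the derivative along the strip, to reach the full gradient that ellipticity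
    controls.\<close>
  also have "\<dots> \<le> C * (\<Sum>i\<in>Basis. LINT z|lborel. (?g i z)\<^sup>2)"
  proof (intro mult_left_mono C)
    have "(\<Sum>k\<in>Basis. LINT z|lborel. (?g (0, k) z)\<^sup>2) = (\<Sum>i\<in>Pair 0 ` Basis. LINT z|lborel. (?g i z)\<^sup>2)"
      by (subst sum.reindex) (auto simp: inj_on_def)
    also have "\<dots> \<le> (\<Sum>i\<in>Basis. LINT z|lborel. (?g i z)\<^sup>2)"
      by (rule sum_mono2) (auto intro: Pair_0_Basis integral_nonneg_AE)
    finally show "(\<Sum>k\<in>Basis. LINT z|lborel. (?g (0, k) z)\<^sup>2) \<le> (\<Sum>i\<in>Basis. LINT z|lborel. (?g i z)\<^sup>2)" .
  qed
  finally show ?thesis by (simp add: C_def)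
qed

text \<open>The term with \<open>\<psi>'\<close> appears twice, once for each factor
  \<open>\<psi>\<close> that is differentiated, and it involves only the flux component
  \<open>E (1, 0)\<close> because \<open>\<psi>\<close> is a function of the first coordinate. What
  remains is \<open>pointwise_estimate\<close>.\<close>

lemma E_H_lower_bound:
  assumes \<psi>: "\<psi> \<in> Cc_inf UNIV"
    and ell: "\<forall>\<xi>. lam * (norm \<xi>)\<^sup>2 \<le> (\<Sum>i\<in>Basis. \<Sum>j\<in>Basis. a i j (snd z) * (\<xi> \<bullet> i) * (\<xi> \<bullet> j))"
  defines "N \<equiv> real DIM('n space)"
  shows "lam / 2 * ((\<psi> (fst (snd z)))\<^sup>2 * (\<Sum>i\<in>Basis. (D i z)\<^sup>2)) - (eps * N / lam + eps) * ((\<psi> (fst (snd z)))\<^sup>2 * (u z)\<^sup>2)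
      - 4 * N * \<Lambda>\<^sup>2 / lam * ((pderiv_dir 1 \<psi> (fst (snd z)))\<^sup>2 * (u z)\<^sup>2)
    \<le> (\<Sum>j\<in>insert 0 Basis. E j z * H \<psi> j z)"
proof -
  define x where "x = snd z"
  define p where "p = \<psi> (fst x)"
  define p' where "p' = pderiv_dir 1 \<psi> (fst x)"
  define Bq where "Bq = (\<Sum>i\<in>Basis. b i x * D i z)"
  define S where "S = (\<Sum>i\<in>Basis. (D i z)\<^sup>2)"
  define P where "P = (\<Sum>i\<in>Basis. \<bar>D i z\<bar>)"
  define q where "q = (\<Sum>i\<in>Basis. E i z * D i z)"
  have B0: "(0::'n space) \<notin> Basis" by simp
  have e1: "(1::real, 0::real ^ 'n) \<in> Basis" by (auto simp: Basis_prod_def)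
  have P2: "P\<^sup>2 \<le> N * S"
    unfolding P_def S_def N_def using Cauchy_Schwarz_ineq_sum[of "\<lambda>_. 1" "\<lambda>i. \<bar>D i z\<bar>" "Basis :: 'n space set"] by simp
  have "\<bar>E (1, 0) z\<bar> \<le> (\<Sum>i\<in>Basis. \<bar>a (1, 0) i x * D i z\<bar>)"
    using B0 e1 by (auto simp: E_def x_def intro: sum_abs)
  also have "\<dots> \<le> (\<Sum>i\<in>Basis. \<Lambda> * \<bar>D i z\<bar>)"
    by (rule sum_mono) (auto simp: abs_mult intro!: mult_right_mono bnd_a e1)
  finally have A: "\<bar>E (1, 0) z\<bar> \<le> \<Lambda> * P" by (simp add: P_def sum_distrib_left)
  have "\<bar>Bq\<bar> \<le> (\<Sum>i\<in>Basis. \<bar>b i x * D i z\<bar>)" unfolding Bq_def by (rule sum_abs)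
  also have "\<dots> \<le> (\<Sum>i\<in>Basis. sqrt eps * \<bar>D i z\<bar>)"
    by (rule sum_mono) (auto simp: abs_mult intro!: mult_right_mono bnd_b)
  finally have B: "\<bar>Bq\<bar> \<le> sqrt eps * P" by (simp add: P_def sum_distrib_left)
  have q: "lam * S \<le> q"
  proof -
    let ?\<xi> = "\<Sum>i\<in>Basis. D i z *\<^sub>R i"
    have comp: "?\<xi> \<bullet> i = D i z" if "i \<in> Basis" for i using that by simp
    have "(norm ?\<xi>)\<^sup>2 = (\<Sum>i\<in>Basis. (?\<xi> \<bullet> i)\<^sup>2)"
      unfolding power2_norm_eq_inner by (subst euclidean_inner) (simp add: power2_eq_square)
    also have "\<dots> = S" unfolding S_def by (intro sum.cong refl) (simp only: comp)
    finally have nS: "(norm ?\<xi>)\<^sup>2 = S" .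
    have "lam * S \<le> (\<Sum>i\<in>Basis. \<Sum>j\<in>Basis. a i j x * (?\<xi> \<bullet> i) * (?\<xi> \<bullet> j))"
      using spec[OF ell, of ?\<xi>] unfolding nS x_def .
    also have "\<dots> = (\<Sum>i\<in>Basis. \<Sum>j\<in>Basis. a i j x * D i z * D j z)" by (intro sum.cong refl) (simp only: comp)
    also have "\<dots> = q"
      unfolding q_def using B0 by (intro sum.cong refl) (auto simp: E_def x_def sum_distrib_left mult_ac)
    finally show ?thesis .
  qed
  have grad: "(\<Sum>i\<in>Basis. pderiv_dir (fst i) \<psi> (fst x) * E i z) = p' * E (1, 0) z"
  proof -
    have "(\<Sum>i\<in>Basis. pderiv_dir (fst i) \<psi> (fst x) * E i z) = (\<Sum>i\<in>Basis. if i = (1, 0) then p' * E i z else 0)"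
      by (intro sum.cong refl) (auto simp: pderiv_fst_Basis[OF \<psi>] p'_def)
    then show ?thesis using e1 by (simp add: sum.delta)
  qed
  have "(\<Sum>j\<in>insert 0 Basis. E j z * H \<psi> j z) = E 0 z * (p\<^sup>2 * u z) + (\<Sum>i\<in>Basis. E i z * (p * G \<psi> i z + pderiv_dir (fst i) \<psi> (fst x) * p * u z))"
    using B0 by (subst sum.insert) (auto simp: H_def p_def x_def intro!: sum.cong)
  also have "(\<Sum>i\<in>Basis. E i z * (p * G \<psi> i z + pderiv_dir (fst i) \<psi> (fst x) * p * u z))
     = p\<^sup>2 * q + 2 * p * u z * (\<Sum>i\<in>Basis. pderiv_dir (fst i) \<psi> (fst x) * E i z)"
    unfolding q_def by (simp add: G_def p_def[symmetric] x_def[symmetric] algebra_simps sum.distrib sum_distrib_left power2_eq_square)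
  also have "E 0 z * (p\<^sup>2 * u z) = - (p\<^sup>2 * u z * Bq) - c x * (p\<^sup>2 * (u z)\<^sup>2)"
    by (simp add: E_def Bq_def x_def algebra_simps power2_eq_square)
  finally have "(\<Sum>j\<in>insert 0 Basis. E j z * H \<psi> j z)
     = p\<^sup>2 * q + 2 * p * p' * u z * E (1, 0) z - p\<^sup>2 * u z * Bq - c x * (p\<^sup>2 * (u z)\<^sup>2)"
    by (simp add: grad)
  moreover have "lam / 2 * (p\<^sup>2 * S) - (eps * N / lam + eps) * (p\<^sup>2 * (u z)\<^sup>2) - 4 * N * \<Lambda>\<^sup>2 / lam * (p'\<^sup>2 * (u z)\<^sup>2)
     \<le> p\<^sup>2 * q + 2 * p * p' * u z * E (1, 0) z - p\<^sup>2 * u z * Bq - c x * (p\<^sup>2 * (u z)\<^sup>2)"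
    by (rule pointwise_estimate[OF lam _ P2 A B q bnd_c(2) eps]) (auto simp: N_def P_def intro: sum_nonneg)
  ultimately show ?thesis by (simp add: p_def p'_def x_def S_def)
qed

text \<open>\<open>\<kappa>\<close> is made so that half of the ellipticity, through the Poincare
  inequality, yields \<open>2 * \<kappa>\<close> times the weighted integral of
  \<open>u\<^sup>2\<close>. One \<open>\<kappa>\<close> pays for the lower-order coefficients, which
  cost \<open>eps * N / lam + eps\<close>; the other is kept.\<close>

lemma energy_inequality:
  assumes cut: "cutoff T R \<zeta> \<psi>" and sub: "\<psi> \<in> Cc_inf {-R<..<R}"
    and V: "emeasure lborel W = ennreal V" "V > 0"
    and r: "measure lborel (ball (0::real ^ 'n) r) \<ge> 2 * V" "r > 0"
    and \<kappa>: "\<kappa> = lam * V / (4 * (r\<^sup>2 * measure lborel (ball (0::real ^ 'n) r)))"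
    and N: "N = real DIM('n space)" and small: "eps * N / lam + eps \<le> \<kappa>"
  shows "\<kappa> * (LINT z|lborel. (\<zeta> (fst z) * \<psi> (fst (snd z)) * u z)\<^sup>2)
    \<le> (LINT z|lborel. pderiv_dir 1 \<zeta> (fst z) * \<zeta> (fst z) * ((\<psi> (fst (snd z)))\<^sup>2 * (u z)\<^sup>2))
      + 4 * N * \<Lambda>\<^sup>2 / lam * (LINT z|lborel. (\<zeta> (fst z) * pderiv_dir 1 \<psi> (fst (snd z)) * u z)\<^sup>2)"
proof -
  have TR: "T > 0" "R > 0" and \<zeta>: "\<zeta> \<in> Cc_inf {-T<..<0}" and \<psi>: "\<psi> \<in> Cc_inf UNIV" using cut by (auto simp: cutoff_def)
  define C where "C = r\<^sup>2 * measure lborel (ball (0::real ^ 'n) r)"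
  have C: "C > 0" using r V by (simp add: C_def)
  define X where "X = (LINT z|lborel. (\<zeta> (fst z) * \<psi> (fst (snd z)) * u z)\<^sup>2)"
  define Y where "Y = (LINT z|lborel. (\<zeta> (fst z) * pderiv_dir 1 \<psi> (fst (snd z)) * u z)\<^sup>2)"
  define DD where "DD = (\<Sum>i\<in>Basis. LINT z|lborel. (\<zeta> (fst z) * \<psi> (fst (snd z)) * D i z)\<^sup>2)"
  have cut': "cutoff T R \<zeta> (pderiv_dir 1 \<psi>)"
  proof -
    have "pderiv_dir 1 \<psi> \<in> Cc_inf UNIV" by (rule Cc_inf_pderiv[OF \<psi>]) simp
    moreover obtain K where "K \<subseteq> {-R<..<R}" "\<And>x w. x \<notin> K \<Longrightarrow> pderiv_dir w \<psi> x = 0" using Cc_infE[OF sub] by metis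
    then have "\<forall>x. pderiv_dir 1 \<psi> x \<noteq> 0 \<longrightarrow> \<bar>x\<bar> < R" by (force simp: abs_less_iff)
    ultimately show ?thesis using cut by (simp add: cutoff_def)
  qed
  note sX = sq_intD(2)[OF sq_cut_mult(1)[OF cut]] and sD = sq_intD(2)[OF sq_cut_mult(2)[OF cut]]
    and sY = sq_intD(2)[OF sq_cut_mult(1)[OF cut']]
  let ?e = "eps * N / lam + eps" and ?M = "4 * N * \<Lambda>\<^sup>2 / lam"
  let ?L = "\<lambda>z. lam / 2 * (\<Sum>i\<in>Basis. (\<zeta> (fst z) * \<psi> (fst (snd z)) * D i z)\<^sup>2)
     - ?e * (\<zeta> (fst z) * \<psi> (fst (snd z)) * u z)\<^sup>2 - ?M * (\<zeta> (fst z) * pderiv_dir 1 \<psi> (fst (snd z)) * u z)\<^sup>2"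
  have "lam / 2 * DD - ?e * X - ?M * Y = (LINT z|lborel. ?L z)"
    unfolding DD_def X_def Y_def using sX sY sD by (simp add: Bochner_Integration.integral_sum)
  also have "\<dots> \<le> (LINT z|lborel. (\<Sum>j\<in>insert 0 Basis. (\<zeta> (fst z))\<^sup>2 * (E j z * H \<psi> j z)))"
  proof (rule integral_mono_AE)
    show "integrable lborel ?L"
      by (intro Bochner_Integration.integrable_diff integrable_mult_right Bochner_Integration.integrable_sum sX sY sD)
    show "integrable lborel (\<lambda>z. \<Sum>j\<in>insert 0 Basis. (\<zeta> (fst z))\<^sup>2 * (E j z * H \<psi> j z))"
      by (intro Bochner_Integration.integrable_sum energy(1)[OF cut sub])
    show "AE z in lborel. ?L z \<le> (\<Sum>j\<in>insert 0 Basis. (\<zeta> (fst z))\<^sup>2 * (E j z * H \<psi> j z))"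
      using AE_lborel_snd[OF elliptic]
    proof eventually_elim
      case (elim z)
      have eq: "?L z = (\<zeta> (fst z))\<^sup>2 * (lam / 2 * ((\<psi> (fst (snd z)))\<^sup>2 * (\<Sum>i\<in>Basis. (D i z)\<^sup>2))
         - ?e * ((\<psi> (fst (snd z)))\<^sup>2 * (u z)\<^sup>2) - ?M * ((pderiv_dir 1 \<psi> (fst (snd z)))\<^sup>2 * (u z)\<^sup>2))"
        by (simp add: power_mult_distrib sum_distrib_left right_diff_distrib mult_ac)
      show ?case
      proof (cases "z \<in> {..<0} \<times> strip W")
        case True
        then have "\<forall>\<xi>. lam * (norm \<xi>)\<^sup>2 \<le> (\<Sum>i\<in>Basis. \<Sum>j\<in>Basis. a i j (snd z) * (\<xi> \<bullet> i) * (\<xi> \<bullet> j))"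
          using elim by (auto simp: mem_Times_iff)
        from E_H_lower_bound[OF \<psi> this, folded N] show ?thesis
          unfolding eq sum_distrib_left[symmetric] by (rule mult_left_mono) simp
      next
        case False
        have "(\<Sum>j\<in>insert 0 Basis. (\<zeta> (fst z))\<^sup>2 * (E j z * H \<psi> j z)) = 0"
          by (rule sum.neutral) (use E_0[OF _ False] in auto)
        then show ?thesis using u_0[OF False] D_0[OF _ False] by simp
      qed
    qed
  qed
  also have "\<dots> = (LINT z|lborel. pderiv_dir 1 \<zeta> (fst z) * \<zeta> (fst z) * ((\<psi> (fst (snd z)))\<^sup>2 * (u z)\<^sup>2))" (is "_ = ?Z")
    using energy[OF cut sub] by (subst Bochner_Integration.integral_sum) auto
  finally have 1: "lam / 2 * DD - ?e * X - ?M * Y \<le> ?Z" .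
  have "V * X \<le> C * DD" using poincare_slices[OF cut sub V r] by (simp add: X_def DD_def C_def)
  then have "V / C * X \<le> DD" using C by (simp add: field_simps)
  then have "lam / 2 * (V / C * X) \<le> lam / 2 * DD" using lam by (intro mult_left_mono) auto
  moreover have "lam / 2 * (V / C * X) = \<kappa> * X + \<kappa> * X" using C by (simp add: \<kappa> C_def[symmetric] field_simps)
  moreover have "?e * X \<le> \<kappa> * X" using small by (intro mult_right_mono) (auto simp: X_def intro: integral_nonneg_AE)
  ultimately have "\<kappa> * X \<le> ?Z + ?M * Y" using 1 by linarith
  then show ?thesis by (simp add: X_def Y_def)
qed

end

section \<open>Vanishing of solutions of polynomial growth\<close>

definition bump_power :: "real \<Rightarrow> nat \<Rightarrow> real \<Rightarrow> real" where
  "bump_power T m x = bump (x / T) ^ m"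

lemma smooth_bump_scale: "smooth (\<lambda>x. bump (x / T))"
  using smooth_scale[OF smooth_bump, of "1 / T" 0] by simp

lemma smooth_bump_power: "smooth (bump_power T m)"
  unfolding bump_power_def[abs_def] by (intro smooth_power smooth_bump_scale)

lemma bump_power_range: "0 \<le> bump_power T m x" "bump_power T m x \<le> 1"
  by (auto simp: bump_power_def bump_range power_le_one)

lemma bump_power_0: "T > 0 \<Longrightarrow> m > 0 \<Longrightarrow> \<bar>x\<bar> \<ge> T \<Longrightarrow> bump_power T m x = 0"
  using bump_0[of "x / T"] by (simp add: bump_power_def)

lemma bump_power_Cc_inf:
  assumes "T > 0" "m > 0"
  shows "bump_power T m \<in> Cc_inf {-(T+1)<..<T+1}"
proof (rule Cc_infI[OF smooth_bump_power, of "{-T..T}"])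
  show "bump_power T m x = 0" if "x \<notin> {-T..T}" for x
    using that by (intro bump_power_0 assms) auto
qed auto

lemma pderiv_bump_power:
  "pderiv_dir 1 (bump_power T m) x = real m * bump (x / T) ^ (m - 1) * (pderiv_dir 1 bump (x / T) / T)"
proof (rule pderiv_dir_real)
  have "((\<lambda>x. bump (x / T)) has_real_derivative pderiv_dir 1 bump (x / T) * (1 / T)) (at x)"
    by (rule DERIV_chain2[OF smooth_has_real_derivative[OF smooth_bump]]) (use DERIV_cdivide[OF DERIV_ident] in auto)
  from DERIV_power[OF this, of m]
  show "(bump_power T m has_real_derivative real m * bump (x / T) ^ (m - 1) * (pderiv_dir 1 bump (x / T) / T)) (at x)"
    unfolding bump_power_def[abs_def] by (simp add: mult_ac)
qed

text \<open>The derivative of the m-th power still contains \<open>bump\<close> to the power m - 1.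
  Let y be the squared bump and A a constant of order T^(-2). Then y^(m-1) A is at most \<delta> y^m
  if A is at most \<delta> y, and otherwise at most A^m / \<delta>^(m-1), which has order
  T^(-2m).\<close>

lemma bump_power_deriv_bound:
  assumes T: "T > 0" and m: "m > 0" and \<delta>: "\<delta> > 0" and C: "\<And>x. \<bar>pderiv_dir 1 bump x\<bar> \<le> C"
  shows "(pderiv_dir 1 (bump_power T m) x)\<^sup>2 \<le> \<delta> * (bump_power T m x)\<^sup>2 + ((real m * C)\<^sup>2) ^ m / \<delta> ^ (m - 1) / T ^ (2 * m)"
proof -
  define y where "y = (bump (x / T))\<^sup>2"
  define A where "A = (real m * C / T)\<^sup>2"
  obtain k where k: "m = Suc k" using m by (cases m) auto
  have y: "y \<ge> 0" by (simp add: y_def)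
  have A: "A \<ge> 0" by (simp add: A_def)
  have "(pderiv_dir 1 (bump_power T m) x)\<^sup>2 = y ^ k * ((real m / T)\<^sup>2 * (pderiv_dir 1 bump (x / T))\<^sup>2)"
    unfolding pderiv_bump_power y_def k by (simp add: power_mult_distrib power_divide flip: power_mult power2_eq_square) (simp add: mult.commute)
  also have "\<dots> \<le> y ^ k * ((real m / T)\<^sup>2 * C\<^sup>2)"
    using power_mono[OF C abs_ge_zero, of "x / T" 2] y by (intro mult_left_mono) auto
  also have "\<dots> = y ^ k * A" by (simp add: A_def power_mult_distrib power_divide)
  also have "\<dots> \<le> \<delta> * y ^ m + A ^ m / \<delta> ^ k"
  proof (cases "A \<le> \<delta> * y")
    case True
    then have "y ^ k * A \<le> y ^ k * (\<delta> * y)" using y by (intro mult_left_mono) auto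
    also have "\<dots> = \<delta> * y ^ m" by (simp add: k)
    finally show ?thesis using A \<delta> by (smt (verit) divide_nonneg_nonneg zero_le_power)
  next
    case False
    then have "y \<le> A / \<delta>" using \<delta> by (simp add: field_simps)
    then have "y ^ k * A \<le> (A / \<delta>) ^ k * A" using y A by (intro mult_right_mono power_mono) auto
    also have "\<dots> = A ^ m / \<delta> ^ k" by (simp add: k power_divide)
    finally show ?thesis using y \<delta> by (smt (verit) mult_nonneg_nonneg zero_le_power)
  qed
  also have "y ^ m = (bump_power T m x)\<^sup>2" by (simp add: y_def bump_power_def mult.commute flip: power_mult)
  also have "A ^ m / \<delta> ^ k = ((real m * C)\<^sup>2) ^ m / \<delta> ^ (m - 1) / T ^ (2 * m)"
  proof -
    have "A ^ m = ((real m * C)\<^sup>2) ^ m / T ^ (2 * m)" by (simp only: A_def power_divide power_mult)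
    then show ?thesis by (simp add: k)
  qed
  finally show ?thesis .
qed

text \<open>The first factor vanishes for \<open>t \<ge> - \<tau>\<close>, decreases in time and
  does not scale with \<open>T\<close>; the second removes the remote past at scale
  \<open>T\<close>.\<close>

definition past_cutoff :: "real \<Rightarrow> real \<Rightarrow> nat \<Rightarrow> real \<Rightarrow> real" where
  "past_cutoff \<tau> T m t = ebump (- t - \<tau>) * bump_power T m t"

lemma smooth_ebump_past: "smooth (\<lambda>t. ebump (- t - \<tau>))"
  using smooth_scale[OF smooth_ebump, of "-1" "- \<tau>"] by simp

lemma past_cutoff_Cc_inf:
  assumes "T > 0" "m > 0" "\<tau> > 0"
  shows "past_cutoff \<tau> T m \<in> Cc_inf {-(T+1)<..<0}"
proof (rule Cc_infI[of _ "{-T..-\<tau>}"])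
  show "smooth (past_cutoff \<tau> T m)"
    unfolding past_cutoff_def[abs_def] by (intro smooth_mult smooth_ebump_past smooth_bump_power)
  show "past_cutoff \<tau> T m t = 0" if "t \<notin> {-T..-\<tau>}" for t
  proof (cases "t < - T")
    case True
    then have "bump_power T m t = 0" using assms by (intro bump_power_0) auto
    then show ?thesis by (simp add: past_cutoff_def)
  next
    case False
    then show ?thesis using that by (simp add: past_cutoff_def ebump_0)
  qed
qed (use assms in auto)

text \<open>Let \<open>h\<close> and \<open>f\<close> be the two factors of the cutoff
  \<open>\<zeta>\<close>. In \<open>\<zeta> \<zeta>' = h\<^sup>2 f f' + h h' f\<^sup>2\<close> the
  last term is nonpositive since \<open>h\<close> decreases, and Young's inequality with weight
  \<open>\<kappa>\<close> handles the first.\<close>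

lemma past_cutoff_deriv:
  assumes \<kappa>: "\<kappa> > 0"
  shows "pderiv_dir 1 (past_cutoff \<tau> T m) t * past_cutoff \<tau> T m t
    \<le> (ebump (- t - \<tau>))\<^sup>2 * (\<kappa> / 4 * (bump_power T m t)\<^sup>2 + (pderiv_dir 1 (bump_power T m) t)\<^sup>2 / \<kappa>)"
proof -
  let ?h = "\<lambda>t. ebump (- t - \<tau>)"
  define h h' f f' where "h = ?h t" and "h' = pderiv_dir 1 ?h t" and "f = bump_power T m t" and "f' = pderiv_dir 1 (bump_power T m) t"
  have h0: "h \<ge> 0" by (simp add: h_def ebump_range)
  have "h' \<le> 0"
  proof (rule ccontr)
    assume "\<not> h' \<le> 0"
    then obtain e where e: "e > 0" "\<And>s. s > 0 \<Longrightarrow> s < e \<Longrightarrow> ?h t < ?h (t + s)"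
      using DERIV_pos_inc_right[OF smooth_has_real_derivative[OF smooth_ebump_past, of \<tau> t]] by (auto simp: h'_def)
    from e(2)[of "e / 2"] e(1) have "?h t < ?h (t + e / 2)" by simp
    moreover have "?h (t + e / 2) \<le> ?h t" using e(1) by (intro ebump_mono) simp
    ultimately show False by simp
  qed
  then have "h * h' * f\<^sup>2 \<le> 0" using h0 by (intro mult_nonpos_nonneg mult_nonneg_nonpos) auto
  moreover have "pderiv_dir 1 (past_cutoff \<tau> T m) t = h * f' + h' * f"
    unfolding past_cutoff_def[abs_def] h_def h'_def f_def f'_def
    by (rule pderiv_dir_mult[OF smooth_ebump_past smooth_bump_power])
  ultimately have "pderiv_dir 1 (past_cutoff \<tau> T m) t * past_cutoff \<tau> T m t \<le> h\<^sup>2 * (f * f')"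
    by (simp add: past_cutoff_def h_def[symmetric] f_def[symmetric] algebra_simps power2_eq_square)
  also have "\<dots> \<le> h\<^sup>2 * (\<kappa> / 4 * f\<^sup>2 + f'\<^sup>2 / \<kappa>)"
  proof (rule mult_left_mono)
    have "0 \<le> (\<kappa> / 2 * f - f')\<^sup>2 / \<kappa>" using \<kappa> by simp
    also have "\<dots> = \<kappa> / 4 * f\<^sup>2 + f'\<^sup>2 / \<kappa> - f * f'" using \<kappa> by (simp add: power2_eq_square field_simps)
    finally show "f * f' \<le> \<kappa> / 4 * f\<^sup>2 + f'\<^sup>2 / \<kappa>" by simp
  qed simp
  finally show ?thesis by (simp add: h_def f_def f'_def)
qed

section \<open>Polynomial growth against decay in the scale\<close>

context strip_solution
begin

lemma emeasure_cyl:
  assumes V: "emeasure lborel W = ennreal V" "V > 0" and "T > 0" "R > 0"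
  shows "emeasure lborel (cyl W T R) = ennreal (T * (2 * R * V))"
proof -
  have "emeasure lborel (cyl W T R) = emeasure lborel {-T<..<0} * emeasure lborel ({-R<..<R} \<times> W)"
    using lborel.emeasure_pair_measure_Times[of "{-T<..<0}" lborel "{-R<..<R} \<times> W"] W(1)
    by (simp add: lborel_prod cyl_def open_Times)
  also have "emeasure lborel ({-R<..<R} \<times> W) = emeasure lborel {-R<..<R} * emeasure lborel W"
    using lborel.emeasure_pair_measure_Times[of "{-R<..<R}" lborel W] W(1) by (simp add: lborel_prod)
  finally show ?thesis using assms by (simp add: ennreal_mult[symmetric])
qed

text \<open>A box of size \<open>T\<close> has volume of order \<open>T\<^sup>2\<close>, since only
  time and the first coordinate are unbounded, and on it \<open>u\<close> is of order
  \<open>T ^ n\<close>. This explains the exponent \<open>2 * n + 2\<close>.\<close>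

lemma growth_integral:
  assumes V: "emeasure lborel W = ennreal V" "V > 0"
    and gr: "AE z in lborel. \<bar>u z\<bar> \<le> C * (norm (snd z) + sqrt \<bar>fst z\<bar> + 1) powr d" "C > 0" "d > 0"
    and n: "d \<le> real n"
  obtains B where "B \<ge> 0" "\<And>T. T \<ge> 1 \<Longrightarrow> (LINT z|lborel. (indicator (cyl W (T + 1) (T + 1)) z * u z)\<^sup>2) \<le> B * T ^ (2 * n + 2)"
proof -
  obtain \<omega> where \<omega>: "\<omega> > 0" "\<And>y. y \<in> W \<Longrightarrow> norm y \<le> \<omega>" using W(2) by (auto simp: bounded_pos)
  \<comment> \<open>On the box the growth weight is at most
    \<open>(T + 1) + \<omega> + (T + 1) + 1\<close>, which is at most
    \<open>(\<omega> + 5) * T\<close> for \<open>T \<ge> 1\<close>.\<close>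
  define B0 where "B0 = C * (\<omega> + 5) powr d"
  have B0: "B0 \<ge> 0" using gr(2) by (simp add: B0_def)
  show ?thesis
  proof (rule that[of "B0\<^sup>2 * (8 * V)"])
    show "0 \<le> B0\<^sup>2 * (8 * V)" using V by simp
    fix T :: real assume T: "T \<ge> 1"
    let ?S = "cyl W (T + 1) (T + 1)"
    have eS: "emeasure lborel ?S = ennreal ((T + 1) * (2 * (T + 1) * V))" using T by (intro emeasure_cyl V) auto
    have iS: "integrable lborel (indicator ?S :: _ \<Rightarrow> real)" using eS cyl_borel by (intro integrable_real_indicator) auto
    have "(LINT z|lborel. (indicator ?S z * u z)\<^sup>2) \<le> (LINT z|lborel. (B0 * T ^ n)\<^sup>2 * indicator ?S z)"
    proof (rule integral_mono_AE)
      show "integrable lborel (\<lambda>z. (indicator ?S z * u z)\<^sup>2)" using T by (intro sq_intD(2) sq_u) auto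
      show "integrable lborel (\<lambda>z. (B0 * T ^ n)\<^sup>2 * indicator ?S z)" using iS by simp
      show "AE z in lborel. (indicator ?S z * u z)\<^sup>2 \<le> (B0 * T ^ n)\<^sup>2 * indicator ?S z"
        using gr(1)
      proof eventually_elim
        case (elim z)
        show ?case
        proof (cases "z \<in> ?S")
          case True
          obtain t x y where z: "z = (t, x, y)" by (cases z) auto
          from True have b: "- (T + 1) < t" "t < 0" "\<bar>x\<bar> < T + 1" "y \<in> W" by (auto simp: cyl_def z)
          have "norm (x, y) \<le> (T + 1) + \<omega>" using norm_Pair_le[of x y] b(3) \<omega>(2)[OF b(4)] by simp
          moreover have "sqrt \<bar>t\<bar> \<le> T + 1"
          proof (rule real_le_lsqrt)
            have "\<bar>t\<bar> \<le> (T + 1) * 1" using b by simp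
            also have "\<dots> \<le> (T + 1) * (T + 1)" using T by (intro mult_left_mono) auto
            finally show "\<bar>t\<bar> \<le> (T + 1)\<^sup>2" by (simp add: power2_eq_square)
          qed (use T in auto)
          moreover have "\<omega> * 1 \<le> \<omega> * T" using T \<omega>(1) by (intro mult_left_mono) auto
          ultimately have "norm (snd z) + sqrt \<bar>fst z\<bar> + 1 \<le> (\<omega> + 5) * T"
            using T unfolding z fst_conv snd_conv distrib_right by linarith
          then have "(norm (snd z) + sqrt \<bar>fst z\<bar> + 1) powr d \<le> ((\<omega> + 5) * T) powr d"
            using gr(3) by (intro powr_mono2) (auto intro: add_nonneg_nonneg)
          also have "\<dots> = (\<omega> + 5) powr d * T powr d" using T \<omega>(1) by (intro powr_mult)
          also have "\<dots> \<le> (\<omega> + 5) powr d * T ^ n"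
            using powr_mono[OF n T] T by (intro mult_left_mono) (auto simp: powr_realpow)
          finally have "C * (norm (snd z) + sqrt \<bar>fst z\<bar> + 1) powr d \<le> C * ((\<omega> + 5) powr d * T ^ n)"
            using gr(2) by (intro mult_left_mono) auto
          with elim have "\<bar>u z\<bar> \<le> B0 * T ^ n" unfolding B0_def mult.assoc by linarith
          from power_mono[OF this abs_ge_zero, of 2] show ?thesis using True by simp
        qed simp
      qed
    qed
    also have "\<dots> = (B0 * T ^ n)\<^sup>2 * ((T + 1) * (2 * (T + 1) * V))"
      using eS T V cyl_borel by (simp add: measure_def)
    also have "\<dots> \<le> (B0 * T ^ n)\<^sup>2 * ((2 * T) * (2 * (2 * T) * V))"
      using T V by (intro mult_left_mono mult_mono mult_right_mono) auto
    also have "\<dots> = B0\<^sup>2 * (8 * V) * T ^ (2 * n + 2)"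
      by (simp add: power_mult_distrib power_add power2_eq_square mult.commute[of 2 n] power_mult[symmetric] mult_ac power_mult)
    finally show "(LINT z|lborel. (indicator ?S z * u z)\<^sup>2) \<le> B0\<^sup>2 * (8 * V) * T ^ (2 * n + 2)" .
  qed
qed

text \<open>Both cutoff estimates are inserted into the energy inequality. The right-hand side then
  reproduces at most \<open>\<kappa> / 2\<close> times the weighted integral, which the left-hand
  side absorbs; the remainder has \<open>T ^ (2 * m)\<close> in the denominator. \<open>K\<close>
  may depend on \<open>\<Lambda>\<close> and \<open>m\<close>, but not on \<open>T\<close>.\<close>

lemma weighted_decay:
  assumes V: "emeasure lborel W = ennreal V" "V > 0"
    and r: "measure lborel (ball (0::real ^ 'n) r) \<ge> 2 * V" "r > 0"
    and \<kappa>: "\<kappa> = lam * V / (4 * (r\<^sup>2 * measure lborel (ball (0::real ^ 'n) r)))"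
    and N: "N = real DIM('n space)" and small: "eps * N / lam + eps \<le> \<kappa>"
    and \<tau>: "\<tau> > 0" and m: "m > 0"
  obtains K where "K \<ge> 0" "\<And>T. T \<ge> 1 \<Longrightarrow>
    (LINT z|lborel. (past_cutoff \<tau> T m (fst z) * bump_power T m (fst (snd z)) * u z)\<^sup>2)
      \<le> K / T ^ (2 * m) * (LINT z|lborel. (indicator (cyl W (T + 1) (T + 1)) z * u z)\<^sup>2)"
proof -
  have \<kappa>0: "\<kappa> > 0" unfolding \<kappa> using lam V r by (intro divide_pos_pos mult_pos_pos) auto
  obtain C1 where C1: "\<And>x. \<bar>pderiv_dir 1 bump x\<bar> \<le> C1"
  proof -
    have "bump \<in> Cc_inf UNIV" by (rule Cc_infI[OF smooth_bump, of "{-1..1}"]) (auto intro!: bump_0)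
    from Cc_inf_bounded[OF Cc_inf_pderiv[OF this, of 1]] that show ?thesis by auto
  qed
  define M where "M = 4 * N * \<Lambda>\<^sup>2 / lam"
  have M: "M \<ge> 0" using lam by (simp add: M_def N)
  \<comment> \<open>\<open>\<delta>1 / \<kappa> = \<kappa> / 8\<close> raises the
    \<open>\<kappa> / 4\<close> of \<open>past_cutoff_deriv\<close> to
    \<open>3 * \<kappa> / 8\<close>, and \<open>M * \<delta>2 \<le> \<kappa> / 8\<close>. Together
    these are the \<open>\<kappa> / 2\<close> that can be absorbed.\<close>
  define \<delta>1 where "\<delta>1 = \<kappa>\<^sup>2 / 8"
  define \<delta>2 where "\<delta>2 = \<kappa> / (8 * (M + 1))"
  have \<delta>: "\<delta>1 > 0" "\<delta>2 > 0" using \<kappa>0 M by (auto simp: \<delta>1_def \<delta>2_def)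
  define K1 where "K1 = ((real m * C1)\<^sup>2) ^ m / \<delta>1 ^ (m - 1)"
  define K2 where "K2 = ((real m * C1)\<^sup>2) ^ m / \<delta>2 ^ (m - 1)"
  have K: "K1 \<ge> 0" "K2 \<ge> 0" using \<delta> by (auto simp: K1_def K2_def)
  show ?thesis
  proof (rule that[of "2 / \<kappa> * (K1 / \<kappa> + M * K2)"])
    show "2 / \<kappa> * (K1 / \<kappa> + M * K2) \<ge> 0" using K M \<kappa>0 by simp
    fix T :: real assume T: "T \<ge> 1"
    define \<zeta> where "\<zeta> = past_cutoff \<tau> T m"
    define \<psi> where "\<psi> = bump_power T m"
    define h where "h t = ebump (- t - \<tau>)" for t
    let ?R = "T + 1"
    let ?S = "cyl W ?R ?R"
    have sub: "\<psi> \<in> Cc_inf {-?R<..<?R}" unfolding \<psi>_def using T m by (intro bump_power_Cc_inf) auto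
    have \<psi>0: "\<psi> x = 0" if "T \<le> \<bar>x\<bar>" for x unfolding \<psi>_def using T m that by (intro bump_power_0) auto
    have cut: "cutoff ?R ?R \<zeta> \<psi>"
      unfolding cutoff_def
    proof (intro conjI allI impI)
      show "\<zeta> \<in> Cc_inf {-?R<..<0}" unfolding \<zeta>_def using T m \<tau> by (intro past_cutoff_Cc_inf) auto
      show "\<psi> \<in> Cc_inf UNIV" by (rule Cc_inf_mono[OF subset_UNIV sub])
      show "\<bar>x\<bar> < ?R" if "\<psi> x \<noteq> 0" for x using that \<psi>0[of x] by (cases "T \<le> \<bar>x\<bar>") auto
    qed (use T in auto)
    have cut': "cutoff ?R ?R \<zeta> (pderiv_dir 1 \<psi>)"
    proof -
      have "pderiv_dir 1 \<psi> \<in> Cc_inf UNIV" by (rule Cc_inf_pderiv[OF Cc_inf_mono[OF subset_UNIV sub]]) simp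
      moreover obtain L where "L \<subseteq> {-?R<..<?R}" "\<And>x w. x \<notin> L \<Longrightarrow> pderiv_dir w \<psi> x = 0" using Cc_infE[OF sub] by metis
      then have "\<forall>x. pderiv_dir 1 \<psi> x \<noteq> 0 \<longrightarrow> \<bar>x\<bar> < ?R" unfolding abs_less_iff by force
      ultimately show ?thesis using cut unfolding cutoff_def by blast
    qed
    define X where "X = (LINT z|lborel. (\<zeta> (fst z) * \<psi> (fst (snd z)) * u z)\<^sup>2)"
    define U where "U = (LINT z|lborel. (indicator ?S z * u z)\<^sup>2)"
    define Y where "Y = (LINT z|lborel. (\<zeta> (fst z) * pderiv_dir 1 \<psi> (fst (snd z)) * u z)\<^sup>2)"
    define Z where "Z = (LINT z|lborel. pderiv_dir 1 \<zeta> (fst z) * \<zeta> (fst z) * ((\<psi> (fst (snd z)))\<^sup>2 * (u z)\<^sup>2))"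
    note iX = sq_intD(2)[OF sq_cut_mult(1)[OF cut]] and iY = sq_intD(2)[OF sq_cut_mult(1)[OF cut']]
    have iU: "integrable lborel (\<lambda>z. (indicator ?S z * u z)\<^sup>2)" using T by (intro sq_intD(2) sq_u) auto
    have h01: "0 \<le> h t" "h t \<le> 1" for t by (auto simp: h_def ebump_range)
    have \<psi>01: "0 \<le> \<psi> x" "\<psi> x \<le> 1" for x by (auto simp: \<psi>_def bump_power_range)
    have sq01: "(w)\<^sup>2 \<le> 1" if "0 \<le> w" "w \<le> 1" for w :: real using that by (simp add: power_le_one)
    have out: "\<zeta> (fst z) = 0 \<or> (\<psi> (fst (snd z)) = 0 \<and> pderiv_dir 1 \<psi> (fst (snd z)) = 0) \<or> u z = 0" if "z \<notin> ?S" for z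
    proof -
      have "fst z \<notin> {-?R<..<0} \<or> fst (snd z) \<notin> {-?R<..<?R} \<or> snd (snd z) \<notin> W"
        using that by (auto simp: cyl_def mem_Times_iff)
      then show ?thesis
        using cutoff_zero[OF cut] cutoff_zero(3)[OF cut'] u_0[of z] by (auto simp: strip_def mem_Times_iff)
    qed
    have Yle: "(\<zeta> (fst z) * pderiv_dir 1 \<psi> (fst (snd z)) * u z)\<^sup>2
        \<le> \<delta>2 * (\<zeta> (fst z) * \<psi> (fst (snd z)) * u z)\<^sup>2 + K2 / T ^ (2 * m) * (indicator ?S z * u z)\<^sup>2" for z
    proof (cases "z \<in> ?S")
      case True
      have "(\<zeta> (fst z))\<^sup>2 \<le> 1"
        unfolding \<zeta>_def past_cutoff_def using ebump_range[of "- fst z - \<tau>"] bump_power_range[of T m "fst z"]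
        by (intro sq01 mult_nonneg_nonneg mult_le_one) auto
      then have z1: "(\<zeta> (fst z))\<^sup>2 * (u z)\<^sup>2 \<le> (u z)\<^sup>2" by (simp add: mult_left_le_one_le)
      have "(pderiv_dir 1 \<psi> (fst (snd z)))\<^sup>2 \<le> \<delta>2 * (\<psi> (fst (snd z)))\<^sup>2 + K2 / T ^ (2 * m)"
        unfolding \<psi>_def K2_def using T m \<delta> C1 by (intro bump_power_deriv_bound) auto
      then have "((\<zeta> (fst z))\<^sup>2 * (u z)\<^sup>2) * (pderiv_dir 1 \<psi> (fst (snd z)))\<^sup>2
         \<le> ((\<zeta> (fst z))\<^sup>2 * (u z)\<^sup>2) * (\<delta>2 * (\<psi> (fst (snd z)))\<^sup>2 + K2 / T ^ (2 * m))"
        by (intro mult_left_mono) auto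
      also have "\<dots> = \<delta>2 * ((\<zeta> (fst z))\<^sup>2 * (\<psi> (fst (snd z)))\<^sup>2 * (u z)\<^sup>2) + K2 / T ^ (2 * m) * ((\<zeta> (fst z))\<^sup>2 * (u z)\<^sup>2)"
        by (simp add: algebra_simps)
      also have "\<dots> \<le> \<delta>2 * ((\<zeta> (fst z))\<^sup>2 * (\<psi> (fst (snd z)))\<^sup>2 * (u z)\<^sup>2) + K2 / T ^ (2 * m) * (u z)\<^sup>2"
        using z1 K T by (intro add_left_mono mult_left_mono) auto
      finally show ?thesis using True by (simp add: power_mult_distrib mult_ac)
    next
      case False
      then show ?thesis using out[OF False] \<delta> K T by auto
    qed
    have Zle: "pderiv_dir 1 \<zeta> (fst z) * \<zeta> (fst z) * ((\<psi> (fst (snd z)))\<^sup>2 * (u z)\<^sup>2)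
        \<le> 3 * \<kappa> / 8 * (\<zeta> (fst z) * \<psi> (fst (snd z)) * u z)\<^sup>2 + K1 / \<kappa> / T ^ (2 * m) * (indicator ?S z * u z)\<^sup>2" for z
    proof (cases "z \<in> ?S")
      case True
      let ?w = "(\<psi> (fst (snd z)))\<^sup>2 * (u z)\<^sup>2"
      have w: "?w \<le> (u z)\<^sup>2" using sq01[OF \<psi>01] by (simp add: mult_left_le_one_le)
      have hw: "(h (fst z))\<^sup>2 * ?w \<le> (u z)\<^sup>2"
        using mult_mono[OF sq01[OF h01] w, of "fst z"] by simp
      have "(pderiv_dir 1 (bump_power T m) (fst z))\<^sup>2 \<le> \<delta>1 * (bump_power T m (fst z))\<^sup>2 + K1 / T ^ (2 * m)"
        unfolding K1_def using T m \<delta> C1 by (intro bump_power_deriv_bound) auto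
      then have "(pderiv_dir 1 (bump_power T m) (fst z))\<^sup>2 / \<kappa> \<le> (\<delta>1 * (bump_power T m (fst z))\<^sup>2 + K1 / T ^ (2 * m)) / \<kappa>"
        using \<kappa>0 by (intro divide_right_mono) auto
      also have "\<dots> = \<kappa> / 8 * (bump_power T m (fst z))\<^sup>2 + K1 / \<kappa> / T ^ (2 * m)"
        using \<kappa>0 by (simp add: \<delta>1_def add_divide_distrib power2_eq_square mult.commute)
      finally have "\<kappa> / 4 * (bump_power T m (fst z))\<^sup>2 + (pderiv_dir 1 (bump_power T m) (fst z))\<^sup>2 / \<kappa>
          \<le> 3 * \<kappa> / 8 * (bump_power T m (fst z))\<^sup>2 + K1 / \<kappa> / T ^ (2 * m)" by (simp add: algebra_simps)
      then have "(h (fst z))\<^sup>2 * (\<kappa> / 4 * (bump_power T m (fst z))\<^sup>2 + (pderiv_dir 1 (bump_power T m) (fst z))\<^sup>2 / \<kappa>)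
          \<le> (h (fst z))\<^sup>2 * (3 * \<kappa> / 8 * (bump_power T m (fst z))\<^sup>2 + K1 / \<kappa> / T ^ (2 * m))"
        by (intro mult_left_mono) auto
      with past_cutoff_deriv[OF \<kappa>0, of \<tau> T m "fst z"]
      have "pderiv_dir 1 \<zeta> (fst z) * \<zeta> (fst z) \<le> (h (fst z))\<^sup>2 * (3 * \<kappa> / 8 * (bump_power T m (fst z))\<^sup>2 + K1 / \<kappa> / T ^ (2 * m))"
        by (simp add: \<zeta>_def h_def)
      then have "pderiv_dir 1 \<zeta> (fst z) * \<zeta> (fst z) * ?w \<le> (h (fst z))\<^sup>2 * (3 * \<kappa> / 8 * (bump_power T m (fst z))\<^sup>2 + K1 / \<kappa> / T ^ (2 * m)) * ?w"
        by (intro mult_right_mono) auto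
      also have "\<dots> = 3 * \<kappa> / 8 * ((h (fst z) * bump_power T m (fst z))\<^sup>2 * ?w) + K1 / \<kappa> / T ^ (2 * m) * ((h (fst z))\<^sup>2 * ?w)"
        by (simp add: algebra_simps power_mult_distrib)
      also have "\<dots> \<le> 3 * \<kappa> / 8 * ((h (fst z) * bump_power T m (fst z))\<^sup>2 * ?w) + K1 / \<kappa> / T ^ (2 * m) * (u z)\<^sup>2"
        using hw K \<kappa>0 T by (intro add_left_mono mult_left_mono) auto
      finally show ?thesis using True by (simp add: \<zeta>_def past_cutoff_def h_def power_mult_distrib mult_ac)
    next
      case False
      then show ?thesis using out[OF False] \<kappa>0 K T by auto
    qed
    have "Y \<le> \<delta>2 * X + K2 / T ^ (2 * m) * U"
    proof -
      have "Y \<le> (LINT z|lborel. \<delta>2 * (\<zeta> (fst z) * \<psi> (fst (snd z)) * u z)\<^sup>2 + K2 / T ^ (2 * m) * (indicator ?S z * u z)\<^sup>2)"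
        unfolding Y_def by (rule integral_mono[OF iY _ Yle]) (intro Bochner_Integration.integrable_add integrable_mult_right iX iU)
      also have "\<dots> = \<delta>2 * X + K2 / T ^ (2 * m) * U"
        unfolding X_def U_def by (subst Bochner_Integration.integral_add; (intro integrable_mult_right iX iU)?) simp
      finally show ?thesis .
    qed
    then have "M * Y \<le> M * (\<delta>2 * X + K2 / T ^ (2 * m) * U)" using M by (rule mult_left_mono)
    also have "\<dots> \<le> \<kappa> / 8 * X + M * K2 / T ^ (2 * m) * U"
    proof -
      have "M * \<delta>2 \<le> \<kappa> / 8" using M \<kappa>0 by (simp add: \<delta>2_def field_simps)
      then have "M * \<delta>2 * X \<le> \<kappa> / 8 * X" by (rule mult_right_mono) (auto simp: X_def intro: integral_nonneg_AE)
      then show ?thesis by (simp add: algebra_simps)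
    qed
    finally have MY: "M * Y \<le> \<kappa> / 8 * X + M * K2 / T ^ (2 * m) * U" .
    have Z: "Z \<le> 3 * \<kappa> / 8 * X + K1 / \<kappa> / T ^ (2 * m) * U"
    proof -
      have Xi: "integrable lborel (\<lambda>z. 3 * \<kappa> / 8 * (\<zeta> (fst z) * \<psi> (fst (snd z)) * u z)\<^sup>2 + K1 / \<kappa> / T ^ (2 * m) * (indicator ?S z * u z)\<^sup>2)"
        by (intro Bochner_Integration.integrable_add integrable_mult_right iX iU)
      have "Z \<le> (LINT z|lborel. 3 * \<kappa> / 8 * (\<zeta> (fst z) * \<psi> (fst (snd z)) * u z)\<^sup>2 + K1 / \<kappa> / T ^ (2 * m) * (indicator ?S z * u z)\<^sup>2)"
      proof (cases "integrable lborel (\<lambda>z. pderiv_dir 1 \<zeta> (fst z) * \<zeta> (fst z) * ((\<psi> (fst (snd z)))\<^sup>2 * (u z)\<^sup>2))")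
        case True
        show ?thesis unfolding Z_def by (rule integral_mono[OF True Xi Zle])
      next
        \<comment> \<open>The integral of a non-integrable function is 0 by convention, and the
          majorant has a nonnegative integral, so the bound holds in this case as well.\<close>
        case False
        then have "Z = 0" unfolding Z_def by (rule not_integrable_integral_eq)
        moreover have "0 \<le> (LINT z|lborel. 3 * \<kappa> / 8 * (\<zeta> (fst z) * \<psi> (fst (snd z)) * u z)\<^sup>2 + K1 / \<kappa> / T ^ (2 * m) * (indicator ?S z * u z)\<^sup>2)"
          using \<kappa>0 K T by (intro integral_nonneg_AE AE_I2 add_nonneg_nonneg mult_nonneg_nonneg) auto
        ultimately show ?thesis by simp
      qed
      also have "\<dots> = 3 * \<kappa> / 8 * X + K1 / \<kappa> / T ^ (2 * m) * U"
        unfolding X_def U_def by (subst Bochner_Integration.integral_add; (intro integrable_mult_right iX iU)?) simp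
      finally show ?thesis .
    qed
    have "\<kappa> * X \<le> Z + M * Y"
      using energy_inequality[OF cut sub V r \<kappa> N small] by (simp add: X_def Y_def Z_def M_def)
    with MY Z have "\<kappa> / 2 * X \<le> (K1 / \<kappa> + M * K2) / T ^ (2 * m) * U"
      by (simp add: add_divide_distrib algebra_simps)
    then have "2 / \<kappa> * (\<kappa> / 2 * X) \<le> 2 / \<kappa> * ((K1 / \<kappa> + M * K2) / T ^ (2 * m) * U)"
      using \<kappa>0 by (intro mult_left_mono) auto
    then have "X \<le> 2 / \<kappa> * ((K1 / \<kappa> + M * K2) / T ^ (2 * m) * U)" using \<kappa>0 by simp
    then show "(LINT z|lborel. (past_cutoff \<tau> T m (fst z) * bump_power T m (fst (snd z)) * u z)\<^sup>2)
      \<le> 2 / \<kappa> * (K1 / \<kappa> + M * K2) / T ^ (2 * m) * (LINT z|lborel. (indicator ?S z * u z)\<^sup>2)"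
    proof -
      have "2 / \<kappa> * (q / w * v) = 2 / \<kappa> * q / w * v" for q w v :: real by (simp add: mult.assoc)
      with \<open>X \<le> _\<close> show ?thesis unfolding X_def U_def \<zeta>_def \<psi>_def by metis
    qed
  qed
qed

text \<open>With \<open>m = n + 2\<close> the decay beats the growth by a factor
  \<open>T\<^sup>2\<close>. On a fixed box the cutoff powers are bounded below uniformly in large
  \<open>T\<close>, so letting \<open>T\<close> grow gives \<open>u = 0\<close> there for times
  before \<open>- \<tau>\<close>. Finally box and \<open>\<tau>\<close> run through countable
  families.\<close>

lemma vanish:
  assumes V: "emeasure lborel W = ennreal V" "V > 0"
    and r: "measure lborel (ball (0::real ^ 'n) r) \<ge> 2 * V" "r > 0"
    and \<kappa>: "\<kappa> = lam * V / (4 * (r\<^sup>2 * measure lborel (ball (0::real ^ 'n) r)))"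
    and N: "N = real DIM('n space)" and small: "eps * N / lam + eps \<le> \<kappa>"
    and gr: "AE z in lborel. \<bar>u z\<bar> \<le> C * (norm (snd z) + sqrt \<bar>fst z\<bar> + 1) powr d" "C > 0" "d > 0"
  shows "AE z in lborel. u z = 0"
proof -
  obtain n where n: "d \<le> real n" using real_arch_simple by blast
  obtain B where B: "B \<ge> 0" "\<And>T. T \<ge> 1 \<Longrightarrow> (LINT z|lborel. (indicator (cyl W (T + 1) (T + 1)) z * u z)\<^sup>2) \<le> B * T ^ (2 * n + 2)"
    by (rule growth_integral[OF V gr n]) blast
  define m where "m = n + 2"
  have m: "m > 0" by (simp add: m_def)
  have key: "AE z in lborel. ebump (- fst z - \<tau>) * (indicator (cyl W A A) z * u z) = 0" if \<tau>: "\<tau> > 0" and A: "A \<ge> 1" for \<tau> A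
  proof -
    obtain K where K: "K \<ge> 0" "\<And>T. T \<ge> 1 \<Longrightarrow>
      (LINT z|lborel. (past_cutoff \<tau> T m (fst z) * bump_power T m (fst (snd z)) * u z)\<^sup>2)
        \<le> K / T ^ (2 * m) * (LINT z|lborel. (indicator (cyl W (T + 1) (T + 1)) z * u z)\<^sup>2)"
      by (rule weighted_decay[OF V r \<kappa> N small \<tau> m]) blast
    \<comment> \<open>A lower bound of \<open>bump_power T m\<close> on
      \<open>\<bar>y\<bar> < A\<close> once \<open>T \<ge> 2 * A\<close>, because then
      \<open>bump_ge\<close> applies to \<open>y / T\<close>. It enters once for time and once for
      space and is then squared, hence \<open>(c0\<^sup>2)\<^sup>2\<close> below.\<close>
    define c0 where "c0 = ((ebump (1/2))\<^sup>2) ^ m"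
    have c0: "c0 > 0" using ebump_pos[of "1/2"] by (simp add: c0_def)
    let ?g = "\<lambda>z. ebump (- fst z - \<tau>) * (indicator (cyl W A A) z * u z)"
    have sg: "sq_int ?g"
      by (rule sq_int_mult_bounded[OF sq_u measurable_fst_borel[OF smooth_borel_measurable[OF smooth_ebump_past]], of _ _ _ 1])
        (use A ebump_range in auto)
    have le: "(c0\<^sup>2)\<^sup>2 * (LINT z|lborel. (?g z)\<^sup>2) \<le> K * B / T\<^sup>2" if T: "T \<ge> 2 * A" for T
    proof -
      have T1: "T \<ge> 1" using T A by simp
      have c0le: "c0 \<le> bump_power T m y" if "\<bar>y\<bar> < A" for y
      proof -
        have "\<bar>y / T\<bar> \<le> 1/2" using that T A by (simp add: field_simps abs_divide)
        then show ?thesis unfolding c0_def bump_power_def by (intro power_mono bump_ge) auto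
      qed
      have cutT: "cutoff (T + 1) (T + 1) (past_cutoff \<tau> T m) (bump_power T m)"
        unfolding cutoff_def
      proof (intro conjI allI impI)
        show "past_cutoff \<tau> T m \<in> Cc_inf {-(T + 1)<..<0}" using T1 m \<tau> by (intro past_cutoff_Cc_inf) auto
        show "bump_power T m \<in> Cc_inf UNIV" using T1 m by (intro Cc_inf_mono[OF subset_UNIV bump_power_Cc_inf]) auto
        show "\<bar>x\<bar> < T + 1" if "bump_power T m x \<noteq> 0" for x
          using that bump_power_0[of T m x] T1 m by (cases "T \<le> \<bar>x\<bar>") auto
      qed (use T1 in auto)
      have "(c0\<^sup>2)\<^sup>2 * (LINT z|lborel. (?g z)\<^sup>2) = (LINT z|lborel. (c0\<^sup>2 * ?g z)\<^sup>2)" by (simp add: power_mult_distrib)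
      also have "\<dots> \<le> (LINT z|lborel. (past_cutoff \<tau> T m (fst z) * bump_power T m (fst (snd z)) * u z)\<^sup>2)"
      proof (rule integral_mono)
        show "integrable lborel (\<lambda>z. (c0\<^sup>2 * ?g z)\<^sup>2)" using sq_intD(2)[OF sq_int_cmult[OF sg]] .
        show "integrable lborel (\<lambda>z. (past_cutoff \<tau> T m (fst z) * bump_power T m (fst (snd z)) * u z)\<^sup>2)"
          by (rule sq_intD(2)[OF sq_cut_mult(1)[OF cutT]])
        show "(c0\<^sup>2 * ?g z)\<^sup>2 \<le> (past_cutoff \<tau> T m (fst z) * bump_power T m (fst (snd z)) * u z)\<^sup>2" for z
        proof (cases "z \<in> cyl W A A")
          case True
          then have b: "\<bar>fst z\<bar> < A" "\<bar>fst (snd z)\<bar> < A" by (auto simp: cyl_def mem_Times_iff)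
          have "c0\<^sup>2 * ebump (- fst z - \<tau>) \<le> bump_power T m (fst z) * bump_power T m (fst (snd z)) * ebump (- fst z - \<tau>)"
            unfolding power2_eq_square using c0le[OF b(1)] c0le[OF b(2)] c0 ebump_range(1)
            by (intro mult_right_mono mult_mono) auto
          moreover have "0 \<le> c0\<^sup>2 * ebump (- fst z - \<tau>)" using ebump_range(1)[of "- fst z - \<tau>"] by simp
          ultimately have "(c0\<^sup>2 * ebump (- fst z - \<tau>))\<^sup>2 \<le> (past_cutoff \<tau> T m (fst z) * bump_power T m (fst (snd z)))\<^sup>2"
            by (intro power_mono) (auto simp: past_cutoff_def mult_ac)
          from mult_right_mono[OF this, of "(u z)\<^sup>2"] True show ?thesis by (simp add: power_mult_distrib mult_ac)
        qed simp
      qed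
      also have "\<dots> \<le> K / T ^ (2 * m) * (LINT z|lborel. (indicator (cyl W (T + 1) (T + 1)) z * u z)\<^sup>2)" by (rule K(2)[OF T1])
      also have "\<dots> \<le> K / T ^ (2 * m) * (B * T ^ (2 * n + 2))" using K(1) T1 by (intro mult_left_mono B(2)) auto
      also have "\<dots> = K * B / T\<^sup>2" using T1 by (simp add: m_def power_add power2_eq_square power4_eq_xxxx field_simps)
      finally show ?thesis .
    qed
    have lim: "(\<lambda>j. K * B / (real j)\<^sup>2) \<longlonglongrightarrow> 0"
    proof -
      have "(\<lambda>j. K * B * (1 / real j)\<^sup>2) \<longlonglongrightarrow> K * B * 0\<^sup>2" by (intro tendsto_intros lim_1_over_n)
      then show ?thesis by (simp add: power_divide)
    qed
    obtain j0 where j0: "real j0 \<ge> 2 * A" using real_arch_simple by blast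
    have "(c0\<^sup>2)\<^sup>2 * (LINT z|lborel. (?g z)\<^sup>2) \<le> 0"
      by (rule LIMSEQ_le_const[OF lim]) (use le j0 in \<open>auto intro!: exI[of _ j0] order_trans[OF j0]\<close>)
    then have "(LINT z|lborel. (?g z)\<^sup>2) \<le> 0" using c0 by (simp add: mult_le_0_iff)
    then have "(LINT z|lborel. (?g z)\<^sup>2) = 0" by (intro antisym integral_nonneg_AE) auto
    then have "AE z in lborel. (?g z)\<^sup>2 = 0"
      using sq_intD(2)[OF sg] by (subst (asm) integral_nonneg_eq_0_iff_AE) auto
    then show ?thesis by eventually_elim simp
  qed
  \<comment> \<open>The boxes grow while \<open>\<tau> = 1 / real (Suc k)\<close> shrinks, so each
    point with \<open>t < 0\<close> in the strip is eventually reached with a positive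
    weight.\<close>
  have "AE z in lborel. \<forall>k::nat. ebump (- fst z - 1 / real (Suc k)) * (indicator (cyl W (real (Suc k)) (real (Suc k))) z * u z) = 0"
    unfolding AE_all_countable by (intro allI key) auto
  then show ?thesis
  proof eventually_elim
    case (elim z)
    show "u z = 0"
    proof (cases "z \<in> {..<0} \<times> strip W")
      case True
      then have z: "fst z < 0" "snd (snd z) \<in> W" by (auto simp: strip_def mem_Times_iff)
      obtain k1 where k1: "inverse (real (Suc k1)) < - fst z" using reals_Archimedean[of "- fst z"] z by auto
      obtain k2 where k2: "max \<bar>fst z\<bar> \<bar>fst (snd z)\<bar> < real k2" using reals_Archimedean2 by blast
      define k where "k = max k1 k2"
      have "1 / real (Suc k) \<le> inverse (real (Suc k1))" by (simp add: k_def divide_simps)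
      then have "0 < - fst z - 1 / real (Suc k)" using k1 by linarith
      then have e: "ebump (- fst z - 1 / real (Suc k)) > 0" by (rule ebump_pos)
      have "real k2 < real (Suc k)" by (simp add: k_def)
      then have "\<bar>fst z\<bar> < real (Suc k)" "\<bar>fst (snd z)\<bar> < real (Suc k)" using k2 by linarith+
      then have "z \<in> cyl W (real (Suc k)) (real (Suc k))" using z by (auto simp: cyl_def mem_Times_iff)
      with elim[rule_format, of k] e show ?thesis by simp
    qed (rule u_0)
  qed
qed

end

section \<open>Reduction to Borel data\<close>

lemma weak_deriv_rep:
  assumes wd: "has_weak_deriv U f v g" and U: "open U" and v: "v \<in> Basis"
    and f': "f' \<in> borel_measurable borel" "AE x in lborel. x \<in> U \<longrightarrow> f' x = f x" "\<And>x. x \<notin> U \<Longrightarrow> f' x = 0"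
    and g': "g' \<in> borel_measurable borel" "AE x in lborel. x \<in> U \<longrightarrow> g' x = g x" "\<And>x. x \<notin> U \<Longrightarrow> g' x = 0"
    and \<eta>: "\<eta> \<in> Cc_inf U"
  shows "(LINT x|lborel. f' x * pderiv_dir v \<eta> x) = - (LINT x|lborel. g' x * \<eta> x)"
proof -
  have m: "\<eta> \<in> borel_measurable borel" "pderiv_dir v \<eta> \<in> borel_measurable borel"
    using smooth_borel_measurable[OF Cc_inf_smooth] \<eta> Cc_inf_pderiv[OF \<eta> v] by auto
  have "(LINT x|lebesgue_on U. f x * pderiv_dir v \<eta> x) = (LINT x|lborel. f' x * pderiv_dir v \<eta> x)"
    by (rule LINT_rep) (use f' m U in \<open>auto elim: eventually_mono\<close>)
  moreover have "(LINT x|lebesgue_on U. g x * \<eta> x) = (LINT x|lborel. g' x * \<eta> x)"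
    by (rule LINT_rep) (use g' m U in \<open>auto elim: eventually_mono\<close>)
  ultimately show ?thesis using wd \<eta> by (simp add: has_weak_deriv_def)
qed

lemma sq_int_rep:
  assumes f: "f \<in> L2 U" and U: "U \<in> sets borel"
    and f': "f' \<in> borel_measurable borel" "AE x in lborel. x \<in> U \<longrightarrow> f' x = f x" "\<And>x. x \<notin> U \<Longrightarrow> f' x = 0"
  shows "sq_int f'"
proof -
  have "integrable (lebesgue_on U) (\<lambda>x. (f x)\<^sup>2) \<longleftrightarrow> integrable lborel (\<lambda>x. (f' x)\<^sup>2)"
    by (rule integrable_rep) (use f' U in \<open>auto elim: eventually_mono\<close>)
  then show ?thesis using f f'(1) by (simp add: L2_def sq_int_def)
qed

text \<open>Agreement is demanded on the countable family \<open>box_bumps U\<close> only, so that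
  one null set of times is enough when the lemma is applied on slices.\<close>

lemma weak_deriv_unique:
  fixes g1 g2 :: "'a::euclidean_space \<Rightarrow> real"
  assumes U: "open U" and g1: "g1 \<in> borel_measurable borel" "\<And>K. compact K \<Longrightarrow> K \<subseteq> U \<Longrightarrow> integrable lborel (\<lambda>x. indicator K x * g1 x)"
    and g2: "g2 \<in> borel_measurable borel" "\<And>K. compact K \<Longrightarrow> K \<subseteq> U \<Longrightarrow> integrable lborel (\<lambda>x. indicator K x * g2 x)"
    and eq: "\<And>\<eta>. \<eta> \<in> box_bumps U \<Longrightarrow> (LINT x|lborel. g1 x * \<eta> x) = (LINT x|lborel. g2 x * \<eta> x)"
  shows "AE x in lborel. x \<in> U \<longrightarrow> g1 x = g2 x"
proof -
  have "AE x in lborel. x \<in> U \<longrightarrow> g1 x - g2 x = 0"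
  proof (rule fundamental_lemma[OF U])
    show "(\<lambda>x. g1 x - g2 x) \<in> borel_measurable borel" using g1 g2 by simp
    show "integrable lborel (\<lambda>x. indicator K x * (g1 x - g2 x))" if "compact K" "K \<subseteq> U" for K
      using g1(2)[OF that] g2(2)[OF that] by (simp add: right_diff_distrib)
    fix \<eta> assume \<eta>: "\<eta> \<in> box_bumps U"
    then have c: "\<eta> \<in> Cc_inf U" using box_bumps_Cc_inf by blast
    obtain K where K: "compact K" "K \<subseteq> U" "\<And>x. x \<notin> K \<Longrightarrow> \<eta> x = 0" using Cc_infE[OF c] by metis
    have "integrable lborel (\<lambda>x. g1 x * \<eta> x)"
      by (rule integrable_mult_compact[OF g1(1) g1(2)[OF K(1,2)] smooth_continuous[OF Cc_inf_smooth[OF c]] K(1,3)])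
    moreover have "integrable lborel (\<lambda>x. g2 x * \<eta> x)"
      by (rule integrable_mult_compact[OF g2(1) g2(2)[OF K(1,2)] smooth_continuous[OF Cc_inf_smooth[OF c]] K(1,3)])
    ultimately show "(LINT x|lborel. (g1 x - g2 x) * \<eta> x) = 0"
      using eq[OF \<eta>] by (simp add: left_diff_distrib)
  qed
  then show ?thesis by simp
qed

section \<open>Slices of weak derivatives and of the boundary condition\<close>

lemma AE_slices:
  assumes "AE z in (lborel :: (real \<times> 'b::euclidean_space) measure). P z"
  shows "AE s in lborel. AE x in lborel. P (s, x)"
proof (rule lborel_pair.AE_pair)
  show "AE z in lborel \<Otimes>\<^sub>M lborel. P z" using assms unfolding lborel_prod .
qed

text \<open>Testing with products \<open>\<theta>(t) \<kappa>(x)\<close> and Fubini show that the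
  slice integral, as a function of time, is orthogonal to every \<open>\<theta>\<close>. By the
  fundamental lemma on the half-line it vanishes almost everywhere, with a null set that depends on
  \<open>\<kappa>\<close>.\<close>

lemma slice_weak_deriv:
  fixes u g :: "real \<times> 'b::euclidean_space \<Rightarrow> real"
  assumes i: "i \<in> Basis" and u: "u \<in> borel_measurable borel" and g: "g \<in> borel_measurable borel"
    and lu: "\<And>K. compact K \<Longrightarrow> K \<subseteq> {..<0} \<times> S \<Longrightarrow> integrable lborel (\<lambda>z. indicator K z * u z)"
    and lg: "\<And>K. compact K \<Longrightarrow> K \<subseteq> {..<0} \<times> S \<Longrightarrow> integrable lborel (\<lambda>z. indicator K z * g z)"
    and wd: "\<And>\<eta>. \<eta> \<in> Cc_inf ({..<0} \<times> S) \<Longrightarrow> (LINT z|lborel. u z * pderiv_dir (0, i) \<eta> z) = - (LINT z|lborel. g z * \<eta> z)"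
    and \<kappa>: "\<kappa> \<in> Cc_inf S"
  shows "AE s in lborel. s < 0 \<longrightarrow> (LINT x|lborel. u (s, x) * pderiv_dir i \<kappa> x + g (s, x) * \<kappa> x) = 0"
proof -
  define F where "F z = u z * pderiv_dir i \<kappa> (snd z) + g z * \<kappa> (snd z)" for z
  note s\<kappa> = Cc_inf_smooth[OF \<kappa>]
  obtain L where L: "compact L" "L \<subseteq> S" "\<And>x. x \<notin> L \<Longrightarrow> \<kappa> x = 0" "\<And>v x. x \<notin> L \<Longrightarrow> pderiv_dir v \<kappa> x = 0"
    using Cc_infE[OF \<kappa>] by metis
  have m\<kappa>: "\<kappa> \<in> borel_measurable borel" "pderiv_dir i \<kappa> \<in> borel_measurable borel"
    using smooth_borel_measurable smooth_pderiv_Basis[OF s\<kappa> i] s\<kappa> by auto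
  obtain B1 where B1: "\<And>x. \<bar>\<kappa> x\<bar> \<le> B1" using Cc_inf_bounded[OF \<kappa>] by metis
  obtain B2 where B2: "\<And>x. \<bar>pderiv_dir i \<kappa> x\<bar> \<le> B2" using Cc_inf_bounded[OF Cc_inf_pderiv[OF \<kappa> i]] by metis
  have mF: "F \<in> borel_measurable borel"
    unfolding F_def by (intro borel_measurable_add borel_measurable_times u g measurable_snd_borel m\<kappa>)
  have aux: "integrable lborel (\<lambda>z. \<theta> (fst z) * (f z * k (snd z)))"
    if "f \<in> borel_measurable borel" "\<And>K. compact K \<Longrightarrow> K \<subseteq> {..<0} \<times> S \<Longrightarrow> integrable lborel (\<lambda>z. indicator K z * f z)"
      "k \<in> borel_measurable borel" "\<And>x. \<bar>k x\<bar> \<le> B" "\<And>x. x \<notin> L \<Longrightarrow> k x = 0"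
      "\<theta> \<in> borel_measurable borel" "\<And>t. \<bar>\<theta> t\<bar> \<le> B'" "compact K" "K \<subseteq> {..<0}" "\<And>t. t \<notin> K \<Longrightarrow> \<theta> t = 0"
    for f :: "real \<times> 'b \<Rightarrow> real" and k :: "'b \<Rightarrow> real" and \<theta> :: "real \<Rightarrow> real" and B B' K
  proof (rule Bochner_Integration.integrable_bound)
    have B: "B' \<ge> 0" using that(7)[of 0] by linarith
    show "integrable lborel (\<lambda>z. B' * B * (indicator (K \<times> L) z * f z))"
      using that(2)[of "K \<times> L"] that(8,9) L(1,2) by (intro integrable_mult_right) (auto intro: compact_Times)
    show "(\<lambda>z. \<theta> (fst z) * (f z * k (snd z))) \<in> borel_measurable lborel"
      using that(1) measurable_fst_borel[OF that(6), where 'b='b] measurable_snd_borel[OF that(3), where 'a=real] by simp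
    have "norm (\<theta> (fst z) * (f z * k (snd z))) \<le> norm (B' * B * (indicator (K \<times> L) z * f z))" for z
    proof (cases "z \<in> K \<times> L")
      case True
      have "\<bar>\<theta> (fst z)\<bar> * \<bar>k (snd z)\<bar> \<le> B' * B" using that(4,7) B by (intro mult_mono) auto
      also have "\<dots> \<le> \<bar>B' * B\<bar>" by simp
      finally have "\<bar>\<theta> (fst z)\<bar> * \<bar>k (snd z)\<bar> * \<bar>f z\<bar> \<le> \<bar>B' * B\<bar> * \<bar>f z\<bar>" by (intro mult_right_mono) auto
      with True show ?thesis by (simp add: abs_mult mult_ac)
    next
      case False
      then have "\<theta> (fst z) = 0 \<or> k (snd z) = 0" using that(5,10) by (auto simp: mem_Times_iff)
      then show ?thesis by auto
    qed
    then show "AE z in lborel. norm (\<theta> (fst z) * (f z * k (snd z))) \<le> norm (B' * B * (indicator (K \<times> L) z * f z))" by simp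
  qed
  have iF: "integrable lborel (\<lambda>z. \<theta> (fst z) * F z)" "integrable lborel (\<lambda>z. \<theta> (fst z) * (u z * pderiv_dir i \<kappa> (snd z)))"
     "integrable lborel (\<lambda>z. \<theta> (fst z) * (g z * \<kappa> (snd z)))"
    if \<theta>: "\<theta> \<in> borel_measurable borel" "\<And>t. \<bar>\<theta> t\<bar> \<le> B'" "compact K" "K \<subseteq> {..<0}" "\<And>t. t \<notin> K \<Longrightarrow> \<theta> t = 0" for \<theta> B' K
  proof -
    show 1: "integrable lborel (\<lambda>z. \<theta> (fst z) * (u z * pderiv_dir i \<kappa> (snd z)))"
      using aux[OF u lu m\<kappa>(2) B2 L(4) \<theta>] by auto
    show 2: "integrable lborel (\<lambda>z. \<theta> (fst z) * (g z * \<kappa> (snd z)))"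
      using aux[OF g lg m\<kappa>(1) B1 L(3) \<theta>] by auto
    show "integrable lborel (\<lambda>z. \<theta> (fst z) * F z)" using 1 2 by (simp add: F_def distrib_left)
  qed
  have "AE s in lborel. s \<in> {..<0} \<longrightarrow> (LINT x|lborel. F (s, x)) = 0"
  proof (rule fundamental_lemma)
    show "(\<lambda>s. LINT x|lborel. F (s, x)) \<in> borel_measurable borel"
      using lborel.borel_measurable_lebesgue_integral[of "\<lambda>s x. F (s, x)" lborel] mF by (simp add: lborel_prod)
    show "integrable lborel (\<lambda>s. indicator K s * (LINT x|lborel. F (s, x)))" if K: "compact K" "K \<subseteq> {..<0}" for K
    proof -
      have "integrable lborel (\<lambda>z. indicator K (fst z) * F z)"
        by (rule iF(1)[where B'=1 and K=K]) (use K borel_compact[OF K(1)] in \<open>auto simp: indicator_def\<close>)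
      from integral_slices(1)[OF this] show ?thesis by simp
    qed
    fix \<theta> assume "\<theta> \<in> box_bumps {..<(0::real)}"
    then have \<theta>: "\<theta> \<in> Cc_inf {..<0}" using box_bumps_Cc_inf by blast
    note s\<theta> = Cc_inf_smooth[OF \<theta>]
    obtain K where K: "compact K" "K \<subseteq> {..<0}" "\<And>t. t \<notin> K \<Longrightarrow> \<theta> t = 0" using Cc_infE[OF \<theta>] by metis
    obtain B' where B': "\<And>t. \<bar>\<theta> t\<bar> \<le> B'" using Cc_inf_bounded[OF \<theta>] by metis
    note iF = iF[OF smooth_borel_measurable[OF s\<theta>] B' K]
    let ?\<eta> = "\<lambda>z. \<theta> (fst z) * \<kappa> (snd z)"
    have \<eta>: "?\<eta> \<in> Cc_inf ({..<0} \<times> S)" by (rule Cc_inf_tensor[OF \<theta> \<kappa>])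
    have d: "pderiv_dir (0, i) ?\<eta> z = \<theta> (fst z) * pderiv_dir i \<kappa> (snd z)" for z
      using pderiv_dir_mult[OF smooth_fst[OF s\<theta>] smooth_snd[OF s\<kappa>], of "(0, i)" z]
      by (simp add: pderiv_dir_fst[OF s\<theta>] pderiv_dir_snd[OF s\<kappa>] pderiv_dir_0[OF s\<theta>])
    have "(LINT s|lborel. (LINT x|lborel. F (s, x)) * \<theta> s) = (LINT s|lborel. (LINT x|lborel. \<theta> (fst (s, x)) * F (s, x)))"
      by (simp add: mult.commute)
    also have "\<dots> = (LINT z|lborel. \<theta> (fst z) * F z)" by (rule integral_slices(2)[OF iF(1)])
    also have "\<dots> = (LINT z|lborel. \<theta> (fst z) * (u z * pderiv_dir i \<kappa> (snd z))) + (LINT z|lborel. \<theta> (fst z) * (g z * \<kappa> (snd z)))"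
      unfolding F_def distrib_left by (rule Bochner_Integration.integral_add[OF iF(2,3)])
    also have "(LINT z|lborel. \<theta> (fst z) * (u z * pderiv_dir i \<kappa> (snd z))) = (LINT z|lborel. u z * pderiv_dir (0, i) ?\<eta> z)"
      unfolding d by (simp add: mult_ac)
    also have "(LINT z|lborel. \<theta> (fst z) * (g z * \<kappa> (snd z))) = (LINT z|lborel. g z * ?\<eta> z)"
      by (simp add: mult_ac)
    finally show "(LINT s|lborel. (LINT x|lborel. F (s, x)) * \<theta> s) = 0" using wd[OF \<eta>] by simp
  qed simp
  then show ?thesis by (simp add: F_def)
qed

lemma tendsto_0_of_sum:
  fixes f :: "nat \<Rightarrow> real" and g :: "'i \<Rightarrow> nat \<Rightarrow> real"
  assumes lim: "(\<lambda>k. f k + (\<Sum>i\<in>I. g i k)) \<longlonglongrightarrow> 0" and I: "finite I"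
    and nn: "\<And>k. f k \<ge> 0" "\<And>i k. i \<in> I \<Longrightarrow> g i k \<ge> 0"
  shows "f \<longlonglongrightarrow> 0" "\<And>i. i \<in> I \<Longrightarrow> g i \<longlonglongrightarrow> 0"
proof -
  show "f \<longlonglongrightarrow> 0"
    by (rule tendsto_sandwich[OF _ _ tendsto_const lim]) (auto intro!: always_eventually nn sum_nonneg)
  show "g i \<longlonglongrightarrow> 0" if i: "i \<in> I" for i
  proof (rule tendsto_sandwich[OF _ _ tendsto_const lim])
    show "eventually (\<lambda>k. g i k \<le> f k + (\<Sum>i\<in>I. g i k)) sequentially"
    proof (rule always_eventually, rule allI)
      fix k
      have "g i k \<le> (\<Sum>i\<in>I. g i k)" using member_le_sum[OF i, of "\<lambda>i. g i k"] nn(2) I by auto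
      then show "g i k \<le> f k + (\<Sum>i\<in>I. g i k)" using nn(1)[of k] by simp
    qed
  qed (use nn i in auto)
qed

text \<open>On each slice \<open>W12_0\<close> supplies some gradient \<open>g\<close>, which has no
  given relation to the space-time gradient \<open>D\<close>. Uniqueness of weak derivatives on the
  slice identifies it, for almost every time, with the expression formed from
  \<open>D\<close>.\<close>

lemma boundary_slices:
  fixes W :: "(real ^ 'n::finite) set" and u :: "real \<times> 'n space \<Rightarrow> real" and D :: "'n space \<Rightarrow> real \<times> 'n space \<Rightarrow> real"
  assumes W: "open W" and bd: "vanishes_on_boundary W u0" and \<psi>: "\<psi> \<in> Cc_inf UNIV"
    and u: "u \<in> borel_measurable borel" "AE z in lborel. z \<in> {..<0} \<times> strip W \<longrightarrow> u z = u0 z" "\<And>z. z \<notin> {..<0} \<times> strip W \<Longrightarrow> u z = 0"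
    and lu: "\<And>K. compact K \<Longrightarrow> K \<subseteq> {..<0} \<times> strip W \<Longrightarrow> integrable lborel (\<lambda>z. indicator K z * u z)"
    and D: "\<And>i. i \<in> Basis \<Longrightarrow> D i \<in> borel_measurable borel" "\<And>i z. i \<in> Basis \<Longrightarrow> z \<notin> {..<0} \<times> strip W \<Longrightarrow> D i z = 0"
    and lD: "\<And>i K. i \<in> Basis \<Longrightarrow> compact K \<Longrightarrow> K \<subseteq> {..<0} \<times> strip W \<Longrightarrow> integrable lborel (\<lambda>z. indicator K z * D i z)"
    and sq_u: "\<And>T R. T > 0 \<Longrightarrow> R > 0 \<Longrightarrow> sq_int (\<lambda>z. indicator (cyl W T R) z * u z)"
    and sq_D: "\<And>T R i. T > 0 \<Longrightarrow> R > 0 \<Longrightarrow> i \<in> Basis \<Longrightarrow> sq_int (\<lambda>z. indicator (cyl W T R) z * D i z)"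
    and wd: "\<And>i \<eta>. i \<in> Basis \<Longrightarrow> \<eta> \<in> Cc_inf ({..<0} \<times> strip W) \<Longrightarrow>
      (LINT z|lborel. u z * pderiv_dir (0, i) \<eta> z) = - (LINT z|lborel. D i z * \<eta> z)"
  shows "AE s in lborel. s < 0 \<longrightarrow> (\<exists>\<phi>. (\<forall>k. \<phi> k \<in> Cc_inf (strip W)) \<and>
        (\<lambda>k. LINT x|lborel. (\<phi> k x - \<psi> (fst x) * u (s, x))\<^sup>2) \<longlonglongrightarrow> 0 \<and>
        (\<forall>i\<in>Basis. (\<lambda>k. LINT x|lborel. (pderiv_dir i (\<phi> k) x
             - (\<psi> (fst x) * D i (s, x) + pderiv_dir (fst i) \<psi> (fst x) * u (s, x)))\<^sup>2) \<longlonglongrightarrow> 0))"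
proof -
  let ?S = "strip W"
  have S: "open ?S" unfolding strip_def using W by (intro open_Times) auto
  define G where "G i z = \<psi> (fst (snd z)) * D i z + pderiv_dir (fst i) \<psi> (fst (snd z)) * u z" for i z
  note s\<psi> = Cc_inf_smooth[OF \<psi>]
  have s\<psi>f: "smooth (\<lambda>x::'n space. \<psi> (fst x))" by (rule smooth_fst[OF s\<psi>])
  have fB: "fst i = 0 \<or> fst i = 1" if "i \<in> (Basis :: 'n space set)" for i using that by (auto simp: Basis_prod_def)
  have d\<psi>: "pderiv_dir (fst i) \<psi> \<in> Cc_inf UNIV" if "i \<in> (Basis :: 'n space set)" for i
  proof -
    have "pderiv_dir 0 \<psi> = (\<lambda>x. 0)" using pderiv_dir_0[OF s\<psi>] by auto
    then show ?thesis using fB[OF that] Cc_inf_pderiv[OF \<psi>, of 1] Cc_inf_zero by auto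
  qed
  obtain R where R: "R > 0" "\<And>y. y \<notin> {-R<..<R} \<Longrightarrow> \<psi> y = 0" "\<And>v y. y \<notin> {-R<..<R} \<Longrightarrow> pderiv_dir v \<psi> y = 0"
  proof -
    obtain K where K: "compact K" "\<And>x. x \<notin> K \<Longrightarrow> \<psi> x = 0" "\<And>v x. x \<notin> K \<Longrightarrow> pderiv_dir v \<psi> x = 0" using Cc_infE[OF \<psi>] by metis
    obtain R where "R > 0" "\<And>x. x \<in> K \<Longrightarrow> \<bar>x\<bar> < R" using compact_imp_bounded[OF K(1)] bounded_pos_less[of K] by auto
    moreover from this have "y \<notin> K" if "y \<notin> {-R<..<R}" for y using that by force
    ultimately show ?thesis using that[of R] K by blast
  qed
  have mult: "sq_int (\<lambda>x. f (fst x) * F (s, x))"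
    if "s \<in> {-T<..<0}" "sq_int (\<lambda>x. indicator (cyl W T R) (s, x) * F (s, x))" "f \<in> Cc_inf UNIV" "\<And>y. y \<notin> {-R<..<R} \<Longrightarrow> f y = 0"
      "\<And>z. z \<notin> {..<0} \<times> ?S \<Longrightarrow> F z = 0"
    for f F s T
  proof -
    note f = that(3)
    obtain B where B: "\<And>x. \<bar>f x\<bar> \<le> B" using Cc_inf_bounded[OF f] by metis
    have "sq_int (\<lambda>x. f (fst x) * (indicator (cyl W T R) (s, x) * F (s, x)))"
      by (rule sq_int_mult_bounded[OF that(2) measurable_fst_borel[OF smooth_borel_measurable[OF Cc_inf_smooth[OF that(3)]]] B])
    then show ?thesis
    proof (rule back_subst[of sq_int], intro ext)
      fix x :: "'n space"
      show "f (fst x) * (indicator (cyl W T R) (s, x) * F (s, x)) = f (fst x) * F (s, x)"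
      proof (cases "(s, x) \<in> cyl W T R")
        case False
        then have "fst x \<notin> {-R<..<R} \<or> snd x \<notin> W" using that(1) by (auto simp: cyl_def mem_Times_iff)
        then have "f (fst x) = 0 \<or> F (s, x) = 0" using that(4) that(5)[of "(s, x)"] by (auto simp: strip_def mem_Times_iff)
        then show ?thesis by auto
      qed simp
    qed
  qed
  \<comment> \<open>Natural heights \<open>T\<close> reach every negative time and leave only
    countably many exceptional sets to unite.\<close>
  have "AE s in lborel. \<forall>T::nat. sq_int (\<lambda>x. indicator (cyl W (real (Suc T)) R) (s, x) * u (s, x))"
    unfolding AE_all_countable using R(1) by (intro allI sq_int_slice sq_u) auto
  moreover have "AE s in lborel. \<forall>i\<in>Basis. \<forall>T::nat. sq_int (\<lambda>x. indicator (cyl W (real (Suc T)) R) (s, x) * D i (s, x))"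
    using R(1) by (intro AE_finite_allI) (auto simp: AE_all_countable intro!: sq_int_slice sq_D)
  \<comment> \<open>The weak derivative of \<open>u\<close> on the slice is tested with
    \<open>\<psi> \<eta>\<close>; by the product rule this says that the slice of \<open>G\<close>
    is the weak derivative of \<open>\<psi> u\<close>. Countability of \<open>box_bumps\<close>
    permits the quantifier over \<open>\<eta>\<close> under the almost everywhere.\<close>
  moreover have "AE s in lborel. \<forall>i\<in>Basis. \<forall>\<eta>\<in>box_bumps ?S. s < 0 \<longrightarrow>
      (LINT x|lborel. u (s, x) * pderiv_dir i (\<lambda>x. \<psi> (fst x) * \<eta> x) x + D i (s, x) * (\<psi> (fst x) * \<eta> x)) = 0"
  proof (rule AE_finite_allI)
    fix i :: "'n space" assume i: "i \<in> Basis"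
    show "AE s in lborel. \<forall>\<eta>\<in>box_bumps ?S. s < 0 \<longrightarrow>
      (LINT x|lborel. u (s, x) * pderiv_dir i (\<lambda>x. \<psi> (fst x) * \<eta> x) x + D i (s, x) * (\<psi> (fst x) * \<eta> x)) = 0"
      unfolding AE_ball_countable[OF countable_box_bumps]
    proof
      fix \<eta> assume "\<eta> \<in> box_bumps ?S"
      then have "\<eta> \<in> Cc_inf ?S" using box_bumps_Cc_inf by blast
      then show "AE s in lborel. s < 0 \<longrightarrow>
        (LINT x|lborel. u (s, x) * pderiv_dir i (\<lambda>x. \<psi> (fst x) * \<eta> x) x + D i (s, x) * (\<psi> (fst x) * \<eta> x)) = 0"
        using i by (intro slice_weak_deriv[where S="?S"] u D lu lD wd Cc_inf_mult[OF _ s\<psi>f])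
    qed
  qed simp
  moreover have "AE s in lborel. s \<in> {..<0} \<longrightarrow> (\<lambda>x. \<psi> (fst x) * u0 (s, x)) \<in> W12_0 ?S"
    using bd \<psi> by (auto simp: vanishes_on_boundary_def AE_lebesgue_on_iff)
  ultimately show ?thesis using AE_slices[OF u(2)]
  proof eventually_elim
    case (elim s)
    show ?case
    proof
      assume s: "s < 0"
      obtain T :: nat where "- s < real (Suc T)" using reals_Archimedean2[of "- s"] by (metis less_trans of_nat_less_iff lessI)
      with s have sT: "s \<in> {- real (Suc T)<..<0}" by auto
      define v where "v x = \<psi> (fst x) * u (s, x)" for x
      have sv: "sq_int v"
        unfolding v_def by (rule mult[OF sT _ \<psi> R(2) u(3)]) (use elim(1) in auto)
      have sG: "sq_int (\<lambda>x. G i (s, x))" if i: "i \<in> Basis" for i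
      proof -
        have "sq_int (\<lambda>x. \<psi> (fst x) * D i (s, x))" by (rule mult[OF sT _ \<psi> R(2) D(2)[OF i]]) (use elim(2) i in auto)
        moreover have "sq_int (\<lambda>x. pderiv_dir (fst i) \<psi> (fst x) * u (s, x))"
          by (rule mult[OF sT _ d\<psi>[OF i] R(3) u(3)]) (use elim(1) in auto)
        ultimately show ?thesis unfolding G_def by (simp add: sq_int_add)
      qed
      have G0: "G i (s, x) = 0" "v x = 0" if "x \<notin> ?S" "i \<in> Basis" for x i
        using that D(2)[of i "(s, x)"] u(3)[of "(s, x)"] by (auto simp: G_def v_def)
      have vae: "AE x in lborel. x \<in> ?S \<longrightarrow> v x = \<psi> (fst x) * u0 (s, x)"
        using elim(5) by eventually_elim (use s in \<open>auto simp: v_def\<close>)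
      from elim(4) s have "(\<lambda>x. \<psi> (fst x) * u0 (s, x)) \<in> W12_0 ?S" by simp
      then obtain g \<phi> where g: "\<And>i. i \<in> Basis \<Longrightarrow> g i \<in> L2 ?S \<and> has_weak_deriv ?S (\<lambda>x. \<psi> (fst x) * u0 (s, x)) i (g i)"
        and \<phi>: "\<And>k. \<phi> k \<in> Cc_inf ?S" and lim: "(\<lambda>k. (LINT x|lebesgue_on ?S. (\<phi> k x - \<psi> (fst x) * u0 (s, x))\<^sup>2) +
              (\<Sum>i\<in>Basis. LINT x|lebesgue_on ?S. (pderiv_dir i (\<phi> k) x - g i x)\<^sup>2)) \<longlonglongrightarrow> 0"
        unfolding W12_0_def by blast
      have mv: "v \<in> borel_measurable borel" by (rule sq_intD(1)[OF sv])
      have \<phi>0: "\<phi> k x = 0" "pderiv_dir w (\<phi> k) x = 0" if "x \<notin> ?S" for k x w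
        using Cc_infE[OF \<phi>[of k]] that by (metis subsetD)+
      have e1: "(LINT x|lebesgue_on ?S. (\<phi> k x - \<psi> (fst x) * u0 (s, x))\<^sup>2) = (LINT x|lborel. (\<phi> k x - v x)\<^sup>2)" for k
      proof (rule LINT_rep)
        show "(\<lambda>x. (\<phi> k x - v x)\<^sup>2) \<in> borel_measurable borel"
          using smooth_borel_measurable[OF Cc_inf_smooth[OF \<phi>[of k]]] mv by simp
        show "AE x in lborel. x \<in> ?S \<longrightarrow> (\<phi> k x - v x)\<^sup>2 = (\<phi> k x - \<psi> (fst x) * u0 (s, x))\<^sup>2"
          using vae by eventually_elim auto
        show "(\<phi> k x - v x)\<^sup>2 = 0" if "x \<notin> ?S" for x using \<phi>0[OF that] G0(2)[OF that SOME_Basis] by simp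
      qed (use S in auto)
      have e2: "(LINT x|lebesgue_on ?S. (pderiv_dir i (\<phi> k) x - g i x)\<^sup>2) = (LINT x|lborel. (pderiv_dir i (\<phi> k) x - G i (s, x))\<^sup>2)"
        if i: "i \<in> Basis" for i k
      proof (rule LINT_rep)
        have mG: "(\<lambda>x. G i (s, x)) \<in> borel_measurable borel" by (rule sq_intD(1)[OF sG[OF i]])
        show "(\<lambda>x. (pderiv_dir i (\<phi> k) x - G i (s, x))\<^sup>2) \<in> borel_measurable borel"
          using smooth_borel_measurable[OF Cc_inf_smooth[OF Cc_inf_pderiv[OF \<phi>[of k] i]]] mG by simp
        have li: "locally_integrable ?S (g i)" using g[OF i] by (simp add: has_weak_deriv_def)
        obtain g' where g': "g' \<in> borel_measurable borel" "AE x in lborel. x \<in> ?S \<longrightarrow> g' x = g i x" "\<And>x. x \<notin> ?S \<Longrightarrow> g' x = 0"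
          "\<And>K. compact K \<Longrightarrow> K \<subseteq> ?S \<Longrightarrow> integrable lborel (\<lambda>x. indicator K x * g' x)"
          by (rule locally_integrable_rep[OF S li]) blast
        have "AE x in lborel. x \<in> ?S \<longrightarrow> g' x = G i (s, x)"
        proof (rule weak_deriv_unique[OF S g'(1) g'(4) mG])
          show "integrable lborel (\<lambda>x. indicator K x * G i (s, x))" if K: "compact K" for K
          proof -
            have "sq_int (indicator K :: 'n space \<Rightarrow> real)"
              by (rule sq_int_bounded_support[of _ 1 K]) (use K borel_compact[OF K] compact_imp_bounded[OF K] in \<open>auto simp: indicator_def\<close>)
            from integrable_mult_sq[OF this sG[OF i]] show ?thesis .
          qed
          fix \<eta> assume \<eta>: "\<eta> \<in> box_bumps ?S"
          then have c: "\<eta> \<in> Cc_inf ?S" using box_bumps_Cc_inf by blast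
          have s\<eta>: "sq_int \<eta>" "sq_int (pderiv_dir i \<eta>)"
            by (rule sq_int_Cc_inf[OF c], rule sq_int_Cc_inf[OF Cc_inf_pderiv[OF c i]])
          have d: "pderiv_dir i (\<lambda>x. \<psi> (fst x) * \<eta> x) x = \<psi> (fst x) * pderiv_dir i \<eta> x + pderiv_dir (fst i) \<psi> (fst x) * \<eta> x" for x
            by (simp add: pderiv_dir_mult[OF s\<psi>f Cc_inf_smooth[OF c]] pderiv_dir_fst[OF s\<psi>])
          have "0 = (LINT x|lborel. u (s, x) * pderiv_dir i (\<lambda>x. \<psi> (fst x) * \<eta> x) x + D i (s, x) * (\<psi> (fst x) * \<eta> x))"
            using elim(3) i \<eta> s by simp
          also have "\<dots> = (LINT x|lborel. v x * pderiv_dir i \<eta> x + G i (s, x) * \<eta> x)"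
            unfolding d by (simp add: v_def G_def algebra_simps)
          also have "\<dots> = (LINT x|lborel. v x * pderiv_dir i \<eta> x) + (LINT x|lborel. G i (s, x) * \<eta> x)"
            by (intro Bochner_Integration.integral_add integrable_mult_sq sv sG i s\<eta>)
          also have "(LINT x|lborel. v x * pderiv_dir i \<eta> x) = - (LINT x|lborel. g' x * \<eta> x)"
            by (rule weak_deriv_rep[OF conjunct2[OF g[OF i]] S i mv vae _ g'(1-3) c]) (use G0(2) i in auto)
          finally show "(LINT x|lborel. g' x * \<eta> x) = (LINT x|lborel. G i (s, x) * \<eta> x)" by simp
        qed
        with g'(2) show "AE x in lborel. x \<in> ?S \<longrightarrow> (pderiv_dir i (\<phi> k) x - G i (s, x))\<^sup>2 = (pderiv_dir i (\<phi> k) x - g i x)\<^sup>2"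
          by eventually_elim auto
        show "(pderiv_dir i (\<phi> k) x - G i (s, x))\<^sup>2 = 0" if "x \<notin> ?S" for x using \<phi>0[OF that] G0(1)[OF that i] by simp
      qed (use S in auto)
      have lim': "(\<lambda>k. (LINT x|lborel. (\<phi> k x - v x)\<^sup>2) + (\<Sum>i\<in>Basis. LINT x|lborel. (pderiv_dir i (\<phi> k) x - G i (s, x))\<^sup>2)) \<longlonglongrightarrow> 0"
        using lim by (simp add: e1 e2)
      note l = tendsto_0_of_sum[OF lim' finite_Basis]
      show "\<exists>\<phi>. (\<forall>k. \<phi> k \<in> Cc_inf ?S) \<and>
        (\<lambda>k. LINT x|lborel. (\<phi> k x - \<psi> (fst x) * u (s, x))\<^sup>2) \<longlonglongrightarrow> 0 \<and>
        (\<forall>i\<in>Basis. (\<lambda>k. LINT x|lborel. (pderiv_dir i (\<phi> k) x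
             - (\<psi> (fst x) * D i (s, x) + pderiv_dir (fst i) \<psi> (fst x) * u (s, x)))\<^sup>2) \<longlonglongrightarrow> 0)"
      proof (intro exI[of _ \<phi>] conjI allI ballI)
        show "\<phi> k \<in> Cc_inf ?S" for k by (rule \<phi>)
        show "(\<lambda>k. LINT x|lborel. (\<phi> k x - \<psi> (fst x) * u (s, x))\<^sup>2) \<longlonglongrightarrow> 0"
          using l(1) by (simp add: v_def integral_nonneg_AE)
        show "(\<lambda>k. LINT x|lborel. (pderiv_dir i (\<phi> k) x
             - (\<psi> (fst x) * D i (s, x) + pderiv_dir (fst i) \<psi> (fst x) * u (s, x)))\<^sup>2) \<longlonglongrightarrow> 0" if "i \<in> Basis" for i
          using l(2)[OF _ _ that] by (simp add: G_def integral_nonneg_AE)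
      qed
    qed
  qed
qed

text \<open>All data are changed on null sets so as to fit the locale, and the time derivative is
  moved onto the test function. Coefficients become 0 where a requirement fails; this respects the
  bounds but not ellipticity, which therefore remains an almost everywhere statement on the
  strip.\<close>

lemma strip_solution_exists:
  fixes W :: "(real ^ 'n::finite) set"
  assumes W: "open W" "bounded W" and lam: "lam > 0" "lam < \<Lambda>" and eps: "eps \<ge> 0"
    and adm: "admissible_coeffs lam \<Lambda> eps (strip W) a b c"
    and loc: "u \<in> W12_loc W" and sol: "weak_solution W a b c u" and bd: "vanishes_on_boundary W u"
  obtains Kc a' b' c' u' D where "strip_solution W lam \<Lambda> eps Kc a' b' c' u' D"
    "AE z in lborel. z \<in> {..<0} \<times> strip W \<longrightarrow> u' z = u z" "\<And>z. z \<notin> {..<0} \<times> strip W \<Longrightarrow> u' z = 0"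
proof -
  let ?S = "strip W" and ?Q = "{..<0::real} \<times> strip W"
  have S: "open ?S" unfolding strip_def using W by (intro open_Times) auto
  have Q: "open ?Q" using S by (intro open_Times) auto
  have cylQ: "cyl W T R \<subseteq> ?Q" for T R by (auto simp: cyl_def strip_def)
  have e0: "(1, 0) \<in> (Basis :: (real \<times> 'n space) set)" by (auto simp: Basis_prod_def)

  from sol obtain ut Du where
    wt: "has_weak_deriv ?Q u (1, 0) ut" and wD: "\<And>i. i \<in> Basis \<Longrightarrow> has_weak_deriv ?Q u (0, i) (Du i)"
    and weq: "\<And>\<eta>. \<eta> \<in> Cc_inf ?Q \<Longrightarrow> (LINT (t, x)|lebesgue_on ?Q.
               ut (t, x) * \<eta> (t, x)
             + (\<Sum>i\<in>Basis. \<Sum>j\<in>Basis. a i j x * Du j (t, x) * pderiv_dir (0, i) \<eta> (t, x))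
             - (\<Sum>i\<in>Basis. b i x * Du i (t, x) * \<eta> (t, x))
             - c x * u (t, x) * \<eta> (t, x)) = 0"
    unfolding weak_solution_def by blast

  define rep where "rep f g \<longleftrightarrow> g \<in> borel_measurable borel \<and> (AE z in lborel. z \<in> ?Q \<longrightarrow> g z = f z) \<and> (\<forall>z. z \<notin> ?Q \<longrightarrow> g z = 0)
      \<and> (\<forall>K. compact K \<and> K \<subseteq> ?Q \<longrightarrow> integrable lborel (\<lambda>z. indicator K z * g z))" for f g :: "real \<times> 'n space \<Rightarrow> real"
  have ex_rep: "\<exists>g. rep f g" if "locally_integrable ?Q f" for f
    by (rule locally_integrable_rep[OF Q that]) (auto simp: rep_def)
  obtain u' where u': "rep u u'" using ex_rep[of u] wt by (auto simp: has_weak_deriv_def)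
  obtain w where w: "rep ut w" using ex_rep[of ut] wt by (auto simp: has_weak_deriv_def)
  have "\<forall>i\<in>Basis. \<exists>g. rep (Du i) g" using ex_rep wD by (auto simp: has_weak_deriv_def)
  then obtain D where "\<forall>i\<in>Basis. rep (Du i) (D i)" by (rule bchoice[THEN exE])
  then have D: "rep (Du i) (D i)" if "i \<in> Basis" for i using that by blast
  have repD: "g \<in> borel_measurable borel" "AE z in lborel. z \<in> ?Q \<longrightarrow> g z = f z" "z \<notin> ?Q \<Longrightarrow> g z = 0"
    "compact K \<Longrightarrow> K \<subseteq> ?Q \<Longrightarrow> integrable lborel (\<lambda>z. indicator K z * g z)"
    if "rep f g" for f g z K
    using that unfolding rep_def by blast+

  have wDD: "(LINT z|lborel. u' z * pderiv_dir (0, i) \<eta> z) = - (LINT z|lborel. D i z * \<eta> z)"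
    if "i \<in> Basis" "\<eta> \<in> Cc_inf ?Q" for i \<eta>
    by (rule weak_deriv_rep[OF wD[OF that(1)] Q Pair_0_Basis[OF that(1)] repD(1-3)[OF u'] repD(1-3)[OF D[OF that(1)]] that(2)])
  have wtt: "(LINT z|lborel. u' z * pderiv_dir (1, 0) \<eta> z) = - (LINT z|lborel. w z * \<eta> z)"
    if "\<eta> \<in> Cc_inf ?Q" for \<eta>
    by (rule weak_deriv_rep[OF wt Q e0 repD(1-3)[OF u'] repD(1-3)[OF w] that])

  have sq_u: "sq_int (\<lambda>z. indicator (cyl W T R) z * u' z)" if "T > 0" "R > 0" for T R
  proof (rule sq_int_rep)
    show "u \<in> L2 (cyl W T R)" using loc that by (auto simp: W12_loc_def W12_def cyl_def)
    show "(\<lambda>z. indicator (cyl W T R) z * u' z) \<in> borel_measurable borel"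
      using repD(1)[OF u'] open_cyl[OF W(1)] by (intro borel_measurable_times borel_measurable_indicator) auto
    show "AE z in lborel. z \<in> cyl W T R \<longrightarrow> indicator (cyl W T R) z * u' z = u z"
      using repD(2)[OF u'] by eventually_elim (use cylQ in auto)
  qed (use open_cyl[OF W(1)] in auto)
  \<comment> \<open>\<open>Du i\<close> is only known to be locally integrable. On a cylinder
    \<open>W12_loc\<close> supplies a square integrable weak derivative, and by uniqueness the two
    agree there almost everywhere.\<close>
  have sq_D: "sq_int (\<lambda>z. indicator (cyl W T R) z * D i z)" if TR: "T > 0" "R > 0" and i: "i \<in> Basis" for T R i
  proof -
    let ?C = "cyl W T R"
    have C: "open ?C" by (rule open_cyl[OF W(1)])
    have "u \<in> W12 ?C" using loc TR by (auto simp: W12_loc_def cyl_def)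
    then obtain g where g: "g \<in> L2 ?C" "has_weak_deriv ?C u (0, i) g"
      unfolding W12_def using Pair_0_Basis[OF i] by blast
    have li: "locally_integrable ?C g" using g by (simp add: has_weak_deriv_def)
    obtain g' where g': "g' \<in> borel_measurable borel" "AE x in lborel. x \<in> ?C \<longrightarrow> g' x = g x" "\<And>x. x \<notin> ?C \<Longrightarrow> g' x = 0"
      "\<And>K. compact K \<Longrightarrow> K \<subseteq> ?C \<Longrightarrow> integrable lborel (\<lambda>x. indicator K x * g' x)"
      by (rule locally_integrable_rep[OF C li]) blast
    have mD: "D i \<in> borel_measurable borel" by (rule repD(1)[OF D[OF i]])
    have "AE z in lborel. z \<in> ?C \<longrightarrow> D i z = g' z"
    proof (rule weak_deriv_unique[OF C mD _ g'(1,4)])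
      show "integrable lborel (\<lambda>z. indicator K z * D i z)" if "compact K" "K \<subseteq> ?C" for K
        by (rule repD(4)[OF D[OF i] that(1) subset_trans[OF that(2) cylQ]])
      fix \<eta> assume "\<eta> \<in> box_bumps ?C"
      then have c: "\<eta> \<in> Cc_inf ?C" using box_bumps_Cc_inf by blast
      have cQ: "\<eta> \<in> Cc_inf ?Q" by (rule Cc_inf_mono[OF cylQ c])
      obtain L where L: "L \<subseteq> ?C" "\<And>v x. x \<notin> L \<Longrightarrow> pderiv_dir v \<eta> x = 0" using Cc_infE[OF c] by metis
      have "(LINT z|lborel. indicator ?C z * u' z * pderiv_dir (0, i) \<eta> z) = - (LINT z|lborel. g' z * \<eta> z)"
      proof (rule weak_deriv_rep[OF g(2) C Pair_0_Basis[OF i] _ _ _ g'(1-3) c])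
        show "(\<lambda>z. indicator ?C z * u' z) \<in> borel_measurable borel"
          using repD(1)[OF u'] C by (intro borel_measurable_times borel_measurable_indicator) auto
        show "AE z in lborel. z \<in> ?C \<longrightarrow> indicator ?C z * u' z = u z"
          using repD(2)[OF u'] by eventually_elim (use cylQ in auto)
      qed auto
      also have "(\<lambda>z. indicator ?C z * u' z * pderiv_dir (0, i) \<eta> z) = (\<lambda>z. u' z * pderiv_dir (0, i) \<eta> z)"
      proof
        fix z
        show "indicator ?C z * u' z * pderiv_dir (0, i) \<eta> z = u' z * pderiv_dir (0, i) \<eta> z"
          using L(1) L(2)[of z "(0, i)"] by (cases "z \<in> ?C") auto
      qed
      finally show "(LINT z|lborel. D i z * \<eta> z) = (LINT z|lborel. g' z * \<eta> z)" using wDD[OF i cQ] by simp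
    qed
    then have "AE z in lborel. g' z = indicator ?C z * D i z"
      by eventually_elim (use g'(3) in \<open>auto simp: indicator_def\<close>)
    then have ae: "AE z in lborel. (g' z)\<^sup>2 = (indicator ?C z * D i z)\<^sup>2" by eventually_elim simp
    have m: "(\<lambda>z. indicator ?C z * D i z) \<in> borel_measurable borel"
      using mD C by (intro borel_measurable_times borel_measurable_indicator) auto
    have "sq_int g'" by (rule sq_int_rep[OF g(1) _ g'(1-3)]) (use C in auto)
    then have "integrable lborel (\<lambda>z. (indicator ?C z * D i z)\<^sup>2)"
      using m ae by (intro integrable_cong_AE_imp[OF sq_intD(2)]) auto
    then show ?thesis using m by (simp add: sq_int_def)
  qed

  obtain K where K: "AE x in lborel. x \<in> ?S \<longrightarrow> \<bar>c x\<bar> \<le> K"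
    using adm S by (auto simp: admissible_coeffs_def AE_lebesgue_on_iff)
  have ell: "AE x in lborel. x \<in> ?S \<longrightarrow>
        (\<forall>\<xi>. lam * (norm \<xi>)\<^sup>2 \<le> (\<Sum>i\<in>Basis. \<Sum>j\<in>Basis. a i j x * (\<xi> \<bullet> i) * (\<xi> \<bullet> j))) \<and>
        (\<forall>i\<in>Basis. \<forall>j\<in>Basis. \<bar>a i j x\<bar> \<le> \<Lambda>) \<and> (\<forall>i\<in>Basis. \<bar>b i x\<bar> \<le> sqrt eps) \<and> c x \<le> eps"
    using adm S by (auto simp: admissible_coeffs_def AE_lebesgue_on_iff)
  have ex: "\<exists>g. g \<in> borel_measurable borel \<and> (AE x in lborel. x \<in> ?S \<longrightarrow> g x = f x)"
    if "f \<in> borel_measurable (lebesgue_on ?S)" for f :: "'n space \<Rightarrow> real"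
    by (rule borel_rep[OF that]) (use S in auto)
  have "\<forall>p\<in>Basis \<times> Basis. \<exists>g. g \<in> borel_measurable borel \<and> (AE x in lborel. x \<in> ?S \<longrightarrow> g x = a (fst p) (snd p) x)"
    using adm by (auto simp: admissible_coeffs_def intro!: ex)
  then obtain a2 where a2: "\<forall>p\<in>Basis \<times> Basis. a2 p \<in> borel_measurable borel \<and> (AE x in lborel. x \<in> ?S \<longrightarrow> a2 p x = a (fst p) (snd p) x)"
    by (rule bchoice[THEN exE])
  have "\<forall>i\<in>Basis. \<exists>g. g \<in> borel_measurable borel \<and> (AE x in lborel. x \<in> ?S \<longrightarrow> g x = b i x)"
    using adm by (auto simp: admissible_coeffs_def intro!: ex)
  then obtain b2 where b2: "\<forall>i\<in>Basis. b2 i \<in> borel_measurable borel \<and> (AE x in lborel. x \<in> ?S \<longrightarrow> b2 i x = b i x)"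
    by (rule bchoice[THEN exE])
  obtain c2 where c2: "c2 \<in> borel_measurable borel" "AE x in lborel. x \<in> ?S \<longrightarrow> c2 x = c x"
    using ex[of c] adm by (auto simp: admissible_coeffs_def)
  \<comment> \<open>All pointwise requirements are bundled, so that a single Borel null set
    \<open>N\<close> contains every point of the strip where one of them fails.\<close>
  define good where "good x \<longleftrightarrow> (\<forall>p\<in>Basis \<times> Basis. a2 p x = a (fst p) (snd p) x) \<and> (\<forall>i\<in>Basis. b2 i x = b i x) \<and> c2 x = c x
     \<and> \<bar>c x\<bar> \<le> K \<and> (\<forall>\<xi>. lam * (norm \<xi>)\<^sup>2 \<le> (\<Sum>i\<in>Basis. \<Sum>j\<in>Basis. a i j x * (\<xi> \<bullet> i) * (\<xi> \<bullet> j))) \<and>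
        (\<forall>i\<in>Basis. \<forall>j\<in>Basis. \<bar>a i j x\<bar> \<le> \<Lambda>) \<and> (\<forall>i\<in>Basis. \<bar>b i x\<bar> \<le> sqrt eps) \<and> c x \<le> eps" for x
  have "AE x in lborel. \<forall>p\<in>Basis \<times> Basis. x \<in> ?S \<longrightarrow> a2 p x = a (fst p) (snd p) x"
    by (rule AE_finite_allI) (use a2 in auto)
  moreover have "AE x in lborel. \<forall>i\<in>Basis. x \<in> ?S \<longrightarrow> b2 i x = b i x"
    by (rule AE_finite_allI) (use b2 in auto)
  ultimately have ae_good: "AE x in lborel. x \<in> ?S \<longrightarrow> good x"
    using c2(2) K ell unfolding good_def by eventually_elim blast
  obtain N where N: "N \<in> sets borel" "emeasure lborel N = 0" "\<And>x. x \<in> ?S \<Longrightarrow> x \<notin> N \<Longrightarrow> good x"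
  proof -
    obtain N where "{x \<in> space lborel. \<not> (x \<in> ?S \<longrightarrow> good x)} \<subseteq> N" "emeasure lborel N = 0" "N \<in> sets lborel"
      by (rule AE_E[OF ae_good])
    then show ?thesis using that[of N] by auto
  qed
  define Gd where "Gd = ?S - N"
  have Gd: "Gd \<in> sets borel" "\<And>x. x \<in> Gd \<Longrightarrow> good x" using N S by (auto simp: Gd_def)
  have aeG: "AE x in lborel. x \<in> ?S \<longrightarrow> x \<in> Gd"
    by (rule AE_I[of _ _ N]) (use N in \<open>auto simp: Gd_def\<close>)
  \<comment> \<open>The value 0 off \<open>Gd\<close> satisfies every bound because
    \<open>\<Lambda>\<close> and \<open>eps\<close> are nonnegative.\<close>
  define a' where "a' i j x = indicator Gd x * a2 (i, j) x" for i j x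
  define b' where "b' i x = indicator Gd x * b2 i x" for i x
  define c' where "c' x = indicator Gd x * c2 x" for x
  have coef: "AE x in lborel. x \<in> ?S \<longrightarrow> (\<forall>i\<in>Basis. \<forall>j\<in>Basis. a' i j x = a i j x) \<and> (\<forall>i\<in>Basis. b' i x = b i x) \<and> c' x = c x"
    using aeG by eventually_elim (use Gd(2) in \<open>auto simp: a'_def b'_def c'_def good_def\<close>)
  have ma: "a' i j \<in> borel_measurable borel" if "i \<in> Basis" "j \<in> Basis" for i j
    unfolding a'_def using a2 that Gd by (intro borel_measurable_times borel_measurable_indicator) auto
  have mb: "b' i \<in> borel_measurable borel" if "i \<in> Basis" for i
    unfolding b'_def using b2 that Gd by (intro borel_measurable_times borel_measurable_indicator) auto
  have mc: "c' \<in> borel_measurable borel"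
    unfolding c'_def using c2 Gd by (intro borel_measurable_times borel_measurable_indicator) auto
  have ba: "\<bar>a' i j x\<bar> \<le> \<Lambda>" if "i \<in> Basis" "j \<in> Basis" for i j x
    using Gd(2)[of x] that lam by (cases "x \<in> Gd") (auto simp: a'_def good_def)
  have bb: "\<bar>b' i x\<bar> \<le> sqrt eps" if "i \<in> Basis" for i x
    using Gd(2)[of x] that eps by (cases "x \<in> Gd") (auto simp: b'_def good_def)
  have bc: "\<bar>c' x\<bar> \<le> max K 0" "c' x \<le> eps" for x
    using Gd(2)[of x] eps by (cases "x \<in> Gd"; auto simp: c'_def good_def)+

  have weak_eq: "(LINT z|lborel. - (u' z * pderiv_dir (1, 0) \<eta> z)
         + (\<Sum>i\<in>Basis. \<Sum>j\<in>Basis. a' i j (snd z) * D j z * pderiv_dir (0, i) \<eta> z)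
         - (\<Sum>i\<in>Basis. b' i (snd z) * D i z * \<eta> z) - c' (snd z) * u' z * \<eta> z) = 0" (is "(LINT z|lborel. - ?U z + ?A z - ?B z - ?Cc z) = 0")
    if \<eta>: "\<eta> \<in> Cc_inf ?Q" for \<eta>
  proof -
    note s\<eta> = Cc_inf_smooth[OF \<eta>]
    have m\<eta>: "\<eta> \<in> borel_measurable borel" "\<And>v. v \<in> Basis \<Longrightarrow> pderiv_dir v \<eta> \<in> borel_measurable borel"
      using smooth_borel_measurable smooth_pderiv_Basis[OF s\<eta>] s\<eta> by auto
    obtain L where L: "compact L" "L \<subseteq> ?Q" "\<And>x. x \<notin> L \<Longrightarrow> \<eta> x = 0" "\<And>v x. x \<notin> L \<Longrightarrow> pderiv_dir v \<eta> x = 0"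
      using Cc_infE[OF \<eta>] by metis
    have i1: "integrable lborel (\<lambda>z. g z * \<eta> z)" "v \<in> Basis \<Longrightarrow> integrable lborel (\<lambda>z. g z * pderiv_dir v \<eta> z)"
      if "rep f g" for f g v
    proof -
      have gg: "g \<in> borel_measurable borel" "integrable lborel (\<lambda>z. indicator L z * g z)"
        by (rule repD(1)[OF that], rule repD(4)[OF that L(1,2)])
      show "integrable lborel (\<lambda>z. g z * \<eta> z)"
        by (rule integrable_mult_compact[OF gg smooth_continuous[OF s\<eta>] L(1,3)])
      show "integrable lborel (\<lambda>z. g z * pderiv_dir v \<eta> z)" if "v \<in> Basis"
        by (rule integrable_mult_compact[OF gg smooth_continuous[OF smooth_pderiv_Basis[OF s\<eta> that]] L(1,4)])
    qed
    have bd: "integrable lborel (\<lambda>z. k (snd z) * f z)" if "k \<in> borel_measurable borel" "\<And>x. \<bar>k x\<bar> \<le> B" "integrable lborel f"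
      for k :: "'n space \<Rightarrow> real" and B and f :: "real \<times> 'n space \<Rightarrow> real"
    proof (rule Bochner_Integration.integrable_bound)
      show "integrable lborel (\<lambda>z. B * f z)" using that(3) by simp
      show "(\<lambda>z. k (snd z) * f z) \<in> borel_measurable lborel"
        using measurable_snd_borel[OF that(1), where 'a=real] that(3) by auto
      have "\<bar>k (snd z)\<bar> * \<bar>f z\<bar> \<le> \<bar>B\<bar> * \<bar>f z\<bar>" for z using that(2)[of "snd z"] by (intro mult_right_mono) auto
      then show "AE z in lborel. norm (k (snd z) * f z) \<le> norm (B * f z)" by (simp add: abs_mult)
    qed
    have iU: "integrable lborel ?U" by (rule i1(2)[OF u' e0])
    have iA: "integrable lborel ?A"
    proof (intro Bochner_Integration.integrable_sum)
      fix i j :: "'n space" assume "i \<in> Basis" "j \<in> Basis"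
      then show "integrable lborel (\<lambda>z. a' i j (snd z) * D j z * pderiv_dir (0, i) \<eta> z)"
        using bd[OF ma ba i1(2)[OF D Pair_0_Basis]] by (simp add: mult.assoc)
    qed
    have iB: "integrable lborel ?B"
    proof (intro Bochner_Integration.integrable_sum)
      fix i :: "'n space" assume "i \<in> Basis"
      then show "integrable lborel (\<lambda>z. b' i (snd z) * D i z * \<eta> z)"
        using bd[OF mb bb i1(1)[OF D]] by (simp add: mult.assoc)
    qed
    have iC: "integrable lborel ?Cc" using bd[OF mc bc(1) i1(1)[OF u']] by (simp add: mult.assoc)
    have iw: "integrable lborel (\<lambda>z. w z * \<eta> z)" by (rule i1(1)[OF w])
    let ?F = "\<lambda>z. ut z * \<eta> z + (\<Sum>i\<in>Basis. \<Sum>j\<in>Basis. a i j (snd z) * Du j z * pderiv_dir (0, i) \<eta> z)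
             - (\<Sum>i\<in>Basis. b i (snd z) * Du i z * \<eta> z) - c (snd z) * u z * \<eta> z"
    \<comment> \<open>The equation is first rewritten with Borel data and with \<open>w\<close> as
      time derivative; \<open>wtt\<close> then moves that derivative onto
      \<open>\<eta>\<close>.\<close>
    have "(LINT z|lebesgue_on ?Q. ?F z) = (LINT z|lborel. w z * \<eta> z + ?A z - ?B z - ?Cc z)"
    proof (rule LINT_rep)
      show "(\<lambda>z. w z * \<eta> z + ?A z - ?B z - ?Cc z) \<in> borel_measurable borel"
        using borel_measurable_integrable[OF iw] borel_measurable_integrable[OF iA] borel_measurable_integrable[OF iB] borel_measurable_integrable[OF iC]
        by simp
      have "AE z in lborel. \<forall>i\<in>Basis. z \<in> ?Q \<longrightarrow> D i z = Du i z"
        by (rule AE_finite_allI) (auto intro: repD(2)[OF D, THEN eventually_mono])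
      moreover note repD(2)[OF u'] repD(2)[OF w]
      ultimately show "AE z in lborel. z \<in> ?Q \<longrightarrow> w z * \<eta> z + ?A z - ?B z - ?Cc z = ?F z"
        using AE_lborel_snd[OF coef]
      proof eventually_elim
        case (elim z)
        show ?case
        proof
          assume z: "z \<in> ?Q"
          then have "snd z \<in> ?S" by auto
          with elim(4) have c: "\<And>i j. i \<in> Basis \<Longrightarrow> j \<in> Basis \<Longrightarrow> a' i j (snd z) = a i j (snd z)"
            "\<And>i. i \<in> Basis \<Longrightarrow> b' i (snd z) = b i (snd z)" "c' (snd z) = c (snd z)" by auto
          have d: "\<And>i. i \<in> Basis \<Longrightarrow> D i z = Du i z" "u' z = u z" "w z = ut z" using elim(1-3) z by auto
          show "w z * \<eta> z + ?A z - ?B z - ?Cc z = ?F z"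
            using c d by simp
        qed
      qed
      show "w z * \<eta> z + ?A z - ?B z - ?Cc z = 0" if "z \<notin> ?Q" for z
      proof -
        have "z \<notin> L" using that L(2) by blast
        then show ?thesis using L(3,4) by simp
      qed
    qed (use Q in auto)
    moreover have "(LINT z|lebesgue_on ?Q. ?F z) = 0"
      using weq[OF \<eta>] by (simp add: case_prod_unfold)
    ultimately have "(LINT z|lborel. w z * \<eta> z) + (LINT z|lborel. ?A z) - (LINT z|lborel. ?B z) - (LINT z|lborel. ?Cc z) = 0"
      using iw iA iB iC by simp
    moreover have "(LINT z|lborel. - ?U z + ?A z - ?B z - ?Cc z) = - (LINT z|lborel. ?U z) + (LINT z|lborel. ?A z) - (LINT z|lborel. ?B z) - (LINT z|lborel. ?Cc z)"
      using iU iA iB iC by simp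
    ultimately show ?thesis using wtt[OF \<eta>] by simp
  qed

  have "strip_solution W lam \<Lambda> eps (max K 0) a' b' c' u' D"
  proof
    show "AE x in lborel. x \<in> ?S \<longrightarrow> (\<forall>\<xi>. lam * (norm \<xi>)\<^sup>2 \<le> (\<Sum>i\<in>Basis. \<Sum>j\<in>Basis. a' i j x * (\<xi> \<bullet> i) * (\<xi> \<bullet> j)))"
      using aeG coef
    proof eventually_elim
      case (elim x)
      show ?case
      proof
        assume "x \<in> ?S"
        with elim have "good x" and e: "\<And>i j. i \<in> Basis \<Longrightarrow> j \<in> Basis \<Longrightarrow> a' i j x = a i j x" using Gd(2) by auto
        then have "\<forall>\<xi>. lam * (norm \<xi>)\<^sup>2 \<le> (\<Sum>i\<in>Basis. \<Sum>j\<in>Basis. a i j x * (\<xi> \<bullet> i) * (\<xi> \<bullet> j))" by (simp add: good_def)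
        moreover have "(\<Sum>i\<in>Basis. \<Sum>j\<in>Basis. a i j x * (\<xi> \<bullet> i) * (\<xi> \<bullet> j)) = (\<Sum>i\<in>Basis. \<Sum>j\<in>Basis. a' i j x * (\<xi> \<bullet> i) * (\<xi> \<bullet> j))" for \<xi>
          by (intro sum.cong refl) (simp add: e)
        ultimately show "\<forall>\<xi>. lam * (norm \<xi>)\<^sup>2 \<le> (\<Sum>i\<in>Basis. \<Sum>j\<in>Basis. a' i j x * (\<xi> \<bullet> i) * (\<xi> \<bullet> j))" by simp
      qed
    qed
    show "AE s in lborel. s < 0 \<longrightarrow> (\<exists>\<phi>. (\<forall>k. \<phi> k \<in> Cc_inf ?S) \<and>
        (\<lambda>k. LINT x|lborel. (\<phi> k x - \<psi> (fst x) * u' (s, x))\<^sup>2) \<longlonglongrightarrow> 0 \<and>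
        (\<forall>i\<in>Basis. (\<lambda>k. LINT x|lborel. (pderiv_dir i (\<phi> k) x
             - (\<psi> (fst x) * D i (s, x) + pderiv_dir (fst i) \<psi> (fst x) * u' (s, x)))\<^sup>2) \<longlonglongrightarrow> 0))"
      if \<psi>: "\<psi> \<in> Cc_inf UNIV" for \<psi>
      by (rule boundary_slices[OF W(1) bd \<psi> repD(1-4)[OF u'] repD(1)[OF D] repD(3)[OF D] repD(4)[OF D] sq_u sq_D wDD])
  qed (fact W lam eps ma mb mc ba bb bc repD(1,3)[OF u'] repD(1)[OF D] repD(3)[OF D] sq_u sq_D wDD weak_eq)+
  then show ?thesis by (rule that) (fact repD(2,3)[OF u'])+
qed

section \<open>The two inclusions between \<open>P_space\<close> and \<open>ae_zero\<close>\<close>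

lemma emeasure_lborel_open_bounded:
  fixes W :: "'a::euclidean_space set"
  assumes "open W" "bounded W"
  shows "emeasure lborel W = ennreal (measure lebesgue W)"
proof -
  have "measure lebesgue W = measure lborel W" using assms by (intro measure_completion) auto
  then show ?thesis
    using emeasure_bounded_finite[OF assms(2)] by (simp add: emeasure_eq_ennreal_measure)
qed

text \<open>The growth bound and \<open>ae_zero\<close> refer to \<open>t \<le> 0\<close>, the
  equation to \<open>t < 0\<close>; the difference lies in the hyperplane \<open>t = 0\<close>, a
  null set.\<close>

lemma AE_past_iff:
  fixes S :: "'b::euclidean_space set"
  assumes S: "open S"
  shows "(AE z in lebesgue_on ({..0::real} \<times> S). P z) \<longleftrightarrow> (AE z in lborel. z \<in> {..<0} \<times> S \<longrightarrow> P z)"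
proof -
  have "{..0::real} \<times> S \<in> sets borel" unfolding borel_prod[symmetric] using S by (intro pair_measureI) auto
  then have "(AE z in lebesgue_on ({..0::real} \<times> S). P z) \<longleftrightarrow> (AE z in lborel. z \<in> {..0} \<times> S \<longrightarrow> P z)"
    by (rule AE_lebesgue_on_iff)
  also have "\<dots> \<longleftrightarrow> (AE z in lborel. z \<in> {..<0} \<times> S \<longrightarrow> P z)"
  proof -
    have "emeasure lborel ({0::real} \<times> (UNIV :: 'b set)) = 0"
      using lborel.emeasure_pair_measure_Times[of "{0::real}" lborel "UNIV :: 'b set"] by (simp add: lborel_prod)
    moreover have "{0::real} \<times> (UNIV :: 'b set) \<in> sets borel" unfolding borel_prod[symmetric] by (intro pair_measureI) auto
    ultimately have "AE z in lborel. z \<notin> {0::real} \<times> (UNIV :: 'b set)" by (intro AE_not_in) (auto simp: null_sets_def)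
    then have "AE z in (lborel :: (real \<times> 'b) measure). (z \<in> {..0} \<times> S \<longrightarrow> P z) = (z \<in> {..<0} \<times> S \<longrightarrow> P z)"
      by eventually_elim (auto simp: mem_Times_iff less_le)
    then show ?thesis by (auto elim: eventually_elim2)
  qed
  finally show ?thesis .
qed

text \<open>All derivatives and approximants can be taken to be 0. These facts give the inclusion of
  \<open>ae_zero\<close> in \<open>P_space\<close>, where representatives rather than classes have
  to be handled.\<close>

lemma
  fixes f :: "'a::euclidean_space \<Rightarrow> real"
  assumes U: "U \<in> sets borel" and f: "AE x in lborel. x \<in> U \<longrightarrow> f x = 0"
  shows locally_integrable_ae_zero: "locally_integrable U f"
    and L2_ae_zero: "f \<in> L2 U"
    and has_weak_deriv_ae_zero: "has_weak_deriv U f v (\<lambda>_. 0)"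
    and W12_ae_zero: "f \<in> W12 U"
    and W12_0_ae_zero: "f \<in> W12_0 U"
proof -
  have li: "locally_integrable U g" if g: "AE x in lborel. x \<in> U \<longrightarrow> g x = 0" for g :: "'a \<Rightarrow> real"
    unfolding locally_integrable_def
  proof (intro allI impI)
    fix K assume K: "compact K \<and> K \<subseteq> U"
    have "integrable (lebesgue_on K) g \<longleftrightarrow> integrable lborel (\<lambda>x::'a. 0::real)"
    proof (rule integrable_rep)
      show "AE x in lborel. x \<in> K \<longrightarrow> 0 = g x" using g by eventually_elim (use K in auto)
    qed (use K borel_compact in auto)
    then show "integrable (lebesgue_on K) g" by simp
  qed
  show lf: "locally_integrable U f" by (rule li[OF f])
  have L: "g \<in> L2 U" if g: "AE x in lborel. x \<in> U \<longrightarrow> g x = 0" for g :: "'a \<Rightarrow> real"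
  proof -
    have "integrable (lebesgue_on U) (\<lambda>x. (g x)\<^sup>2) \<longleftrightarrow> integrable lborel (\<lambda>x::'a. 0::real)"
      by (rule integrable_rep) (use U g in \<open>auto elim: eventually_mono\<close>)
    moreover have "g \<in> borel_measurable (lebesgue_on U)"
      by (rule measurable_rep[of "\<lambda>_. 0"]) (use U g in \<open>auto elim: eventually_mono\<close>)
    ultimately show ?thesis by (simp add: L2_def)
  qed
  show Lf: "f \<in> L2 U" by (rule L[OF f])
  have z: "(LINT x|lebesgue_on U. f x * h x) = 0" for h
  proof -
    have "(LINT x|lebesgue_on U. f x * h x) = (LINT x::'a|lborel. 0)"
      by (rule LINT_rep) (use U f in \<open>auto elim: eventually_mono\<close>)
    then show ?thesis by simp
  qed
  show wd: "has_weak_deriv U f v (\<lambda>_. 0)" for v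
    unfolding has_weak_deriv_def using lf li[of "\<lambda>_. 0"] z by simp
  show "f \<in> W12 U" unfolding W12_def using Lf wd L[of "\<lambda>_. 0"] by auto
  have d0: "pderiv_dir i (\<lambda>x::'a. 0) x = 0" for i x by (rule pderiv_dir_eq[THEN trans]) (auto intro: derivative_eq_intros)
  have "(LINT x|lebesgue_on U. (0 - f x)\<^sup>2) = 0" using z[of f] by (simp add: power2_eq_square)
  then have lim: "(\<lambda>k::nat. (LINT x|lebesgue_on U. ((\<lambda>_. 0) x - f x)\<^sup>2) +
              (\<Sum>i\<in>Basis. LINT x|lebesgue_on U. (pderiv_dir i (\<lambda>_. 0) x - 0)\<^sup>2)) \<longlonglongrightarrow> 0"
    by (simp add: d0)
  show "f \<in> W12_0 U"
    unfolding W12_0_def mem_Collect_eq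
  proof (intro conjI exI[of _ "\<lambda>_ _. 0"] ballI allI)
    show "(\<lambda>k::nat. (LINT x|lebesgue_on U. (0 - f x)\<^sup>2) +
              (\<Sum>i\<in>Basis. LINT x|lebesgue_on U. (pderiv_dir i (\<lambda>_. 0) x - 0)\<^sup>2)) \<longlonglongrightarrow> 0" using lim by simp
  qed (use Lf wd L[of "\<lambda>_. 0"] Cc_inf_zero in auto)
qed

lemma ae_zero_subset_P_space:
  fixes W :: "(real ^ 'n::finite) set"
  assumes W: "open W" and u: "u \<in> ae_zero W"
  shows "u \<in> P_space W a b c d"
proof -
  let ?S = "strip W" and ?Q = "{..<0::real} \<times> strip W"
  have S: "open ?S" unfolding strip_def using W by (intro open_Times) auto
  have Q: "open ?Q" using S by (intro open_Times) auto
  have u0: "AE z in lborel. z \<in> ?Q \<longrightarrow> u z = 0"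
    using u unfolding ae_zero_def mem_Collect_eq AE_past_iff[OF S] .
  have "u \<in> W12_loc W"
    unfolding W12_loc_def mem_Collect_eq
  proof (intro allI impI)
    fix T R :: real
    have C: "{-T<..<0} \<times> ({-R<..<R} \<times> W) \<subseteq> ?Q" by (auto simp: strip_def)
    have "open ({-T<..<0} \<times> ({-R<..<R} \<times> W))" using W by (intro open_Times) auto
    then show "u \<in> W12 ({-T<..<0} \<times> ({-R<..<R} \<times> W))"
      by (intro W12_ae_zero eventually_mono[OF u0]) (use C in auto)
  qed
  moreover have "weak_solution W a b c u"
    unfolding weak_solution_def
  proof (intro exI[of _ "\<lambda>_. 0"] exI[of _ "\<lambda>_ _. 0"] conjI ballI)
    show "has_weak_deriv ?Q u v (\<lambda>_. 0)" "has_weak_deriv ?Q u v (\<lambda>_. 0)" for v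
      using Q u0 by (auto intro!: has_weak_deriv_ae_zero)
    fix \<eta> :: "real \<times> 'n space \<Rightarrow> real"
    have "(LINT (t, x)|lebesgue_on ?Q. 0 * \<eta> (t, x)
             + (\<Sum>i\<in>Basis. \<Sum>j\<in>Basis. a i j x * 0 * pderiv_dir (0, i) \<eta> (t, x))
             - (\<Sum>i\<in>Basis. b i x * 0 * \<eta> (t, x)) - c x * u (t, x) * \<eta> (t, x)) = (LINT z::real \<times> 'n space|lborel. 0)"
      by (rule LINT_rep) (use Q u0 in \<open>auto elim!: eventually_mono\<close>)
    then show "(LINT (t, x)|lebesgue_on ?Q. 0 * \<eta> (t, x)
             + (\<Sum>i\<in>Basis. \<Sum>j\<in>Basis. a i j x * 0 * pderiv_dir (0, i) \<eta> (t, x))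
             - (\<Sum>i\<in>Basis. b i x * 0 * \<eta> (t, x)) - c x * u (t, x) * \<eta> (t, x)) = 0" by simp
  qed
  moreover have "vanishes_on_boundary W u"
    unfolding vanishes_on_boundary_def
  proof
    fix \<psi> :: "real \<Rightarrow> real"
    have "AE t in lborel. t \<in> {..<0} \<longrightarrow> (\<lambda>x. \<psi> (fst x) * u (t, x)) \<in> W12_0 ?S"
      using AE_slices[OF u0]
    proof eventually_elim
      case (elim t)
      show ?case
      proof
        assume "t \<in> {..<0::real}"
        then have "AE x in lborel. x \<in> ?S \<longrightarrow> \<psi> (fst x) * u (t, x) = 0"
          using elim by (auto elim!: eventually_mono)
        then show "(\<lambda>x. \<psi> (fst x) * u (t, x)) \<in> W12_0 ?S" using S by (intro W12_0_ae_zero) auto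
      qed
    qed
    then show "AE t in lebesgue_on {..<0}. (\<lambda>x. \<psi> (fst x) * u (t, x)) \<in> W12_0 ?S"
      by (subst AE_lebesgue_on_iff) auto
  qed
  moreover have "AE (t, x) in lebesgue_on ({..0} \<times> ?S). \<bar>u (t, x)\<bar> \<le> 1 * (norm x + sqrt \<bar>t\<bar> + 1) powr d"
    unfolding AE_past_iff[OF S] using u0 by eventually_elim auto
  ultimately show ?thesis unfolding P_space_def mem_Collect_eq by (intro conjI exI[of _ 1]) auto
qed

lemma P_space_subset_ae_zero:
  fixes W :: "(real ^ 'n::finite) set"
  assumes W: "open W" "bounded W" "measure lebesgue W = V" and V: "V > 0" and lam: "lam > 0" "lam < \<Lambda>"
    and r: "measure lborel (ball (0::real ^ 'n) r) \<ge> 2 * V" "r > 0"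
    and \<kappa>: "\<kappa> = lam * V / (4 * (r\<^sup>2 * measure lborel (ball (0::real ^ 'n) r)))"
    and eps: "eps \<ge> 0" "eps * real DIM('n space) / lam + eps \<le> \<kappa>"
    and adm: "admissible_coeffs lam \<Lambda> eps (strip W) a b c" and d: "d > 0" and u: "u \<in> P_space W a b c d"
  shows "u \<in> ae_zero W"
proof -
  let ?S = "strip W" and ?Q = "{..<0::real} \<times> strip W"
  have S: "open ?S" unfolding strip_def using W by (intro open_Times) auto
  from u obtain C where loc: "u \<in> W12_loc W" and sol: "weak_solution W a b c u" and bd: "vanishes_on_boundary W u"
    and C: "C > 0" and gr: "AE (t, x) in lebesgue_on ({..0} \<times> ?S). \<bar>u (t, x)\<bar> \<le> C * (norm x + sqrt \<bar>t\<bar> + 1) powr d"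
    unfolding P_space_def by blast
  obtain Kc a' b' c' u' D where sys: "strip_solution W lam \<Lambda> eps Kc a' b' c' u' D"
    and eq: "AE z in lborel. z \<in> ?Q \<longrightarrow> u' z = u z" and u'0: "\<And>z. z \<notin> ?Q \<Longrightarrow> u' z = 0"
    by (rule strip_solution_exists[OF W(1,2) lam eps(1) adm loc sol bd]) blast
  have eV: "emeasure lborel W = ennreal V" using emeasure_lborel_open_bounded[OF W(1,2)] W(3) by simp
  have "AE z in lborel. z \<in> ?Q \<longrightarrow> \<bar>u z\<bar> \<le> C * (norm (snd z) + sqrt \<bar>fst z\<bar> + 1) powr d"
    using gr unfolding AE_past_iff[OF S] by (simp add: case_prod_unfold)
  with eq have "AE z in lborel. \<bar>u' z\<bar> \<le> C * (norm (snd z) + sqrt \<bar>fst z\<bar> + 1) powr d"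
  proof eventually_elim
    case (elim z)
    then show ?case using u'0[of z] C by (cases "z \<in> ?Q") auto
  qed
  from strip_solution.vanish[OF sys eV V r \<kappa> refl eps(2) this C d]
  have "AE z in lborel. u' z = 0" .
  with eq have "AE z in lborel. z \<in> ?Q \<longrightarrow> u z = 0" by eventually_elim auto
  then show ?thesis unfolding ae_zero_def mem_Collect_eq AE_past_iff[OF S] .
qed

theorem theorem1p2:
  fixes lam V\<^sub>0 :: real
  assumes "lam > 0" and "V\<^sub>0 > 0"
  shows "\<exists>\<epsilon>\<^sub>0>0. \<forall>(\<Omega>\<^sub>0 :: (real ^ 'n::finite) set) \<Lambda> a b c.
    bounded \<Omega>\<^sub>0 \<and> open \<Omega>\<^sub>0 \<and> measure lebesgue \<Omega>\<^sub>0 = V\<^sub>0 \<and> \<Lambda> > lam \<and>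
    admissible_coeffs lam \<Lambda> \<epsilon>\<^sub>0 (strip \<Omega>\<^sub>0) a b c \<longrightarrow>
    (\<forall>d>0. P_space \<Omega>\<^sub>0 a b c d = ae_zero \<Omega>\<^sub>0)"
proof -
  obtain r where r: "r > 0" "measure lborel (ball (0::real ^ 'n) r) \<ge> 2 * V\<^sub>0"
    using exists_ball_measure_ge by blast
  define \<kappa> where "\<kappa> = lam * V\<^sub>0 / (4 * (r\<^sup>2 * measure lborel (ball (0::real ^ 'n) r)))"
  define N where "N = real DIM('n space)"
  \<comment> \<open>Chosen so that \<open>\<epsilon>\<^sub>0 * N / lam + \<epsilon>\<^sub>0\<close>
    equals \<open>\<kappa>\<close>. Both \<open>r\<close> and \<open>\<kappa>\<close> are fixed by
    the dimension, \<open>lam\<close> and the volume, before the cross-section,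
    \<open>\<Lambda>\<close> and \<open>d\<close> are given.\<close>
  define \<epsilon>\<^sub>0 where "\<epsilon>\<^sub>0 = \<kappa> / (N / lam + 1)"
  have "\<kappa> > 0" unfolding \<kappa>_def using r assms by (intro divide_pos_pos mult_pos_pos) auto
  moreover have N1: "N / lam + 1 > 0" unfolding N_def using assms by (intro add_nonneg_pos) auto
  ultimately have "\<epsilon>\<^sub>0 > 0" by (simp add: \<epsilon>\<^sub>0_def)
  have "\<epsilon>\<^sub>0 * (N / lam + 1) = \<kappa>" unfolding \<epsilon>\<^sub>0_def using N1 by simp
  then have small: "\<epsilon>\<^sub>0 * N / lam + \<epsilon>\<^sub>0 \<le> \<kappa>" by (simp add: distrib_left)
  show ?thesis
  proof (intro exI[of _ \<epsilon>\<^sub>0] conjI allI impI equalityI subsetI)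
    show "\<epsilon>\<^sub>0 > 0" by fact
    fix \<Omega>\<^sub>0 :: "(real ^ 'n) set" and \<Lambda> a b c d u
    assume A: "bounded \<Omega>\<^sub>0 \<and> open \<Omega>\<^sub>0 \<and> measure lebesgue \<Omega>\<^sub>0 = V\<^sub>0 \<and> \<Lambda> > lam \<and> admissible_coeffs lam \<Lambda> \<epsilon>\<^sub>0 (strip \<Omega>\<^sub>0) a b c"
      and d: "(0::real) < d"
    show "u \<in> P_space \<Omega>\<^sub>0 a b c d" if "u \<in> ae_zero \<Omega>\<^sub>0" using A that by (intro ae_zero_subset_P_space) auto
    show "u \<in> ae_zero \<Omega>\<^sub>0" if "u \<in> P_space \<Omega>\<^sub>0 a b c d"
      by (rule P_space_subset_ae_zero[OF _ _ _ assms(2,1) _ r(2,1) \<kappa>_def _ small[unfolded N_def] _ d that])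
        (use A \<open>\<epsilon>\<^sub>0 > 0\<close> in auto)
  qed
qed

end
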